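(* For all complex numbers $a,b$ the following identities hold: \begin{align*} &(1)\ \sum_{i,j,k\geq 0}\frac{q^{i^2/2+3j^2+2k^2+2ij+2ik+4jk+3i/2+3j+2k}}{(q;q)_i(q^2;q^2)_j(q^2;q^2)_k}=\frac{(q,q^7,q^8;q^8)_\infty}{(q;q)_\infty},\\ &(2)\ \sum_{i,j,k\geq 0}\frac{q^{i^2/2+3j^2+2k^2+2ij+2ik+4jk+i/2+j}}{(q;q)_i(q^2;q^2)_j(q^2;q^2)_k}=\frac{(q^3,q^5,q^8;q^8)_\infty}{(q;q)_\infty},\\ &(3)\ \sum_{i,j,k\geq 0}\frac{(-1)^{i+j}q^{i^2/2+3j^2+2k^2+2ij+2ik+4jk+3i/2+2j+k}}{(q;q)_i(q^2;q^2)_j(q^2;q^2)_k}=(q^2;q^2)_\infty,\\ &(4)\ \sum_{i,j,k\geq 0}\frac{(-1)^jq^{i^2/2+3j^2+2k^2+2ij+2ik+4jk+3i/2+2j+2k}}{(q;q)_i(q^2;q^2)_j(q^2;q^2)_k}=\frac{(q,q^5,q^6;q^6)_\infty}{(q;q)_\infty},\\ &(5)\ \sum_{i,j,k\geq 0}\frac{(-1)^jq^{i^2+6j^2+4k^2+4ij+4ik+8jk+i-4j-4k}}{(q^2;q^2)_i(q^4;q^4)_j(q^4;q^4)_k}= \frac{2}{(q^4,q^6,q^8;q^{12})_\infty},\\ &(6)\ \sum_{i,j,k\geq 0}\frac{(-1)^jq^{i^2+6j^2+4k^2+4ij+4ik+8jk+i}}{(q^2;q^2)_i(q^4;q^4)_j(q^4;q^4)_k}=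 \frac{(q^6,q^6,q^{12};q^{12})_\infty}{(q^2;q^{2})_\infty},\\ &(7)\ \sum_{i,j,k\geq 0}\frac{q^{i^2/2+3j^2+2k^2+2ij+2ik+4jk+i/2}a^{j+k}}{(q;q)_i(q^2;q^2)_j(q^2;q^2)_k}=(-q;q)_\infty (-aq^2;q^4)_\infty,\\ &(8)\ \sum_{i,j,k\geq 0}\frac{q^{i^2/2+3j^2+2k^2+2ij+2ik+4jk+3i/2+2j}a^{j+k}}{(q;q)_i(q^2;q^2)_j(q^2;q^2)_k}= (-q^2;q)_\infty (-aq^2;q^4)_\infty,\\ &(9)\ \sum_{i,j,k\geq 0}\frac{q^{i^2+6j^2+4k^2+4ij+4ik+8jk-i-2j}}{(q^2;q^2)_i(q^4;q^4)_j(q^4;q^4)_k}= \frac{2(q^6,q^{10},q^{16};q^{16})_\infty}{(q^2;q^2)_\infty},\\ &(10)\ \sum_{i,j,k\geq 0}\frac{(-1)^jq^{i^2+6j^2+4k^2+4ij+4ik+8jk+2k}a^ib^{j+k}}{(q^2;q^2)_i(q^4;q^4)_j(q^4;q^4)_k}=(-aq;q^2)_\infty,\\ &(11)\ \sum_{i,j,k\geq 0}\frac{(-1)^{i+j}q^{i^2+6j^2+4k^2+4ij+4ik+8jk-2i-6j-5k}a^{i+2j+k}}{(q^2;q^2)_i(q^4;q^4)_j(q^4;q^4)_k}= (aq;q^4)_\infty,\\ &(12)\ \sum_{i,j,k\geq 0}\frac{(-1)^{i+j}q^{i^2+6j^2+4k^2+4ij+4ik+8jk-i-2j-4k}}{(q^2;q^2)_i(q^4;q^4)_j(q^4;q^4)_k}=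 (q^6,q^{10},q^{16};q^{16})_\infty(q^4,q^{28};q^{32})_\infty,\\ &(13)\ \sum_{i,j,k\geq 0}\frac{(-1)^{i+j}q^{i^2+6j^2+4k^2+4ij+4ik+8jk-2j-k}a^{i+2j+k}}{(q^2;q^2)_i(q^4;q^4)_j(q^4;q^4)_k}= (aq;q^4)_\infty,\\ &(14)\ \sum_{i,j,k\geq 0}\frac{(-1)^{i+j}q^{i^2+6j^2+4k^2+4ij+4ik+8jk-i-4j-2k}a^{i+2j+2k}}{(q^2;q^2)_i(q^4;q^4)_j(q^4;q^4)_k}= (a;q^2)_\infty,\\ &(15)\ \sum_{i,j,k\geq 0}\frac{(-1)^{i+j}q^{i^2+6j^2+4k^2+4ij+4ik+8jk-i-6j}a^i}{(q^2;q^2)_i(q^4;q^4)_j(q^4;q^4)_k}= (a;q^2)_\infty-(aq^4;q^2)_\infty,\\ &(16)\ \sum_{i,j,k\geq 0}\frac{(-1)^{i+j}q^{i^2+6j^2+4k^2+4ij+4ik+8jk+i-4j-4k}}{(q^2;q^2)_i(q^4;q^4)_j(q^4;q^4)_k}= 2(q^2;q^4)_\infty. \end{align*}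
   Context: Here $q$ is a complex number with $0<|q|<1$. For $|p|<1$, $(a;p)_\infty=\prod_{n\ge 0}(1-ap^n)$, and $(a;p)_n=(a;p)_\infty/(ap^n;p)_\infty=\prod_{k=0}^{n-1}(1-ap^k)$ for integers $n\ge 0$; $(a_1,\dots,a_m;p)_n=\prod_{k=1}^m(a_k;p)_n$ for $n\in\mathbb{N}\cup\{\infty\}$. Sums run over all triples of nonnegative integers $(i,j,k)$; all exponents of $q$ are integers; $0^0=1$. *)

theory Defs
  imports "HOL-Analysis.Analysis"
begin

definition qpoch :: "complex \<Rightarrow> complex \<Rightarrow> nat \<Rightarrow> complex" where
  "qpoch a p n = (\<Prod>k<n. 1 - a * p ^ k)"

(* The library's has_prod / prodinf admits finitely many vanishing factors (the value is then 0),
   so this agrees with the usual (a;p)_infinity for every a whenever norm p < 1. *)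
definition qpoch_inf :: "complex \<Rightarrow> complex \<Rightarrow> complex" where
  "qpoch_inf a p = (\<Prod>n. 1 - a * p ^ n)"

definition qpochs_inf :: "complex list \<Rightarrow> complex \<Rightarrow> complex" where
  "qpochs_inf as p = (\<Prod>a\<leftarrow>as. qpoch_inf a p)"

end

(*
  Summing over i by Euler's identity and over j + k = m by the finite q-binomial theorem turns the triple
  sum of q^((i + 2 j + 2 k)^2 + 2 j^2) x^i y^j z^k / ((q^2;q^2)_i (q^4;q^4)_j (q^4;q^4)_k) into
    sum_m q^(4 m^2) z^m (A;q^4)_m (B q^(4 m);q^2)_inf / (q^4;q^4)_m,   A = - q^2 y / z,  B = - x q.
  All sixteen left-hand sides have this shape, with sqrt q in place of q in (1)-(4), (7) and (8).
  The sum over m terminates in (10), (14) and (15), is Euler's in (7) and (8), reduces to Cauchy's sum in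
  (11), (13) and (16), and is the odd part of an Euler sum in (3).  In (1), (2), (9) and (12) it is the even
  or odd part of an Euler product, which becomes a theta function when multiplied by (q^4;q^4)_inf.
  In (4), (5) and (6) the summand is expanded by the finite triple product and the order of summation is
  exchanged (Bailey's lemma); the inner sums are Cauchy's and the outer one is a theta function.
*)

theory Submission
  imports Defs
begin

section \<open>The q-Pochhammer symbol\<close>

text \<open>The parameters a and b are arbitrary, so infinite products may vanish and z may be 0.
  Identities are therefore kept free of division: the q-binomial theorem is homogeneous in y and z,
  Cauchy's sum carries its infinite product in the numerator, and A is specified by y q^2 = - z A.
  Only when B is a fixed value with no vanishing factor is (B;q^2)_inf pulled out of the sum over m.
  Bases are squares (b^2, and Q = q^2), which replaces n(n-1)/2 by n^2 in all exponents. Parity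
  separation works because replacing s by -s inserts (-1)^n both in Euler's series, with exponents
  n^2, and in its theta form, with exponents 2n^2 - n; corresponding parts must agree. In (1), (2)
  and (9) the result is applied at -Q, and (-Q;Q)_inf = (Q^2;Q^2)_inf / (Q;Q)_inf produces the
  stated denominator. All sums are unconditional. Wherever an order of summation changes,
  summability comes first, from a Gaussian majorant; the value is named, the sum rearranged, and the
  value identified by uniqueness.\<close>

lemma qpoch_0 [simp]: "qpoch a p 0 = 1"
  by (simp add: qpoch_def)

lemma qpoch_Suc: "qpoch a p (Suc n) = qpoch a p n * (1 - a * p ^ n)"
  by (simp add: qpoch_def)

lemma qpoch_add: "qpoch a p (m + n) = qpoch a p m * qpoch (a * p ^ m) p n"
  by (induction n) (simp_all add: qpoch_Suc power_add mult_ac)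

lemma qpoch_Suc_shift: "qpoch a p (Suc n) = (1 - a) * qpoch (a * p) p n"
  using qpoch_add[of a p 1 n] by (simp add: qpoch_Suc)

lemma qpoch_square: "qpoch (a\<^sup>2) (p\<^sup>2) n = qpoch a p n * qpoch (- a) p n"
proof (induction n)
  case (Suc n)
  have "1 - a\<^sup>2 * (p\<^sup>2) ^ n = (1 - a * p ^ n) * (1 - (- a) * p ^ n)"
  proof -
    have "(p\<^sup>2) ^ n = (p ^ n)\<^sup>2" by (metis power_mult mult.commute)
    then show ?thesis by (simp add: power2_eq_square algebra_simps)
  qed
  then show ?case
    by (simp add: qpoch_Suc Suc)
qed simp

text \<open>Factors are sorted by the residue \<open>r\<close> of their index modulo
  \<open>m\<close>. In the limit this splits a product in base \<open>p\<close> into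
  \<open>m\<close> products in base \<open>p ^ m\<close>.\<close>

lemma qpoch_mult: "qpoch a p (n * m) = (\<Prod>r<m. qpoch (a * p ^ r) (p ^ m) n)"
proof (induction n)
  case (Suc n)
  have "qpoch a p (Suc n * m) = qpoch a p (n * m) * qpoch (a * p ^ (n * m)) p m"
    by (simp add: add.commute flip: qpoch_add)
  also have "qpoch (a * p ^ (n * m)) p m = (\<Prod>r<m. 1 - a * p ^ r * (p ^ m) ^ n)"
    unfolding qpoch_def by (intro prod.cong refl) (simp add: mult_ac flip: power_mult)
  finally show ?case
    by (simp add: Suc qpoch_Suc prod.distrib)
qed simp

lemma qpoch_tendsto:
  assumes "norm p < 1"
  shows "(\<lambda>n. qpoch a p n) \<longlonglongrightarrow> qpoch_inf a p"
proof -
  have "summable (\<lambda>n. norm (1 - a * p ^ n - 1))"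
    using assms by (simp add: norm_mult norm_power summable_mult)
  then have "convergent_prod (\<lambda>n. 1 - a * p ^ n)"
    by (intro abs_convergent_prod_imp_convergent_prod summable_imp_abs_convergent_prod)
  then show ?thesis
    using convergent_prod_LIMSEQ
    by (auto simp: qpoch_inf_def qpoch_def LIMSEQ_lessThan_iff_atMost)
qed

lemma qpoch_inf_split:
  assumes "norm p < 1"
  shows "qpoch_inf a p = qpoch a p n * qpoch_inf (a * p ^ n) p"
proof (rule LIMSEQ_unique)
  show "(\<lambda>k. qpoch a p (n + k)) \<longlonglongrightarrow> qpoch_inf a p"
    using LIMSEQ_ignore_initial_segment[OF qpoch_tendsto[OF assms], of a n] by (simp add: add.commute)
  show "(\<lambda>k. qpoch a p (n + k)) \<longlonglongrightarrow> qpoch a p n * qpoch_inf (a * p ^ n) p"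
    unfolding qpoch_add by (intro tendsto_intros qpoch_tendsto assms)
qed

lemma qpoch_inf_rec:
  assumes "norm p < 1"
  shows "qpoch_inf a p = (1 - a) * qpoch_inf (a * p) p"
  using qpoch_inf_split[OF assms, of a 1] by (simp add: qpoch_Suc)

lemma qpoch_inf_eq_0:
  assumes "norm p < 1" "a * p ^ n = 1"
  shows "qpoch_inf a p = 0"
  using qpoch_inf_split[OF assms(1), of a "Suc n"] assms(2) by (simp add: qpoch_Suc)

lemma qpoch_inf_nonzero:
  assumes "norm p < 1" "\<And>n. a * p ^ n \<noteq> 1"
  shows "qpoch_inf a p \<noteq> 0"
proof -
  have "summable (\<lambda>n. norm (1 - a * p ^ n - 1))"
    using assms(1) by (simp add: norm_mult norm_power summable_mult)
  then have "convergent_prod (\<lambda>n. 1 - a * p ^ n)"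
    by (intro abs_convergent_prod_imp_convergent_prod summable_imp_abs_convergent_prod)
  then show ?thesis
    unfolding qpoch_inf_def using assms(2) by (intro prodinf_nonzero) auto
qed

lemma norm_mult_power_less_1:
  fixes a p :: complex
  assumes "norm p < 1" "norm a < 1"
  shows "norm (a * p ^ n) < 1"
proof -
  have "norm (a * p ^ n) \<le> norm a * 1"
    unfolding norm_mult norm_power using assms by (intro mult_left_mono power_le_one) auto
  then show ?thesis using assms by simp
qed

lemma qpoch_inf_nonzero_norm:
  assumes "norm p < 1" "norm a < 1"
  shows "qpoch_inf a p \<noteq> 0"
proof (rule qpoch_inf_nonzero)
  show "a * p ^ n \<noteq> 1" for n
    using norm_mult_power_less_1[OF assms, of n] by (metis less_irrefl norm_one)
qed (fact assms)

lemma qpoch_nonzero: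
  assumes "norm p < 1" "norm a < 1"
  shows "qpoch a p n \<noteq> 0"
  using qpoch_inf_nonzero_norm[OF assms] qpoch_inf_split[OF assms(1), of a n] by auto

lemma norm_power_less_1:
  fixes q :: complex
  assumes "norm q < 1" "0 < n"
  shows "norm (q ^ n) < 1"
  using assms by (simp add: norm_power power_less_one_iff)

lemma qpoch_inf_dissect:
  assumes "norm p < 1" "0 < m"
  shows "qpoch_inf a p = (\<Prod>r<m. qpoch_inf (a * p ^ r) (p ^ m))"
proof (rule LIMSEQ_unique)
  show "(\<lambda>n. qpoch a p (n * m)) \<longlonglongrightarrow> qpoch_inf a p"
    using LIMSEQ_subseq_LIMSEQ[OF qpoch_tendsto[OF assms(1)], of "\<lambda>n. n * m"] assms(2)
    by (simp add: o_def strict_mono_def)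
  show "(\<lambda>n. qpoch a p (n * m)) \<longlonglongrightarrow> (\<Prod>r<m. qpoch_inf (a * p ^ r) (p ^ m))"
    unfolding qpoch_mult by (intro tendsto_intros qpoch_tendsto norm_power_less_1 assms)
qed

lemma qpoch_inf_square:
  assumes "norm p < 1"
  shows "qpoch_inf (a\<^sup>2) (p\<^sup>2) = qpoch_inf a p * qpoch_inf (- a) p"
proof (rule LIMSEQ_unique)
  show "(\<lambda>n. qpoch (a\<^sup>2) (p\<^sup>2) n) \<longlonglongrightarrow> qpoch_inf (a\<^sup>2) (p\<^sup>2)"
    by (intro qpoch_tendsto norm_power_less_1 assms) auto
  show "(\<lambda>n. qpoch (a\<^sup>2) (p\<^sup>2) n) \<longlonglongrightarrow> qpoch_inf a p * qpoch_inf (- a) p"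
    unfolding qpoch_square by (intro tendsto_intros qpoch_tendsto assms)
qed

text \<open>The limit \<open>qpoch_inf a p\<close> is nonzero, so the reciprocals converge too. The
  bound lets a q-series be majorised by the same series without its denominators.\<close>

lemma inverse_qpoch_bounded:
  assumes "norm p < 1" "norm a < 1"
  obtains C where "0 < C" "\<And>n. norm (1 / qpoch a p n) \<le> C"
proof -
  have "(\<lambda>n. 1 / qpoch a p n) \<longlonglongrightarrow> 1 / qpoch_inf a p"
    by (intro tendsto_intros qpoch_tendsto qpoch_inf_nonzero_norm assms)
  then have "Bseq (\<lambda>n. 1 / qpoch a p n)"
    by (intro convergent_imp_Bseq convergentI)
  then show ?thesis
    using that by (auto simp: Bseq_def)
qed

section \<open>Unconditional sums over product sets and Gaussian majorants\<close>

lemma summable_on_product_complex: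
  fixes f :: "'a \<Rightarrow> complex" and g :: "'b \<Rightarrow> complex"
  assumes "f summable_on A" "g summable_on B"
  shows "(\<lambda>(x, y). f x * g y) summable_on A \<times> B"
proof -
  have f: "(\<lambda>x. norm (f x)) summable_on A" and g: "(\<lambda>x. norm (g x)) summable_on B"
    using assms by (simp_all add: summable_on_iff_abs_summable_on_complex)
  have "(\<lambda>z. norm (case z of (x, y) \<Rightarrow> f x * g y)) summable_on A \<times> B"
    unfolding Infinite_Sum.abs_summable_on_Sigma_iff
    using f g
    by (auto simp: norm_mult infsum_cmult_right' infsum_nonneg intro!: summable_on_cmult_right summable_on_cmult_left)
  then show ?thesis
    by (rule abs_summable_summable)
qed

lemma has_sum_product_complex:
  fixes f :: "'a \<Rightarrow> complex" and g :: "'b \<Rightarrow> complex"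
  assumes "(f has_sum S) A" "(g has_sum T) B"
  shows "((\<lambda>(x, y). f x * g y) has_sum (S * T)) (A \<times> B)"
proof (rule has_sum_SigmaI)
  show "((\<lambda>y. case (x, y) of (x, y) \<Rightarrow> f x * g y) has_sum (f x * T)) B" for x
    using has_sum_cmult_right[OF assms(2), of "f x"] by simp
  show "((\<lambda>x. f x * T) has_sum (S * T)) A"
    using has_sum_cmult_left[OF assms(1)] .
  show "(\<lambda>(x, y). f x * g y) summable_on A \<times> B"
    using assms by (intro summable_on_product_complex has_sum_imp_summable)
qed

lemma summable_on_bounded_mult:
  fixes f g :: "'a \<Rightarrow> complex"
  assumes "f summable_on A" "\<And>x. x \<in> A \<Longrightarrow> norm (g x) \<le> C * norm (f x)"
  shows "g summable_on A"
proof -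
  have "(\<lambda>x. C * norm (f x)) summable_on A"
    using assms(1) by (intro summable_on_cmult_right) (simp flip: summable_on_iff_abs_summable_on_complex)
  then have "(\<lambda>x. norm (g x)) summable_on A"
    by (rule Infinite_Sum.abs_summable_on_comparison_test') (use assms(2) in auto)
  then show ?thesis by (rule abs_summable_summable)
qed

text \<open>Root test: the n-th root of the n-th term is \<open>norm b ^ n * norm x\<close>, which
  tends to 0 for every \<open>x\<close>, so it eventually drops below 1/2.\<close>

lemma summable_gauss:
  fixes b x :: complex
  assumes "norm b < 1"
  shows "summable (\<lambda>n. norm (b ^ (n\<^sup>2) * x ^ n))"
proof -
  have "(\<lambda>n. norm b ^ n * norm x) \<longlonglongrightarrow> 0 * norm x"
    using assms by (intro tendsto_intros LIMSEQ_power_zero) auto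
  then have "eventually (\<lambda>n. norm b ^ n * norm x < 1/2) sequentially"
    by (auto dest: order_tendstoD(2)[of _ _ _ "1/2"])
  then have *: "eventually (\<lambda>n. norm (norm (b ^ (n\<^sup>2) * x ^ n)) \<le> (1/2) ^ n) sequentially"
  proof eventually_elim
    case (elim n)
    have "norm (b ^ (n\<^sup>2) * x ^ n) = (norm b ^ n * norm x) ^ n"
      by (simp add: norm_mult norm_power power_mult_distrib power2_eq_square flip: power_mult)
    also have "\<dots> \<le> (1/2) ^ n"
      using elim by (intro power_mono) auto
    finally show ?case by simp
  qed
  show ?thesis
    by (rule summable_comparison_test_ev[OF *]) (simp add: summable_geometric)
qed

lemma summable_on_gauss:
  fixes b x :: complex
  assumes "norm b < 1"
  shows "(\<lambda>n. b ^ (n\<^sup>2) * x ^ n) summable_on (UNIV :: nat set)"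
  using norm_summable_imp_summable_on[OF summable_gauss[OF assms]] .

lemma int_UNIV_split: "(UNIV :: int set) = range int \<union> (\<lambda>n. - int n) ` {0<..}"
proof -
  have "x \<in> range int \<union> (\<lambda>n. - int n) ` {0<..}" for x :: int
    by (cases "x \<ge> 0") (auto intro: image_eqI[of x _ "nat (- x)"] image_eqI[of x int "nat x"])
  then show ?thesis by blast
qed

text \<open>The negative half is the one-sided series again, taken at \<open>inverse x\<close>; this
  is where \<open>x\<close> must be nonzero.\<close>

lemma summable_on_gauss_int:
  fixes b x :: complex
  assumes "norm b < 1" "x \<noteq> 0"
  shows "(\<lambda>n. b powi (n\<^sup>2) * x powi n) summable_on (UNIV :: int set)"
proof -
  have 1: "(\<lambda>n. b powi (n\<^sup>2) * x powi n) summable_on range int"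
    using summable_on_gauss[OF assms(1), of x]
    by (subst summable_on_reindex) (auto simp: o_def simp flip: of_nat_power)
  have 2: "(\<lambda>n. b powi (n\<^sup>2) * x powi n) summable_on (\<lambda>n. - int n) ` {0<..}"
    using summable_on_gauss[OF assms(1), of "inverse x"] assms(2)
    by (subst summable_on_reindex)
       (auto simp: o_def inj_on_def power_int_minus power_inverse intro: summable_on_subset_banach simp flip: of_nat_power)
  show ?thesis
    unfolding int_UNIV_split by (intro summable_on_union 1 2)
qed

section \<open>Euler, q-binomial and Cauchy sums\<close>

lemma norm_square_less_1: "norm (b\<^sup>2) < 1" if "norm b < 1" for b :: complex
  by (rule norm_power_less_1[OF that]) simp

lemma qpoch_base_nonzero:
  assumes "norm p < 1"
  shows "qpoch p p n \<noteq> 0"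
  using assms by (intro qpoch_nonzero)

lemma qpoch_square_base_Suc:
  "qpoch (b\<^sup>2) (b\<^sup>2) (Suc n) = qpoch (b\<^sup>2) (b\<^sup>2) n * (1 - b ^ (2 * Suc n))"
  unfolding power_mult by (simp add: qpoch_Suc)

text \<open>The coefficient recursion \<open>c_rec\<close> is equivalent to the functional equation
  \<open>E t = (1 + t * b) * E (t * b\<^sup>2)\<close>. Iterating it drives the argument to 0, where
  the power series is continuous with value 1, and leaves the infinite product.\<close>

lemma euler_sum:
  fixes b t :: complex
  assumes b: "norm b < 1"
  shows "((\<lambda>n. b ^ (n\<^sup>2) * t ^ n / qpoch (b\<^sup>2) (b\<^sup>2) n) has_sum qpoch_inf (- t * b) (b\<^sup>2)) UNIV"
proof -
  define c where "c n = b ^ (n\<^sup>2) / qpoch (b\<^sup>2) (b\<^sup>2) n" for n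
  define E where "E t = (\<Sum>n. c n * t ^ n)" for t
  have b2: "norm (b\<^sup>2) < 1"
    using norm_square_less_1[OF b] .
  obtain C where C: "\<And>n. norm (1 / qpoch (b\<^sup>2) (b\<^sup>2) n) \<le> C"
    using inverse_qpoch_bounded[OF b2 b2] by metis
  have norm_summable: "summable (\<lambda>n. norm (c n * t ^ n))" for t
  proof (rule summable_comparison_test')
    show "summable (\<lambda>n. C * norm (b ^ (n\<^sup>2) * t ^ n))"
      by (intro summable_mult summable_gauss b)
    show "norm (norm (c n * t ^ n)) \<le> C * norm (b ^ (n\<^sup>2) * t ^ n)" for n
      using mult_right_mono[OF C[of n], of "norm (b ^ (n\<^sup>2) * t ^ n)"]
      by (simp add: c_def norm_mult norm_divide mult_ac)
  qed
  have sums: "(\<lambda>n. c n * t ^ n) sums E t" for t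
    unfolding E_def by (rule summable_sums[OF summable_norm_cancel[OF norm_summable]])
  have c_rec: "c (Suc n) * (1 - b ^ (2 * Suc n)) = b ^ (2 * n + 1) * c n" for n
  proof -
    have "b ^ ((Suc n)\<^sup>2) = b ^ (2 * n + 1) * b ^ (n\<^sup>2)"
      unfolding power_add[symmetric] by (rule arg_cong[of _ _ "power b"]) (simp add: power2_eq_square)
    moreover have "1 - b ^ (2 * Suc n) \<noteq> 0"
      using qpoch_base_nonzero[OF b2, of "Suc n"] unfolding qpoch_square_base_Suc by auto
    ultimately show ?thesis
      unfolding c_def qpoch_square_base_Suc by (simp del: mult_Suc_right)
  qed
  have E_rec: "E t = (1 - (- t * b)) * E (t * b\<^sup>2)" for t
  proof -
    have "(\<lambda>n. t * b * (c n * (t * b\<^sup>2) ^ n)) sums (t * b * E (t * b\<^sup>2))"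
      by (intro sums_mult sums)
    also have "(\<lambda>n. t * b * (c n * (t * b\<^sup>2) ^ n)) =
        (\<lambda>n. c (Suc n) * t ^ Suc n - c (Suc n) * (t * b\<^sup>2) ^ Suc n)"
    proof
      fix n
      have "c (Suc n) * t ^ Suc n - c (Suc n) * (t * b\<^sup>2) ^ Suc n =
          t ^ Suc n * (c (Suc n) * (1 - b ^ (2 * Suc n)))"
        unfolding power_mult power_mult_distrib by (simp add: algebra_simps)
      also have "\<dots> = t * b * (c n * (t * b\<^sup>2) ^ n)"
        unfolding c_rec unfolding power_mult_distrib power_add power_mult by simp
      finally show "t * b * (c n * (t * b\<^sup>2) ^ n) =
        c (Suc n) * t ^ Suc n - c (Suc n) * (t * b\<^sup>2) ^ Suc n" ..
    qed
    finally have "(\<lambda>n. c n * t ^ n - c n * (t * b\<^sup>2) ^ n) sums (t * b * E (t * b\<^sup>2))"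
      by (rule sums_Suc_imp[rotated]) simp
    moreover have "(\<lambda>n. c n * t ^ n - c n * (t * b\<^sup>2) ^ n) sums (E t - E (t * b\<^sup>2))"
      by (intro sums_diff sums)
    ultimately have "t * b * E (t * b\<^sup>2) = E t - E (t * b\<^sup>2)"
      by (rule sums_unique2)
    then show ?thesis
      by (simp add: algebra_simps)
  qed
  have E_iter: "E t = qpoch (- t * b) (b\<^sup>2) n * E (t * (b\<^sup>2) ^ n)" for n
  proof (induction n)
    case (Suc n)
    then show ?case
      using E_rec[of "t * (b\<^sup>2) ^ n"] by (simp add: qpoch_Suc mult_ac)
  qed simp
  have "isCont E 0"
    unfolding E_def by (rule isCont_powser[of c 1]) (use summable_norm_cancel[OF norm_summable[of 1]] in auto)
  moreover have "(\<lambda>n. t * (b\<^sup>2) ^ n) \<longlonglongrightarrow> t * 0"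
    by (intro tendsto_intros LIMSEQ_power_zero b2)
  ultimately have "(\<lambda>n. E (t * (b\<^sup>2) ^ n)) \<longlonglongrightarrow> E 0"
    by (intro isCont_tendsto_compose[of 0 E]) auto
  then have "(\<lambda>n. qpoch (- t * b) (b\<^sup>2) n * E (t * (b\<^sup>2) ^ n)) \<longlonglongrightarrow> qpoch_inf (- t * b) (b\<^sup>2) * E 0"
    by (intro tendsto_intros qpoch_tendsto b2)
  then have "E t = qpoch_inf (- t * b) (b\<^sup>2) * E 0"
    unfolding E_iter[symmetric] by (simp add: LIMSEQ_const_iff)
  also have "E 0 = 1"
    unfolding E_def powser_zero by (simp add: c_def)
  finally show ?thesis
    using norm_summable_imp_has_sum[OF norm_summable sums, of t] by (simp add: c_def)
qed

text \<open>Same method as for \<open>euler_sum\<close>, with the functional equation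
  \<open>(1 - t) * E t = E (t * p)\<close>; the series now converges only inside the unit
  disc.\<close>

lemma euler_reciprocal_sum:
  fixes p t :: complex
  assumes p: "norm p < 1" and t: "norm t < 1"
  shows "((\<lambda>n. t ^ n / qpoch p p n) has_sum 1 / qpoch_inf t p) UNIV"
proof -
  define c where "c n = 1 / qpoch p p n" for n
  define E where "E t = (\<Sum>n. c n * t ^ n)" for t
  obtain C where C: "\<And>n. norm (1 / qpoch p p n) \<le> C"
    using inverse_qpoch_bounded[OF p p] by metis
  have norm_summable: "summable (\<lambda>n. norm (c n * t ^ n))" if "norm t < 1" for t
  proof (rule summable_comparison_test')
    show "summable (\<lambda>n. C * norm t ^ n)"
      using that by (intro summable_mult summable_geometric) auto
    show "norm (norm (c n * t ^ n)) \<le> C * norm t ^ n" for n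
      using mult_right_mono[OF C[of n], of "norm t ^ n"]
      by (simp add: c_def norm_mult norm_divide norm_power)
  qed
  have sums: "(\<lambda>n. c n * t ^ n) sums E t" if "norm t < 1" for t
    unfolding E_def by (rule summable_sums[OF summable_norm_cancel[OF norm_summable[OF that]]])
  have c_rec: "c (Suc n) * (1 - p ^ Suc n) = c n" for n
    using qpoch_base_nonzero[OF p, of "Suc n"] by (simp add: c_def qpoch_Suc)
  have E_rec: "(1 - t) * E t = E (t * p)" if "norm t < 1" for t
  proof -
    have tp: "norm (t * p) < 1"
      using norm_mult_power_less_1[OF p that, of 1] by simp
    have "(\<lambda>n. t * (c n * t ^ n)) sums (t * E t)"
      by (intro sums_mult sums that)
    also have "(\<lambda>n. t * (c n * t ^ n)) = (\<lambda>n. c (Suc n) * t ^ Suc n - c (Suc n) * (t * p) ^ Suc n)"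
      by (subst c_rec[symmetric]) (simp add: algebra_simps power_mult_distrib)
    finally have "(\<lambda>n. c n * t ^ n - c n * (t * p) ^ n) sums (t * E t)"
      by (rule sums_Suc_imp[rotated]) simp
    moreover have "(\<lambda>n. c n * t ^ n - c n * (t * p) ^ n) sums (E t - E (t * p))"
      by (intro sums_diff sums that tp)
    ultimately have "t * E t = E t - E (t * p)"
      by (rule sums_unique2)
    then show ?thesis
      by (simp add: algebra_simps)
  qed
  have E_iter: "qpoch t p n * E t = E (t * p ^ n)" for n
  proof (induction n)
    case (Suc n)
    have "qpoch t p (Suc n) * E t = (1 - t * p ^ n) * (qpoch t p n * E t)"
      by (simp add: qpoch_Suc mult_ac)
    also have "\<dots> = E (t * p ^ Suc n)"
      unfolding Suc E_rec[OF norm_mult_power_less_1[OF p t]] by (simp add: mult_ac)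
    finally show ?case .
  qed simp
  have "isCont E 0"
    \<comment> \<open>Any nonzero point of the unit disc would serve as the point of
      convergence.\<close>
    unfolding E_def by (rule isCont_powser[of c "1/2"]) (use summable_norm_cancel[OF norm_summable[of "1/2"]] in auto)
  moreover have "(\<lambda>n. t * p ^ n) \<longlonglongrightarrow> t * 0"
    by (intro tendsto_intros LIMSEQ_power_zero p)
  ultimately have "(\<lambda>n. E (t * p ^ n)) \<longlonglongrightarrow> E 0"
    by (intro isCont_tendsto_compose[of 0 E]) auto
  moreover have "(\<lambda>n. qpoch t p n * E t) \<longlonglongrightarrow> qpoch_inf t p * E t"
    by (intro tendsto_intros qpoch_tendsto p)
  ultimately have "qpoch_inf t p * E t = E 0"
    unfolding E_iter by (rule LIMSEQ_unique[rotated])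
  also have "E 0 = 1"
    unfolding E_def powser_zero by (simp add: c_def)
  finally have "E t = 1 / qpoch_inf t p"
    using qpoch_inf_nonzero_norm[OF p t] by (simp add: field_simps)
  then show ?thesis
    using norm_summable_imp_has_sum[OF norm_summable sums, of t] t by (simp add: c_def)
qed

text \<open>The homogeneous form, with \<open>z\<close> kept inside the product, also covers
  \<open>z = 0\<close>. Multiplying the sum for \<open>Suc m\<close> by its missing factor produces
  the next linear factor in \<open>y\<close> and \<open>z\<close>, in the manner of Pascal's
  rule.\<close>

lemma finite_q_binomial:
  fixes b y z :: complex
  assumes b: "norm b < 1"
  shows "(\<Sum>j\<le>m. b ^ (j\<^sup>2) * y ^ j * z ^ (m - j) / (qpoch (b\<^sup>2) (b\<^sup>2) j * qpoch (b\<^sup>2) (b\<^sup>2) (m - j))) =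
    (\<Prod>l<m. z + y * b ^ (2 * l + 1)) / qpoch (b\<^sup>2) (b\<^sup>2) m"
proof (induction m)
  case (Suc m)
  let ?Q = "qpoch (b\<^sup>2) (b\<^sup>2)"
  define A where "A m = (\<Sum>j\<le>m. b ^ (j\<^sup>2) * y ^ j * z ^ (m - j) / (?Q j * ?Q (m - j)))" for m
  have b2: "norm (b\<^sup>2) < 1"
    using norm_square_less_1[OF b] .
  have Q: "?Q n \<noteq> 0" for n
    using qpoch_base_nonzero[OF b2] .
  have nz: "1 - b ^ (2 * Suc n) \<noteq> 0" for n
    using Q[of "Suc n"] unfolding qpoch_square_base_Suc by auto
  define f where "f j = b ^ (j\<^sup>2) * y ^ j * z ^ (Suc m - j) / (?Q j * ?Q (Suc m - j))" for j
  have f1: "f j * (1 - b ^ (2 * (Suc m - j))) = z * (b ^ (j\<^sup>2) * y ^ j * z ^ (m - j) / (?Q j * ?Q (m - j)))"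
    if "j \<le> m" for j
    using nz[of "m - j"] Q[of j] Q[of "m - j"] that
    by (simp add: f_def Suc_diff_le qpoch_square_base_Suc del: mult_Suc_right)
  have f2: "f (Suc j) * (b ^ (2 * (m - j)) * (1 - b ^ (2 * Suc j))) =
      y * b ^ (2 * m + 1) * (b ^ (j\<^sup>2) * y ^ j * z ^ (m - j) / (?Q j * ?Q (m - j)))" if "j \<le> m" for j
  proof -
    have "b ^ ((Suc j)\<^sup>2) * b ^ (2 * (m - j)) = b ^ (2 * m + 1) * b ^ (j\<^sup>2)"
      using that by (simp add: power2_eq_square flip: power_add) (simp add: algebra_simps)
    then have "f (Suc j) * (b ^ (2 * (m - j)) * (1 - b ^ (2 * Suc j))) =
        (b ^ (2 * m + 1) * b ^ (j\<^sup>2)) * (y ^ Suc j * z ^ (m - j)) * (1 - b ^ (2 * Suc j)) / (?Q (Suc j) * ?Q (m - j))"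
      by (simp add: f_def mult_ac del: mult_Suc_right)
    then show ?thesis
      using nz[of j] unfolding qpoch_square_base_Suc by (simp add: mult_ac del: mult_Suc_right)
  qed
  have "A (Suc m) * (1 - b ^ (2 * Suc m)) = (\<Sum>j\<le>Suc m. f j * (1 - b ^ (2 * Suc m)))"
    by (simp add: A_def f_def sum_distrib_right del: sum.atMost_Suc mult_Suc_right)
  \<comment> \<open>The identity 1 - uv = (1 - u) + u (1 - v) with uv = b^(2 Suc m): the first part
    cancels the last factor of the denominator in \<open>m - j\<close> (fact \<open>f1\<close>), the
    second the one in \<open>j\<close> (fact \<open>f2\<close>).\<close>
  also have "\<dots> = (\<Sum>j\<le>Suc m. f j * (1 - b ^ (2 * (Suc m - j))) + f j * (b ^ (2 * (Suc m - j)) * (1 - b ^ (2 * j))))"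
  proof (intro sum.cong refl)
    fix j assume "j \<in> {..Suc m}"
    then have "2 * Suc m = 2 * (Suc m - j) + 2 * j"
      by simp
    then have "b ^ (2 * Suc m) = b ^ (2 * (Suc m - j)) * b ^ (2 * j)"
      by (metis power_add)
    then show "f j * (1 - b ^ (2 * Suc m)) =
        f j * (1 - b ^ (2 * (Suc m - j))) + f j * (b ^ (2 * (Suc m - j)) * (1 - b ^ (2 * j)))"
      by (simp add: algebra_simps del: mult_Suc_right)
  qed
  also have "\<dots> = (\<Sum>j\<le>m. f j * (1 - b ^ (2 * (Suc m - j)))) +
      (\<Sum>j\<le>m. f (Suc j) * (b ^ (2 * (m - j)) * (1 - b ^ (2 * Suc j))))"
    unfolding sum.distrib by (subst (2) sum.atMost_Suc_shift) (simp del: mult_Suc_right)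
  also have "\<dots> = (z + y * b ^ (2 * m + 1)) * A m"
  proof -
    have "(\<Sum>j\<le>m. f j * (1 - b ^ (2 * (Suc m - j)))) = z * A m"
      unfolding A_def sum_distrib_left by (intro sum.cong refl f1) simp
    moreover have "(\<Sum>j\<le>m. f (Suc j) * (b ^ (2 * (m - j)) * (1 - b ^ (2 * Suc j)))) = y * b ^ (2 * m + 1) * A m"
      unfolding A_def sum_distrib_left by (intro sum.cong refl f2) simp
    ultimately show ?thesis
      by (simp only: distrib_right)
  qed
  finally have "A (Suc m) = A m * (z + y * b ^ (2 * m + 1)) / (1 - b ^ (2 * Suc m))"
    using nz[of m] by (simp add: field_simps del: mult_Suc_right)
  then show ?case
    using Suc by (simp add: A_def[symmetric] qpoch_square_base_Suc del: mult_Suc_right sum.atMost_Suc)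
qed simp

lemma has_sum_antidiagonal:
  fixes f :: "nat \<times> nat \<Rightarrow> complex"
  assumes "(f has_sum S) UNIV"
  shows "((\<lambda>n. \<Sum>j\<le>n. f (j, n - j)) has_sum S) UNIV"
proof -
  have "((\<lambda>(n, j). f (j, n - j)) has_sum S) (SIGMA n:UNIV. {..n})"
    using assms
    by (subst has_sum_reindex_bij_witness[of _ "\<lambda>(j, k). (j + k, j)" "\<lambda>(n, j). (j, n - j)" UNIV f _ S]) auto
  then show ?thesis
    by (rule has_sum_SigmaD) (auto intro: has_sum_finiteI)
qed

text \<open>This is sum p^(m^2) z^m / ((p;p)_m (zp;p)_m) = 1 / (zp;p)_inf with p = b^2, multiplied
  by (zp;p)_inf so that \<open>z\<close> is unrestricted. Expanding the infinite product by Euler's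
  identity and collecting terms of equal degree in \<open>z\<close> makes every positive degree
  cancel.\<close>

lemma cauchy_sum:
  fixes b z :: complex
  assumes b: "norm b < 1"
  shows "((\<lambda>m. b ^ (2 * m\<^sup>2) * z ^ m * qpoch_inf (z * b ^ (2 * m + 2)) (b\<^sup>2) / qpoch (b\<^sup>2) (b\<^sup>2) m) has_sum 1) UNIV"
proof -
  let ?Q = "qpoch (b\<^sup>2) (b\<^sup>2)"
  have b2: "norm (b\<^sup>2) < 1"
    using norm_square_less_1[OF b] .
  obtain C where C: "0 < C" "\<And>n. norm (1 / ?Q n) \<le> C"
    using inverse_qpoch_bounded[OF b2 b2] by metis
  define f where "f = (\<lambda>(m, k). b ^ (2 * m\<^sup>2 + k\<^sup>2 + 2 * m * k + k) * (- 1) ^ k * z ^ (m + k) / (?Q m * ?Q k))"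
  have "f summable_on UNIV \<times> UNIV"
  proof (rule summable_on_bounded_mult)
    show "(\<lambda>(m, k). (b ^ (m\<^sup>2) * z ^ m) * (b ^ (k\<^sup>2) * z ^ k)) summable_on UNIV \<times> UNIV"
      by (intro summable_on_product_complex summable_on_gauss b)
    fix x :: "nat \<times> nat"
    obtain m k where x: "x = (m, k)"
      by (cases x)
    have b_le: "norm b ^ (2 * m\<^sup>2 + k\<^sup>2 + 2 * m * k + k) \<le> norm b ^ (m\<^sup>2 + k\<^sup>2)"
      using b by (intro power_decreasing) auto
    have Q_le: "norm (1 / ?Q m) * norm (1 / ?Q k) \<le> C * C"
      by (rule mult_mono[OF C(2) C(2)]) (use C(1) in auto)
    have "norm (1 / ?Q m) * norm (1 / ?Q k) * (norm b ^ (2 * m\<^sup>2 + k\<^sup>2 + 2 * m * k + k) * norm z ^ (m + k))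
        \<le> C * C * (norm b ^ (m\<^sup>2 + k\<^sup>2) * norm z ^ (m + k))"
      using C(1) by (intro mult_mono[OF Q_le mult_right_mono[OF b_le]]) auto
    then show "norm (f x) \<le> C * C * norm (case x of (m, k) \<Rightarrow> (b ^ (m\<^sup>2) * z ^ m) * (b ^ (k\<^sup>2) * z ^ k))"
      by (simp add: x f_def norm_mult norm_divide norm_power power_add mult_ac)
  qed
  then obtain S where S: "(f has_sum S) (UNIV \<times> UNIV)"
    by (auto simp: summable_on_def)
  have "((\<lambda>n. \<Sum>j\<le>n. f (j, n - j)) has_sum S) UNIV"
    using S by (intro has_sum_antidiagonal) simp
  moreover have "((\<lambda>n. \<Sum>j\<le>n. f (j, n - j)) has_sum 1) UNIV"
  proof (rule has_sum_finite_neutralI[of "{0}"])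
    fix n :: nat assume n: "n \<in> UNIV - {0}"
    have "(\<Sum>j\<le>n. f (j, n - j)) =
        (\<Sum>j\<le>n. b ^ (n\<^sup>2) * z ^ n * (b ^ (j\<^sup>2) * 1 ^ j * (- b) ^ (n - j) / (?Q j * ?Q (n - j))))"
    proof (intro sum.cong refl)
      fix j assume "j \<in> {..n}"
      then obtain k where n: "n = j + k"
        using le_Suc_ex by auto
      have "(- b) ^ k = (- 1) ^ k * b ^ k"
        by (simp flip: power_mult_distrib)
      moreover have "b ^ (2 * j\<^sup>2 + k\<^sup>2 + 2 * j * k + k) = b ^ (n\<^sup>2) * b ^ (j\<^sup>2) * b ^ k"
        unfolding n power_add[symmetric] by (rule arg_cong[of _ _ "power b"]) (simp add: power2_eq_square algebra_simps)
      ultimately show "f (j, n - j) =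
          b ^ (n\<^sup>2) * z ^ n * (b ^ (j\<^sup>2) * 1 ^ j * (- b) ^ (n - j) / (?Q j * ?Q (n - j)))"
        unfolding f_def by (simp add: n)
    qed
    also have "\<dots> = b ^ (n\<^sup>2) * z ^ n * ((\<Prod>l<n. - b + 1 * b ^ (2 * l + 1)) / ?Q n)"
      unfolding finite_q_binomial[OF b, symmetric] by (simp add: sum_distrib_left)
    \<comment> \<open>The q-binomial sum has y = 1 and z = - b, so its factor with
      \<open>l = 0\<close> is - b + b.\<close>
    also have "(\<Prod>l<n. - b + 1 * b ^ (2 * l + 1)) = 0"
      using n by (intro prod_zero bexI[of _ 0]) auto
    finally show "(\<Sum>j\<le>n. f (j, n - j)) = 0"
      by simp
  qed (auto simp: f_def)
  ultimately have "S = 1"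
    by (rule has_sum_unique)
  with S have "(f has_sum 1) (UNIV \<times> UNIV)"
    by simp
  then show ?thesis
  proof (rule has_sum_SigmaD)
    fix m :: nat
    have "((\<lambda>k. b ^ (2 * m\<^sup>2) * z ^ m / ?Q m * (b ^ (k\<^sup>2) * (- (z * b ^ (2 * m + 1))) ^ k / ?Q k)) has_sum
        (b ^ (2 * m\<^sup>2) * z ^ m / ?Q m * qpoch_inf (- (- (z * b ^ (2 * m + 1))) * b) (b\<^sup>2))) UNIV"
      by (intro has_sum_cmult_right euler_sum b)
    also have "(\<lambda>k. b ^ (2 * m\<^sup>2) * z ^ m / ?Q m * (b ^ (k\<^sup>2) * (- (z * b ^ (2 * m + 1))) ^ k / ?Q k)) = (\<lambda>k. f (m, k))"
    proof
      fix k
      have "(- (z * b ^ (2 * m + 1))) ^ k = (- 1) ^ k * z ^ k * b ^ (2 * m * k + k)"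
        by (subst power_minus) (simp add: power_mult_distrib power_add power_mult)
      then show "b ^ (2 * m\<^sup>2) * z ^ m / ?Q m * (b ^ (k\<^sup>2) * (- (z * b ^ (2 * m + 1))) ^ k / ?Q k) = f (m, k)"
        by (simp add: f_def power_add mult_ac)
    qed
    finally show "((\<lambda>k. f (m, k)) has_sum
        (b ^ (2 * m\<^sup>2) * z ^ m * qpoch_inf (z * b ^ (2 * m + 2)) (b\<^sup>2) / ?Q m)) UNIV"
      by (simp add: mult_ac)
  qed
qed

section \<open>The Jacobi triple product\<close>

text \<open>Andrews' proof: expand \<^term>\<open>qpoch_inf (b ^ (2 * n + 2)) (b\<^sup>2)\<close> by Euler's identity in the bilateral
  sum over \<^term>\<open>n\<close>, where it vanishes for negative \<^term>\<open>n\<close>.\<close>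

theorem jacobi_triple_product:
  fixes b z :: complex
  assumes b: "norm b < 1" "b \<noteq> 0" and z: "norm b < norm z"
  shows "((\<lambda>n. b powi (n\<^sup>2) * z powi n) has_sum
    (qpoch_inf (b\<^sup>2) (b\<^sup>2) * qpoch_inf (- z * b) (b\<^sup>2) * qpoch_inf (- b / z) (b\<^sup>2))) (UNIV :: int set)"
proof -
  let ?Q = "qpoch (b\<^sup>2) (b\<^sup>2)"
  have b2: "norm (b\<^sup>2) < 1"
    using norm_square_less_1[OF b(1)] .
  have b2_power: "(b\<^sup>2) ^ k = b powi (2 * int k)" for k
  proof -
    have "2 * int k = int (2 * k)"
      by simp
    then show ?thesis
      by (simp only: power_int_of_nat power_mult)
  qed
  have z0: "z \<noteq> 0"
    using z by auto
  have bz: "norm (- b / z) < 1"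
    using z z0 by (simp add: norm_divide divide_less_eq_1_pos)
  obtain T where T: "((\<lambda>n. b powi (n\<^sup>2) * z powi n) has_sum T) (UNIV :: int set)"
    using summable_on_gauss_int[OF b(1) z0] by (auto simp: summable_on_def)
  \<comment> \<open>The unknown value \<open>T\<close> is multiplied by the series for 1 / (-b/z;
    b^2)_inf, which needs norm b < norm z. Substituting \<open>N = n + int k\<close> makes the sum
    over \<open>k\<close> an Euler series at t = - b^(2n+1).\<close>
  have "((\<lambda>(N, k). b powi (N\<^sup>2) * z powi N * ((- b / z) ^ k / ?Q k)) has_sum
      (T * (1 / qpoch_inf (- b / z) (b\<^sup>2)))) (UNIV \<times> UNIV)"
    by (intro has_sum_product_complex T euler_reciprocal_sum b2 bz)
  also have "?this \<longleftrightarrow> ((\<lambda>(n, k). b powi (n\<^sup>2) * z powi n * (b ^ (k\<^sup>2) * (- (b powi (2 * n + 1))) ^ k / ?Q k)) has_sum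
      (T * (1 / qpoch_inf (- b / z) (b\<^sup>2)))) (UNIV \<times> UNIV)"
  proof (rule has_sum_reindex_bij_witness[of _ "\<lambda>(n, k). (n + int k, k)" "\<lambda>(N, k). (N - int k, k)"])
    fix a :: "int \<times> nat"
    obtain N k where a: "a = (N, k)"
      by (cases a)
    define n where "n = N - int k"
    have N: "N = n + int k"
      by (simp add: n_def)
    have "(- (b powi (2 * n + 1))) ^ k = (- 1) ^ k * b powi ((2 * n + 1) * int k)"
      by (subst power_minus) (simp add: power_int_mult)
    moreover have "b powi (N\<^sup>2) = b powi (n\<^sup>2) * b ^ (k\<^sup>2) * b powi (2 * n * int k)"
      using b(2) by (simp add: N power2_sum power_int_add flip: power_int_of_nat)
    moreover have "b powi ((2 * n + 1) * int k) = b powi (2 * n * int k) * b ^ k"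
      using b(2) by (simp add: distrib_right power_int_add)
    moreover have "(- b / z) ^ k = (- 1) ^ k * b ^ k / z ^ k"
      by (subst power_divide, subst power_minus) simp
    moreover have "z powi N = z powi n * z ^ k"
      using z0 by (simp add: N power_int_add)
    ultimately show "(case (case a of (N, k) \<Rightarrow> (N - int k, k)) of
        (n, k) \<Rightarrow> b powi (n\<^sup>2) * z powi n * (b ^ (k\<^sup>2) * (- (b powi (2 * n + 1))) ^ k / ?Q k)) =
      (case a of (N, k) \<Rightarrow> b powi (N\<^sup>2) * z powi N * ((- b / z) ^ k / ?Q k))"
      using z0 by (simp add: a n_def[symmetric])
  qed auto
  finally have "((\<lambda>n. b powi (n\<^sup>2) * z powi n * qpoch_inf (- (- (b powi (2 * n + 1))) * b) (b\<^sup>2)) has_sum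
      (T * (1 / qpoch_inf (- b / z) (b\<^sup>2)))) UNIV"
  proof (rule has_sum_SigmaD)
    show "((\<lambda>k. case (n, k) of (n, k) \<Rightarrow> b powi (n\<^sup>2) * z powi n * (b ^ (k\<^sup>2) * (- (b powi (2 * n + 1))) ^ k / ?Q k))
      has_sum b powi (n\<^sup>2) * z powi n * qpoch_inf (- (- (b powi (2 * n + 1))) * b) (b\<^sup>2)) UNIV" for n
      unfolding prod.case by (intro has_sum_cmult_right euler_sum b)
  qed
  also have "?this \<longleftrightarrow> ((\<lambda>n. b powi (n\<^sup>2) * z powi n * qpoch_inf (- (- (b powi (2 * n + 1))) * b) (b\<^sup>2)) has_sum
      (T * (1 / qpoch_inf (- b / z) (b\<^sup>2)))) (range int)"
  proof (rule has_sum_cong_neutral)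
    fix n :: int assume "n \<in> UNIV - range int"
    then have "n < 0"
      by (cases n) auto
    \<comment> \<open>For negative \<open>n\<close> the product starts at b^(2n+2), so the factor of
      index - n - 1 is 1 - b^0 = 0.\<close>
    then have "b powi (2 * n + 1) * b * (b\<^sup>2) ^ nat (- n - 1) = b powi (2 * n + 1 + 1 + 2 * int (nat (- n - 1)))"
      using b(2) by (simp only: b2_power power_int_add power_int_1_right simp_thms)
    also have "2 * n + 1 + 1 + 2 * int (nat (- n - 1)) = 0"
      using \<open>n < 0\<close> by simp
    finally have "- (- (b powi (2 * n + 1))) * b * (b\<^sup>2) ^ nat (- n - 1) = 1"
      by simp
    from qpoch_inf_eq_0[OF b2 this]
    show "b powi (n\<^sup>2) * z powi n * qpoch_inf (- (- (b powi (2 * n + 1))) * b) (b\<^sup>2) = 0"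
      by simp
  qed auto
  also have "\<dots> \<longleftrightarrow> ((\<lambda>n. qpoch_inf (b\<^sup>2) (b\<^sup>2) * (b ^ (n\<^sup>2) * z ^ n / ?Q n)) has_sum
      (T * (1 / qpoch_inf (- b / z) (b\<^sup>2)))) UNIV"
  proof (subst has_sum_reindex)
    have "qpoch_inf (- (- (b powi (2 * int n + 1))) * b) (b\<^sup>2) = qpoch_inf (b\<^sup>2) (b\<^sup>2) / ?Q n" for n
    proof -
      have "2 * int n + 1 = int (2 * n + 1)"
        by simp
      then have "b powi (2 * int n + 1) = b ^ (2 * n + 1)"
        by (simp only: power_int_of_nat)
      then have "- (- (b powi (2 * int n + 1))) * b = b\<^sup>2 * (b\<^sup>2) ^ n"
        by (simp add: power2_eq_square power_mult)
      then show ?thesis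
        using qpoch_inf_split[OF b2, of "b\<^sup>2" n] qpoch_base_nonzero[OF b2, of n] by simp
    qed
    moreover have "b powi ((int n)\<^sup>2) = b ^ (n\<^sup>2)" for n
      by (simp only: power_int_of_nat flip: of_nat_power)
    ultimately show "(((\<lambda>n. b powi (n\<^sup>2) * z powi n * qpoch_inf (- (- (b powi (2 * n + 1))) * b) (b\<^sup>2)) \<circ> int) has_sum
        (T * (1 / qpoch_inf (- b / z) (b\<^sup>2)))) UNIV \<longleftrightarrow>
      ((\<lambda>n. qpoch_inf (b\<^sup>2) (b\<^sup>2) * (b ^ (n\<^sup>2) * z ^ n / ?Q n)) has_sum
        (T * (1 / qpoch_inf (- b / z) (b\<^sup>2)))) UNIV"
      unfolding o_def by (simp add: mult_ac)
  qed auto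
  finally have "T * (1 / qpoch_inf (- b / z) (b\<^sup>2)) = qpoch_inf (b\<^sup>2) (b\<^sup>2) * qpoch_inf (- z * b) (b\<^sup>2)"
    by (rule has_sum_unique) (intro has_sum_cmult_right euler_sum b)
  then have "T = qpoch_inf (b\<^sup>2) (b\<^sup>2) * qpoch_inf (- z * b) (b\<^sup>2) * qpoch_inf (- b / z) (b\<^sup>2)"
    using qpoch_inf_nonzero_norm[OF b2 bz] by (simp add: field_simps)
  with T show ?thesis
    by simp
qed

section \<open>Reciprocal q-factorials on the integers and Cauchy's sum with two shifts\<close>

text \<open>The usual convention 1/(p;p)_n = 0 for negative n. It makes sums range over all
  integers, so that indices can be shifted without tracking boundaries.\<close>

definition qfact_recip :: "complex \<Rightarrow> int \<Rightarrow> complex" where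
  "qfact_recip p n = (if n < 0 then 0 else 1 / qpoch p p (nat n))"

lemma qfact_recip_of_nat [simp]: "qfact_recip p (int n) = 1 / qpoch p p n"
  by (simp add: qfact_recip_def)

lemma qfact_recip_neg: "n < 0 \<Longrightarrow> qfact_recip p n = 0"
  by (simp add: qfact_recip_def)

text \<open>The recursion survives at \<open>n = 0\<close>, where the factor 1 - p^0 matches the
  value 0 at -1.\<close>

lemma qfact_recip_pred:
  assumes "norm p < 1"
  shows "qfact_recip p (n - 1) = (1 - p powi n) * qfact_recip p n"
proof -
  consider "n < 0" | "n = 0" | m where "n = int (Suc m)"
    by (metis gr0_implies_Suc linorder_neqE zero_less_imp_eq_int)
  then show ?thesis
  proof cases
    case 3
    have "n - 1 = int m" "p powi n = p * p ^ m" "qfact_recip p n = 1 / qpoch p p (Suc m)"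
      unfolding 3 power_int_of_nat qfact_recip_of_nat by simp_all
    then show ?thesis
      using qpoch_base_nonzero[OF assms, of "Suc m"] by (simp add: qpoch_Suc)
  qed (auto simp: qfact_recip_def)
qed

lemma qfact_recip_bounded:
  assumes "norm p < 1"
  obtains C where "0 < C" "\<And>n. norm (qfact_recip p n) \<le> C"
proof -
  obtain C where C: "0 < C" "\<And>n. norm (1 / qpoch p p n) \<le> C"
    using inverse_qpoch_bounded[OF assms assms] by metis
  then show ?thesis
    using that[of C] by (simp add: qfact_recip_def)
qed

lemma has_sum_int_nonneg:
  fixes f :: "int \<Rightarrow> complex"
  assumes "\<And>n. n < 0 \<Longrightarrow> f n = 0"
  shows "(f has_sum S) UNIV \<longleftrightarrow> ((\<lambda>n. f (int n)) has_sum S) UNIV"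
proof -
  have "(f has_sum S) UNIV \<longleftrightarrow> (f has_sum S) (range int)"
  proof (rule has_sum_cong_neutral)
    fix n :: int assume "n \<in> UNIV - range int"
    then have "n < 0"
      by (cases n) auto
    then show "f n = 0"
      by (rule assms)
  qed auto
  then show ?thesis
    by (simp add: has_sum_reindex o_def)
qed

lemma has_sum_int_shift:
  fixes f :: "int \<Rightarrow> complex"
  shows "((\<lambda>n. f (n + c)) has_sum S) UNIV \<longleftrightarrow> (f has_sum S) UNIV"
  by (rule has_sum_reindex_bij_witness[of _ "\<lambda>n. n - c" "\<lambda>n. n + c"]) auto

text \<open>The expression is symmetric in \<open>c\<close> and \<open>d\<close>. For
  \<open>c \<le> d\<close> a shift of \<open>n\<close> leaves Cauchy's sum at z = p^(d - c), where
  (p^(m+N+1);p)_inf = (p;p)_inf / (p;p)_(m+N).\<close>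

lemma cauchy_sum_int:
  assumes p: "norm p < 1" "p \<noteq> 0"
  shows "((\<lambda>n. p powi ((n + c) * (n + d)) * (qfact_recip p (n + c) * qfact_recip p (n + d))) has_sum
    1 / qpoch_inf p p) (UNIV :: int set)"
proof -
  have ordered: "((\<lambda>n. p powi ((n + c) * (n + d)) * (qfact_recip p (n + c) * qfact_recip p (n + d))) has_sum
    1 / qpoch_inf p p) (UNIV :: int set)" if "c \<le> d" for c d
  proof -
    define N where "N = nat (d - c)"
    define b where "b = csqrt p"
    have bp: "b\<^sup>2 = p"
      by (simp add: b_def)
    have b: "norm b < 1"
      using p(1) unfolding bp[symmetric] norm_power by (simp add: power_less_one_iff)
    have "((\<lambda>m. 1 / qpoch_inf p p * (b ^ (2 * m\<^sup>2) * (p ^ N) ^ m * qpoch_inf (p ^ N * b ^ (2 * m + 2)) (b\<^sup>2) / qpoch (b\<^sup>2) (b\<^sup>2) m)) has_sum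
        1 / qpoch_inf p p * 1) UNIV"
      by (intro has_sum_cmult_right cauchy_sum b)
    also have "(\<lambda>m. 1 / qpoch_inf p p * (b ^ (2 * m\<^sup>2) * (p ^ N) ^ m * qpoch_inf (p ^ N * b ^ (2 * m + 2)) (b\<^sup>2) / qpoch (b\<^sup>2) (b\<^sup>2) m)) =
        (\<lambda>m. p powi (int m * (int m + N)) * (qfact_recip p (int m) * qfact_recip p (int m + N)))"
    proof
      fix m
      have inf_nz: "qpoch_inf p p \<noteq> 0"
        using qpoch_inf_nonzero_norm[OF p(1) p(1)] .
      have inf_eq: "qpoch_inf (p ^ N * b ^ (2 * m + 2)) (b\<^sup>2) = qpoch_inf p p * (1 / qpoch p p (m + N))"
      proof -
        have "p ^ N * b ^ (2 * m + 2) = p * p ^ (m + N)"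
          unfolding power_add power_mult bp by simp
        then show ?thesis
          using qpoch_inf_split[OF p(1), of p "m + N"] qpoch_base_nonzero[OF p(1), of "m + N"]
          by (simp add: bp)
      qed
      have power_eq: "b ^ (2 * m\<^sup>2) * (p ^ N) ^ m = p powi (int m * (int m + N))"
      proof -
        have "int m * (int m + N) = int (m\<^sup>2 + N * m)"
          by (simp add: power2_eq_square algebra_simps)
        then show ?thesis
          unfolding power_mult bp by (simp only: power_int_of_nat power_add power_mult)
      qed
      show "1 / qpoch_inf p p * (b ^ (2 * m\<^sup>2) * (p ^ N) ^ m * qpoch_inf (p ^ N * b ^ (2 * m + 2)) (b\<^sup>2) / qpoch (b\<^sup>2) (b\<^sup>2) m) =
          p powi (int m * (int m + N)) * (qfact_recip p (int m) * qfact_recip p (int m + N))"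
        using inf_nz qfact_recip_of_nat[of p "m + N"] unfolding inf_eq power_eq by (simp add: bp)
    qed
    finally have "((\<lambda>m. p powi (m * (m + int N)) * (qfact_recip p m * qfact_recip p (m + int N))) has_sum 1 / qpoch_inf p p) (UNIV :: int set)"
      by (subst has_sum_int_nonneg) (auto simp: qfact_recip_neg)
    then have "((\<lambda>n. p powi ((n + c) * (n + c + int N)) * (qfact_recip p (n + c) * qfact_recip p (n + c + int N))) has_sum
        1 / qpoch_inf p p) (UNIV :: int set)"
      by (subst has_sum_int_shift)
    then show ?thesis
      using that by (simp add: N_def)
  qed
  show ?thesis
    using ordered[of c d] ordered[of d c] by (cases "c \<le> d") (simp_all add: mult_ac)
qed

section \<open>Reduction of the triple sum to a single sum\<close>

text \<open>The quadratic form of all sixteen sums, with the square completed. Linear exponents,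
  signs and the parameters a, b are absorbed into \<open>x\<close>, \<open>y\<close>,
  \<open>z\<close>.\<close>

definition triple_term :: "complex \<Rightarrow> complex \<Rightarrow> complex \<Rightarrow> complex \<Rightarrow> nat \<times> nat \<times> nat \<Rightarrow> complex" where
  "triple_term q x y z = (\<lambda>(i, j, k). q ^ ((i + 2 * j + 2 * k)\<^sup>2 + 2 * j\<^sup>2) * x ^ i * y ^ j * z ^ k
     / (qpoch (q\<^sup>2) (q\<^sup>2) i * qpoch (q ^ 4) (q ^ 4) j * qpoch (q ^ 4) (q ^ 4) k))"

text \<open>Every monomial of the exponent has a nonnegative coefficient, so the power of
  \<open>norm q\<close> is at most that with exponent i^2 + j^2 + k^2, and the sum is dominated by a
  product of three Gaussian series.\<close>

lemma triple_term_summable: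
  fixes q x y z :: complex
  assumes q: "norm q < 1"
  shows "triple_term q x y z summable_on UNIV"
proof -
  have q2: "norm (q\<^sup>2) < 1" and q4: "norm (q ^ 4) < 1"
    by (intro norm_power_less_1 q; simp)+
  obtain C where C: "0 < C" "\<And>n. norm (1 / qpoch (q\<^sup>2) (q\<^sup>2) n) \<le> C"
    using inverse_qpoch_bounded[OF q2 q2] by metis
  obtain D where D: "0 < D" "\<And>n. norm (1 / qpoch (q ^ 4) (q ^ 4) n) \<le> D"
    using inverse_qpoch_bounded[OF q4 q4] by metis
  have "triple_term q x y z summable_on UNIV \<times> UNIV \<times> UNIV"
  proof (rule summable_on_bounded_mult)
    show "(\<lambda>(i, u). (q ^ (i\<^sup>2) * x ^ i) * (case u of (j, k) \<Rightarrow> (q ^ (j\<^sup>2) * y ^ j) * (q ^ (k\<^sup>2) * z ^ k)))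
        summable_on UNIV \<times> UNIV \<times> UNIV"
      by (intro summable_on_product_complex summable_on_gauss q)
    fix u :: "nat \<times> nat \<times> nat"
    obtain i j k where u: "u = (i, j, k)"
      by (cases u)
    have "(i + 2 * j + 2 * k)\<^sup>2 + 2 * j\<^sup>2 = i\<^sup>2 + j\<^sup>2 + k\<^sup>2 + (5 * j\<^sup>2 + 3 * k\<^sup>2 + 4 * i * j + 4 * i * k + 8 * j * k)"
      by (simp add: power2_eq_square algebra_simps)
    then have q_le: "norm q ^ ((i + 2 * j + 2 * k)\<^sup>2 + 2 * j\<^sup>2) \<le> norm q ^ (i\<^sup>2 + j\<^sup>2 + k\<^sup>2)"
      using q by (intro power_decreasing) auto
    have C_le: "norm (1 / qpoch (q\<^sup>2) (q\<^sup>2) i) * (norm (1 / qpoch (q ^ 4) (q ^ 4) j) * norm (1 / qpoch (q ^ 4) (q ^ 4) k)) \<le> C * (D * D)"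
      using C(1) D(1) by (intro mult_mono[OF C(2) mult_mono[OF D(2) D(2)]]) auto
    have "norm (1 / qpoch (q\<^sup>2) (q\<^sup>2) i) * (norm (1 / qpoch (q ^ 4) (q ^ 4) j) * norm (1 / qpoch (q ^ 4) (q ^ 4) k)) *
          (norm q ^ ((i + 2 * j + 2 * k)\<^sup>2 + 2 * j\<^sup>2) * norm (x ^ i * y ^ j * z ^ k))
        \<le> C * (D * D) * (norm q ^ (i\<^sup>2 + j\<^sup>2 + k\<^sup>2) * norm (x ^ i * y ^ j * z ^ k))"
      using C(1) D(1) by (intro mult_mono[OF C_le mult_right_mono[OF q_le]]) auto
    then show "norm (triple_term q x y z u) \<le> C * (D * D) *
        norm (case u of (i, u) \<Rightarrow> (q ^ (i\<^sup>2) * x ^ i) * (case u of (j, k) \<Rightarrow> (q ^ (j\<^sup>2) * y ^ j) * (q ^ (k\<^sup>2) * z ^ k)))"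
      by (simp add: u triple_term_def norm_mult norm_divide norm_power power_add mult_ac)
  qed
  then show ?thesis
    by simp
qed

text \<open>Unconditional convergence allows the triples to be grouped by \<open>m = j + k\<close>,
  with \<open>i\<close> summed inside. The product over \<open>l\<close> is left unfactored so that
  \<open>z = 0\<close> is included.\<close>

lemma triple_sum_reduction:
  fixes q x y z :: complex
  assumes q: "norm q < 1"
  assumes S: "((\<lambda>m. q ^ (4 * m\<^sup>2) * (\<Prod>l<m. z + y * q ^ (4 * l + 2)) * qpoch_inf (- x * q ^ (4 * m + 1)) (q\<^sup>2) / qpoch (q ^ 4) (q ^ 4) m)
      has_sum S) UNIV"
  shows "(triple_term q x y z has_sum S) UNIV"
proof -
  have q2: "norm (q\<^sup>2) < 1" and q4: "norm (q ^ 4) < 1"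
    by (intro norm_power_less_1 q; simp)+
  obtain T where T: "(triple_term q x y z has_sum T) UNIV"
    using triple_term_summable[OF q, of x y z] unfolding summable_on_def by blast
  let ?P = "qpoch (q\<^sup>2) (q\<^sup>2)" and ?R = "qpoch (q ^ 4) (q ^ 4)"
  define A where "A m = (\<Sum>j\<le>m. q ^ (2 * j\<^sup>2) * y ^ j * z ^ (m - j) / (?R j * ?R (m - j)))" for m
  have A: "A m = (\<Prod>l<m. z + y * q ^ (4 * l + 2)) / ?R m" for m
  proof -
    have "(q\<^sup>2)\<^sup>2 = q ^ 4"
      by (simp flip: power_mult)
    moreover have "(q\<^sup>2) ^ (j\<^sup>2) = q ^ (2 * j\<^sup>2)" "(q\<^sup>2) ^ (2 * l + 1) = q ^ (4 * l + 2)" for j l :: nat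
      unfolding power_mult[symmetric] by (rule arg_cong[of _ _ "power q"]; simp)+
    ultimately show ?thesis
      using finite_q_binomial[OF q2, of y z m] by (simp only: A_def)
  qed
  let ?g = "\<lambda>((m, j), i). triple_term q x y z (i, j, m - j)"
  have "(?g has_sum T) ((SIGMA m:UNIV. {..m}) \<times> UNIV) \<longleftrightarrow> (triple_term q x y z has_sum T) UNIV"
    by (rule has_sum_reindex_bij_witness[of _ "\<lambda>(i, j, k). ((j + k, j), i)" "\<lambda>((m, j), i). (i, j, m - j)"]) auto
  with T have "(?g has_sum T) ((SIGMA m:UNIV. {..m}) \<times> UNIV)"
    by simp
  then have "((\<lambda>(m, j). q ^ (4 * m\<^sup>2) * qpoch_inf (- x * q ^ (4 * m + 1)) (q\<^sup>2) *
      (q ^ (2 * j\<^sup>2) * y ^ j * z ^ (m - j) / (?R j * ?R (m - j)))) has_sum T) (SIGMA m:UNIV. {..m})"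
  proof (rule has_sum_SigmaD)
    fix u :: "nat \<times> nat" assume "u \<in> (SIGMA m:UNIV. {..m})"
    then obtain m j where u: "u = (m, j)" and j: "j \<le> m"
      by auto
    let ?c = "q ^ (4 * m\<^sup>2) * (q ^ (2 * j\<^sup>2) * y ^ j * z ^ (m - j) / (?R j * ?R (m - j)))"
    have "((\<lambda>i. ?c * (q ^ (i\<^sup>2) * (x * q ^ (4 * m)) ^ i / ?P i)) has_sum
        ?c * qpoch_inf (- (x * q ^ (4 * m)) * q) (q\<^sup>2)) UNIV"
      by (intro has_sum_cmult_right euler_sum q)
    also have "(\<lambda>i. ?c * (q ^ (i\<^sup>2) * (x * q ^ (4 * m)) ^ i / ?P i)) = (\<lambda>i. ?g (u, i))"
    proof
      fix i
      \<comment> \<open>On a block of fixed j + k only 2 j^2 still depends on \<open>j\<close>, and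
        the cross term 4 m i turns \<open>x\<close> into \<open>x * q ^ (4 * m)\<close> in Euler's
        series.\<close>
      have "i + 2 * j + 2 * (m - j) = i + 2 * m"
        using j by simp
      then have "(i + 2 * j + 2 * (m - j))\<^sup>2 + 2 * j\<^sup>2 = 4 * m\<^sup>2 + 2 * j\<^sup>2 + i\<^sup>2 + 4 * m * i"
        by (simp add: power2_eq_square algebra_simps)
      then show "?c * (q ^ (i\<^sup>2) * (x * q ^ (4 * m)) ^ i / ?P i) = ?g (u, i)"
        unfolding u triple_term_def prod.case
        by (simp add: power_mult_distrib power_add mult_ac flip: power_mult)
    qed
    finally show "((\<lambda>i. ?g (u, i)) has_sum (case u of (m, j) \<Rightarrow> q ^ (4 * m\<^sup>2) * qpoch_inf (- x * q ^ (4 * m + 1)) (q\<^sup>2) *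
      (q ^ (2 * j\<^sup>2) * y ^ j * z ^ (m - j) / (?R j * ?R (m - j))))) UNIV"
      by (simp add: u mult_ac power_add)
  qed
  then have "((\<lambda>m. q ^ (4 * m\<^sup>2) * qpoch_inf (- x * q ^ (4 * m + 1)) (q\<^sup>2) * A m) has_sum T) UNIV"
  proof (rule has_sum_SigmaD)
    show "((\<lambda>j. case (m, j) of (m, j) \<Rightarrow> q ^ (4 * m\<^sup>2) * qpoch_inf (- x * q ^ (4 * m + 1)) (q\<^sup>2) *
      (q ^ (2 * j\<^sup>2) * y ^ j * z ^ (m - j) / (?R j * ?R (m - j)))) has_sum
      q ^ (4 * m\<^sup>2) * qpoch_inf (- x * q ^ (4 * m + 1)) (q\<^sup>2) * A m) {..m}" for m
      unfolding prod.case A_def by (intro has_sum_cmult_right has_sum_finite) auto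
  qed
  then have "T = S"
    by (rule has_sum_unique) (use S in \<open>simp add: A mult_ac\<close>)
  with T show ?thesis
    by simp
qed

text \<open>The condition on \<open>A\<close> is written without a quotient y/z, so that y = z = 0
  is allowed. This form puts no condition on \<open>B\<close>, as needed when B contains a parameter
  or equals 1.\<close>

lemma triple_sum_reduction_qpoch:
  fixes q x y z A B :: complex
  assumes q: "norm q < 1" and A: "y * q\<^sup>2 = - z * A" and B: "B = - x * q"
  assumes S: "((\<lambda>m. q ^ (4 * m\<^sup>2) * z ^ m * qpoch A (q ^ 4) m * qpoch_inf (B * q ^ (4 * m)) (q\<^sup>2) / qpoch (q ^ 4) (q ^ 4) m)
      has_sum S) UNIV"
  shows "(triple_term q x y z has_sum S) UNIV"
proof (rule triple_sum_reduction[OF q])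
  have "(\<Prod>l<m. z + y * q ^ (4 * l + 2)) = z ^ m * qpoch A (q ^ 4) m" for m
  proof -
    have "z + y * q ^ (4 * l + 2) = z * (1 - A * (q ^ 4) ^ l)" for l
    proof -
      have "y * q ^ (4 * l + 2) = (y * q\<^sup>2) * (q ^ 4) ^ l"
        unfolding power_add power_mult by simp
      then show ?thesis
        unfolding A by (simp add: algebra_simps)
    qed
    then show ?thesis
      by (simp add: qpoch_def prod.distrib)
  qed
  moreover have "- x * q ^ (4 * m + 1) = B * q ^ (4 * m)" for m
    by (simp add: B)
  ultimately show "((\<lambda>m. q ^ (4 * m\<^sup>2) * (\<Prod>l<m. z + y * q ^ (4 * l + 2)) *
      qpoch_inf (- x * q ^ (4 * m + 1)) (q\<^sup>2) / qpoch (q ^ 4) (q ^ 4) m) has_sum S) UNIV"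
    using S by (simp only: mult.assoc)
qed

lemma qpoch_even: "qpoch a p (2 * m) = qpoch a (p\<^sup>2) m * qpoch (a * p) (p\<^sup>2) m"
  using qpoch_mult[of a p m 2] by (simp add: mult.commute numeral_2_eq_2)

lemma qpoch_inf_even:
  assumes "norm p < 1"
  shows "qpoch_inf a p = qpoch_inf a (p\<^sup>2) * qpoch_inf (a * p) (p\<^sup>2)"
  using qpoch_inf_dissect[OF assms, of 2 a] by (simp add: numeral_2_eq_2)

text \<open>When (B;Q) never vanishes, (B Q^(2m); Q)_inf equals (B;Q)_inf / (B;Q)_(2m), and
  (B;Q)_(2m) splits into two symbols in base Q^2. In the applications \<open>A\<close> often cancels
  one of them.\<close>

lemma triple_sum_reduction_quotient:
  fixes q x y z A B :: complex
  assumes q: "norm q < 1" and Q: "Q = q\<^sup>2" and A: "y * Q = - z * A" and B: "B = - x * q"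
  assumes nz: "\<And>n. qpoch B Q n \<noteq> 0"
  assumes S: "((\<lambda>m. Q ^ (2 * m\<^sup>2) * z ^ m * qpoch A (Q\<^sup>2) m / (qpoch (Q\<^sup>2) (Q\<^sup>2) m * qpoch B (Q\<^sup>2) m * qpoch (B * Q) (Q\<^sup>2) m))
      has_sum S) UNIV"
  shows "(triple_term q x y z has_sum qpoch_inf B Q * S) UNIV"
proof (rule triple_sum_reduction_qpoch[OF q _ B])
  show "y * q\<^sup>2 = - z * A"
    using A by (simp add: Q)
  have q4: "q ^ 4 = Q\<^sup>2" and q4m: "q ^ (4 * m) = Q ^ (2 * m)" for m
    unfolding Q power_mult[symmetric] by simp_all
  have norm_Q: "norm Q < 1"
    unfolding Q by (rule norm_power_less_1[OF q]) simp
  have eq: "qpoch_inf (B * Q ^ (2 * m)) Q = qpoch_inf B Q / (qpoch B (Q\<^sup>2) m * qpoch (B * Q) (Q\<^sup>2) m)" for m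
    using qpoch_inf_split[OF norm_Q, of B "2 * m"] nz[of "2 * m"] by (simp add: qpoch_even)
  show "((\<lambda>m. q ^ (4 * m\<^sup>2) * z ^ m * qpoch A (q ^ 4) m * qpoch_inf (B * q ^ (4 * m)) (q\<^sup>2) / qpoch (q ^ 4) (q ^ 4) m)
      has_sum qpoch_inf B Q * S) UNIV"
    using has_sum_cmult_right[OF S, of "qpoch_inf B Q"]
    unfolding q4 q4m Q[symmetric] eq by (simp add: mult_ac)
qed

section \<open>Even and odd parts of series, and theta functions\<close>

lemma has_sum_even_odd:
  fixes f :: "nat \<Rightarrow> complex"
  assumes S: "(f has_sum S) UNIV" and T: "((\<lambda>n. (- 1) ^ n * f n) has_sum T) UNIV"
  shows "((\<lambda>n. f (2 * n)) has_sum (S + T) / 2) UNIV"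
    and "((\<lambda>n. f (2 * n + 1)) has_sum (S - T) / 2) UNIV"
proof -
  have range: "range (\<lambda>n. 2 * n) = {n :: nat. even n}" "range (\<lambda>n. 2 * n + 1) = {n :: nat. odd n}"
    by (auto elim!: evenE oddE) presburger
  have "((\<lambda>n. (f n + (- 1) ^ n * f n) / 2) has_sum (S + T) / 2) UNIV"
    by (intro has_sum_divide_const has_sum_add S T)
  also have "?this \<longleftrightarrow> (f has_sum (S + T) / 2) (range (\<lambda>n. 2 * n))"
    unfolding range by (rule has_sum_cong_neutral) (auto)
  finally show "((\<lambda>n. f (2 * n)) has_sum (S + T) / 2) UNIV"
    by (subst (asm) has_sum_reindex) (auto simp: o_def inj_on_def)
  have "((\<lambda>n. (f n + - ((- 1) ^ n * f n)) / 2) has_sum (S + - T) / 2) UNIV"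
    by (intro has_sum_divide_const has_sum_add has_sum_uminusI S T)
  also have "?this \<longleftrightarrow> (f has_sum (S + - T) / 2) (range (\<lambda>n. 2 * n + 1))"
    unfolding range by (rule has_sum_cong_neutral) (auto)
  finally show "((\<lambda>n. f (2 * n + 1)) has_sum (S - T) / 2) UNIV"
    by (subst (asm) has_sum_reindex) (auto simp: o_def inj_on_def)
qed

lemma has_sum_even_odd_int:
  fixes f :: "int \<Rightarrow> complex"
  assumes S: "(f has_sum S) UNIV" and T: "((\<lambda>n. (- 1) powi n * f n) has_sum T) UNIV"
  shows "((\<lambda>n. f (2 * n)) has_sum (S + T) / 2) UNIV"
    and "((\<lambda>n. f (2 * n + 1)) has_sum (S - T) / 2) UNIV"
proof -
  have range: "range (\<lambda>n. 2 * n) = {n :: int. even n}" "range (\<lambda>n. 2 * n + 1) = {n :: int. odd n}"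
    by (auto elim!: evenE oddE) presburger
  have "((\<lambda>n. (f n + (- 1) powi n * f n) / 2) has_sum (S + T) / 2) UNIV"
    by (intro has_sum_divide_const has_sum_add S T)
  also have "?this \<longleftrightarrow> (f has_sum (S + T) / 2) (range (\<lambda>n. 2 * n))"
    unfolding range by (rule has_sum_cong_neutral) (auto simp: power_int_minus_left)
  finally show "((\<lambda>n. f (2 * n)) has_sum (S + T) / 2) UNIV"
    by (subst (asm) has_sum_reindex) (auto simp: o_def inj_on_def)
  have "((\<lambda>n. (f n + - ((- 1) powi n * f n)) / 2) has_sum (S + - T) / 2) UNIV"
    by (intro has_sum_divide_const has_sum_add has_sum_uminusI S T)
  also have "?this \<longleftrightarrow> (f has_sum (S + - T) / 2) (range (\<lambda>n. 2 * n + 1))"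
    unfolding range by (rule has_sum_cong_neutral) (auto simp: power_int_minus_left)
  finally show "((\<lambda>n. f (2 * n + 1)) has_sum (S - T) / 2) UNIV"
    by (subst (asm) has_sum_reindex) (auto simp: o_def inj_on_def)
qed

lemma norm_csqrt_less_1:
  assumes "norm q < 1"
  shows "norm (csqrt q) < 1"
proof -
  have "(norm (csqrt q))\<^sup>2 < 1"
    using assms by (simp flip: norm_power)
  then show ?thesis
    by (simp add: power_less_one_iff)
qed

text \<open>Jacobi's triple product with base s^k and argument z = t s^(c-k). Then norm z = norm s^k
  / norm s^d, so \<open>0 < d\<close> supplies the domain condition, and 1/t = t gives both products
  the same sign.\<close>

lemma theta_sum:
  fixes s t :: complex
  assumes s: "norm s < 1" "s \<noteq> 0" and t: "t = 1 \<or> t = - 1" and cd: "c + d = 2 * k" "0 < d"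
  shows "((\<lambda>n. t powi n * s powi (int k * n\<^sup>2 + (int c - int k) * n)) has_sum
    (qpoch_inf (s ^ (2 * k)) (s ^ (2 * k)) * qpoch_inf (- t * s ^ c) (s ^ (2 * k)) * qpoch_inf (- t * s ^ d) (s ^ (2 * k))))
    (UNIV :: int set)"
proof -
  define z where "z = t * s powi (int c - int k)"
  have t0: "t \<noteq> 0" and tt: "1 / t = t" and norm_t: "norm t = 1"
    using t by auto
  have k: "0 < k" and d: "int k - (int c - int k) = int d"
    using cd by auto
  have "norm (s ^ k) = norm (s powi (int c - int k)) * norm s ^ d"
  proof -
    have "s ^ k = s powi ((int c - int k) + int d)"
      using cd by (metis d diff_add_cancel add.commute power_int_of_nat)
    then show ?thesis
      using s(2) by (simp add: power_int_add norm_mult norm_power)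
  qed
  also have "\<dots> < norm (s powi (int c - int k)) * 1"
    using s cd(2) by (intro mult_strict_left_mono) (auto simp: power_less_one_iff norm_power_int)
  also have "\<dots> = norm z"
    by (simp add: z_def norm_mult norm_t)
  finally have norm_z: "norm (s ^ k) < norm z" .
  have "norm (s ^ k) < 1"
    using s(1) k by (rule norm_power_less_1)
  from jacobi_triple_product[OF this _ norm_z] have "((\<lambda>n. (s ^ k) powi (n\<^sup>2) * z powi n) has_sum
      qpoch_inf ((s ^ k)\<^sup>2) ((s ^ k)\<^sup>2) * qpoch_inf (- z * s ^ k) ((s ^ k)\<^sup>2) * qpoch_inf (- (s ^ k) / z) ((s ^ k)\<^sup>2)) (UNIV :: int set)"
    using s(2) by simp
  also have "(\<lambda>n. (s ^ k) powi (n\<^sup>2) * z powi n) = (\<lambda>n. t powi n * s powi (int k * n\<^sup>2 + (int c - int k) * n))"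
  proof
    fix n :: int
    have "(s ^ k) powi (n\<^sup>2) = s powi (int k * n\<^sup>2)"
      by (simp only: power_int_mult power_int_of_nat)
    then show "(s ^ k) powi (n\<^sup>2) * z powi n = t powi n * s powi (int k * n\<^sup>2 + (int c - int k) * n)"
      using s(2) by (simp add: z_def power_int_add power_int_mult_distrib flip: power_int_mult)
  qed
  also have "- z * s ^ k = - t * s ^ c"
  proof -
    have "s powi (int c - int k) * s ^ k = s ^ c"
      using s(2) by (metis diff_add_cancel power_int_add power_int_of_nat)
    then show ?thesis
      by (simp add: z_def)
  qed
  also have "- (s ^ k) / z = - t * s ^ d"
  proof -
    have "s ^ k / s powi (int c - int k) = s ^ d"
      using s(2) d by (metis power_int_diff power_int_of_nat)
    moreover have "- (s ^ k) / z = - (1 / t) * (s ^ k / s powi (int c - int k))"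
      by (simp add: z_def)
    ultimately show ?thesis
      by (simp add: tt)
  qed
  also have "(s ^ k)\<^sup>2 = s ^ (2 * k)"
    by (simp add: mult.commute flip: power_mult)
  finally show ?thesis .
qed

text \<open>Multiplying Euler's product by \<^term>\<open>qpoch_inf (s ^ 4) (s ^ 4)\<close> turns it into a theta function,
  whose even and odd parts are again theta functions.\<close>

lemma euler_sum_theta:
  fixes s t :: complex
  assumes s: "norm s < 1" "s \<noteq> 0" and t: "t = 1 \<or> t = - 1"
  shows "((\<lambda>n. t powi n * s powi (2 * n\<^sup>2 - n)) has_sum qpoch_inf (s ^ 4) (s ^ 4) * qpoch_inf (- t * s) (s\<^sup>2)) (UNIV :: int set)"
proof -
  have "norm (s\<^sup>2) < 1"
    using norm_square_less_1[OF s(1)] .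
  from qpoch_inf_even[OF this, of "- t * s"]
  have "qpoch_inf (- t * s) (s\<^sup>2) = qpoch_inf (- t * s) (s ^ 4) * qpoch_inf (- t * s ^ 3) (s ^ 4)"
    by (simp add: power3_eq_cube power2_eq_square mult_ac power4_eq_xxxx)
  then show ?thesis
    using theta_sum[OF s t, of 1 3 2] by (simp add: mult_ac)
qed

text \<open>Identities (39) and (38) of Slater's list. With s^2 = Q, the even-indexed and
  odd-indexed terms of Euler's series for (-s;Q)_inf are compared with those of the theta series
  that \<open>euler_sum_theta\<close> gives for (Q^2;Q^2)_inf (-s;Q)_inf.\<close>

lemma slater_sums:
  fixes Q :: complex
  assumes Q: "norm Q < 1" "Q \<noteq> 0"
  shows slater_39: "((\<lambda>m. Q ^ (2 * m\<^sup>2) / qpoch Q Q (2 * m)) has_sum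
      qpoch_inf (Q ^ 8) (Q ^ 8) * qpoch_inf (- (Q ^ 3)) (Q ^ 8) * qpoch_inf (- (Q ^ 5)) (Q ^ 8) / qpoch_inf (Q\<^sup>2) (Q\<^sup>2)) UNIV"
    and slater_38: "((\<lambda>m. Q ^ (2 * m\<^sup>2 + 2 * m) / qpoch Q Q (2 * m + 1)) has_sum
      qpoch_inf (Q ^ 8) (Q ^ 8) * qpoch_inf (- (Q ^ 7)) (Q ^ 8) * qpoch_inf (- Q) (Q ^ 8) / qpoch_inf (Q\<^sup>2) (Q\<^sup>2)) UNIV"
proof -
  define s where "s = csqrt Q"
  have sQ: "s\<^sup>2 = Q"
    by (simp add: s_def)
  have s: "norm s < 1" "s \<noteq> 0"
    using norm_csqrt_less_1[OF Q(1)] Q(2) by (simp_all add: s_def)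
  have s_even: "s ^ (2 * n) = Q ^ n" for n
    unfolding power_mult sQ ..
  have s4: "s ^ 4 = Q\<^sup>2"
    using s_even[of 2] by simp
  let ?P = "qpoch_inf (Q\<^sup>2) (Q\<^sup>2)" and ?S = "qpoch_inf (- s) Q" and ?T = "qpoch_inf s Q"
  have P: "?P \<noteq> 0"
    by (intro qpoch_inf_nonzero_norm norm_square_less_1 Q)
  define f where "f n = s ^ (n\<^sup>2) / qpoch Q Q n" for n
  have f1: "(f has_sum ?S) UNIV"
    using euler_sum[OF s(1), of 1] by (simp add: f_def[abs_def] sQ)
  have f2: "((\<lambda>n. (- 1) ^ n * f n) has_sum ?T) UNIV"
    using euler_sum[OF s(1), of "- 1"] by (simp add: f_def sQ mult.commute)
  define g :: "int \<Rightarrow> complex" where "g n = s powi (2 * n\<^sup>2 - n)" for n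
  have g1: "(g has_sum ?P * ?S) UNIV"
    using euler_sum_theta[OF s, of 1] by (simp add: g_def[abs_def] sQ s4)
  have g2: "((\<lambda>n. (- 1) powi n * g n) has_sum ?P * ?T) UNIV"
    using euler_sum_theta[OF s, of "- 1"] by (simp add: g_def[abs_def] sQ s4)
  have "((\<lambda>n. g (2 * n)) has_sum qpoch_inf (Q ^ 8) (Q ^ 8) * qpoch_inf (- (Q ^ 3)) (Q ^ 8) * qpoch_inf (- (Q ^ 5)) (Q ^ 8)) UNIV"
  proof -
    \<comment> \<open>The exponent 8 n^2 - 2 n is that of \<open>theta_sum\<close> with k = 8, c =
      6, d = 10; since s^2 = Q these become base Q^8 and arguments Q^3, Q^5.\<close>
    have "2 * (2 * n)\<^sup>2 - 2 * n = int 8 * n\<^sup>2 + (int 6 - int 8) * n" for n :: int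
      by (simp add: power2_eq_square)
    then show ?thesis
      using theta_sum[OF s, of 1 6 10 8] s_even[of 8] s_even[of 3] s_even[of 5] by (simp add: g_def)
  qed
  from has_sum_unique[OF has_sum_even_odd_int(1)[OF g1 g2] this]
  have "(?S + ?T) / 2 = qpoch_inf (Q ^ 8) (Q ^ 8) * qpoch_inf (- (Q ^ 3)) (Q ^ 8) * qpoch_inf (- (Q ^ 5)) (Q ^ 8) / ?P"
    using P by (simp add: field_simps)
  moreover have "f (2 * n) = Q ^ (2 * n\<^sup>2) / qpoch Q Q (2 * n)" for n
  proof -
    have "(2 * n)\<^sup>2 = 2 * (2 * n\<^sup>2)"
      by (simp add: power2_eq_square)
    then show ?thesis
      unfolding f_def by (simp only: s_even)
  qed
  ultimately show "((\<lambda>m. Q ^ (2 * m\<^sup>2) / qpoch Q Q (2 * m)) has_sum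
      qpoch_inf (Q ^ 8) (Q ^ 8) * qpoch_inf (- (Q ^ 3)) (Q ^ 8) * qpoch_inf (- (Q ^ 5)) (Q ^ 8) / ?P) UNIV"
    using has_sum_even_odd(1)[OF f1 f2] by simp
  have "((\<lambda>n. g (2 * n + 1)) has_sum s * (qpoch_inf (Q ^ 8) (Q ^ 8) * qpoch_inf (- (Q ^ 7)) (Q ^ 8) * qpoch_inf (- Q) (Q ^ 8))) UNIV"
  proof -
    \<comment> \<open>Here c = 14 and d = 2, giving Q^7 and Q. One factor s is left over; it also
      occurs in the odd terms of Euler's series and cancels at the end.\<close>
    have "2 * (2 * n + 1)\<^sup>2 - (2 * n + 1) = 1 + (int 8 * n\<^sup>2 + (int 14 - int 8) * n)" for n :: int
      by (simp add: power2_eq_square algebra_simps)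
    then have "g (2 * n + 1) = s * s powi (int 8 * n\<^sup>2 + (int 14 - int 8) * n)" for n
      using s(2) by (simp only: g_def power_int_add power_int_1_right simp_thms)
    then show ?thesis
      using has_sum_cmult_right[OF theta_sum[OF s, of 1 14 2 8], of s] s_even[of 8] s_even[of 7] s_even[of 1] by simp
  qed
  from has_sum_unique[OF has_sum_even_odd_int(2)[OF g1 g2] this]
  have "(?S - ?T) / 2 = s * (qpoch_inf (Q ^ 8) (Q ^ 8) * qpoch_inf (- (Q ^ 7)) (Q ^ 8) * qpoch_inf (- Q) (Q ^ 8) / ?P)"
    using P by (simp add: field_simps)
  moreover have "f (2 * n + 1) = s * (Q ^ (2 * n\<^sup>2 + 2 * n) / qpoch Q Q (2 * n + 1))" for n
  proof -
    have "(2 * n + 1)\<^sup>2 = 1 + 2 * (2 * n\<^sup>2 + 2 * n)"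
      by (simp add: power2_eq_square algebra_simps)
    then show ?thesis
      unfolding f_def by (simp only: s_even power_add power_one_right times_divide_eq_right)
  qed
  ultimately have "((\<lambda>m. s * (Q ^ (2 * m\<^sup>2 + 2 * m) / qpoch Q Q (2 * m + 1))) has_sum
      s * (qpoch_inf (Q ^ 8) (Q ^ 8) * qpoch_inf (- (Q ^ 7)) (Q ^ 8) * qpoch_inf (- Q) (Q ^ 8) / ?P)) UNIV"
    using has_sum_even_odd(2)[OF f1 f2] by simp
  from has_sum_cmult_right[OF this, of "1 / s"]
  show "((\<lambda>m. Q ^ (2 * m\<^sup>2 + 2 * m) / qpoch Q Q (2 * m + 1)) has_sum
      qpoch_inf (Q ^ 8) (Q ^ 8) * qpoch_inf (- (Q ^ 7)) (Q ^ 8) * qpoch_inf (- Q) (Q ^ 8) / ?P) UNIV"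
    using s(2) by simp
qed

section \<open>Bailey's lemma\<close>

text \<open>The q-binomial theorem for N = 2n + c, recentred by j = n + r. Completing the square in
  r^2 = (j - n)^2 forces y = - Q^(-2n), and the product splits into factors with negative and with
  positive odd exponents of Q.\<close>

lemma finite_triple_product:
  fixes Q :: complex
  assumes Q: "norm Q < 1" "Q \<noteq> 0" and c: "c = 0 \<or> c = 1"
  shows "((\<lambda>r. (- 1) powi r * Q powi (r\<^sup>2) * (qfact_recip (Q\<^sup>2) (int n + r) * qfact_recip (Q\<^sup>2) (int n + int c - r))) has_sum
    qpoch Q (Q\<^sup>2) n * qpoch Q (Q\<^sup>2) (n + c) / qpoch (Q\<^sup>2) (Q\<^sup>2) (2 * n + c)) UNIV"
proof -
  let ?P = "qpoch (Q\<^sup>2) (Q\<^sup>2)" and ?N = "2 * n + c"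
  define y where "y = - (Q powi (- 2 * int n))"
  \<comment> \<open>The half with negative exponents, reflected: pulling - Q^(-(2l+1)) out of each
    of the \<open>m\<close> factors yields (-1)^m Q^(-m^2), because the first m odd numbers add up
    to m^2.\<close>
  define h where "h m = (- 1) ^ m * Q ^ (m\<^sup>2) * (\<Prod>l<m. 1 - Q powi (2 * int l + 1 - 2 * int m))" for m
  have h: "h m = qpoch Q (Q\<^sup>2) m" for m
  proof (induction m)
    case (Suc m)
    have "h (Suc m) = (- 1) ^ Suc m * Q ^ ((Suc m)\<^sup>2) * ((1 - Q powi (- 1 - 2 * int m)) *
        (\<Prod>l<m. 1 - Q powi (2 * int l + 1 - 2 * int m)))"
      unfolding h_def prod.lessThan_Suc_shift by (simp add: algebra_simps)
    also have "\<dots> = h m * (- (Q ^ (2 * m + 1)) * (1 - Q powi (- 1 - 2 * int m)))"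
    proof -
      have "(Suc m)\<^sup>2 = m\<^sup>2 + (2 * m + 1)"
        by (simp add: power2_eq_square)
      then show ?thesis
        unfolding h_def by (simp only: power_add) simp
    qed
    also have "- (Q ^ (2 * m + 1)) * (1 - Q powi (- 1 - 2 * int m)) = 1 - Q * (Q\<^sup>2) ^ m"
    proof -
      have "Q ^ (2 * m + 1) * Q powi (- 1 - 2 * int m) = Q powi (int (2 * m + 1) + (- 1 - 2 * int m))"
        using Q(2) by (simp only: power_int_add power_int_of_nat simp_thms)
      then have "Q ^ (2 * m + 1) * Q powi (- 1 - 2 * int m) = 1"
        by simp
      moreover have "Q ^ (2 * m + 1) = Q * (Q\<^sup>2) ^ m"
        unfolding power_add power_mult by simp
      moreover have "- X * (1 - Y) = X * Y - X" for X Y :: complex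
        by (simp add: algebra_simps)
      ultimately show ?thesis
        by metis
    qed
    finally show ?case
      by (simp add: Suc qpoch_Suc)
  qed (simp add: h_def)
  have prod: "(- 1) ^ n * Q ^ (n\<^sup>2) * (\<Prod>l<?N. 1 + y * Q ^ (2 * l + 1)) = qpoch Q (Q\<^sup>2) n * qpoch Q (Q\<^sup>2) (n + c)"
  proof -
    have eq: "1 + y * Q ^ (2 * l + 1) = 1 - Q powi (2 * int l + 1 - 2 * int n)" for l
    proof -
      have "Q powi (- 2 * int n) * Q ^ (2 * l + 1) = Q powi (- 2 * int n + int (2 * l + 1))"
        using Q(2) by (simp only: power_int_add power_int_of_nat simp_thms)
      then show ?thesis
        by (simp add: y_def algebra_simps)
    qed
    have prod_split: "(\<Prod>l<n + k. g l) = (\<Prod>l<n. g l) * (\<Prod>l<k. g (l + n))" for g :: "nat \<Rightarrow> complex" and k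
      by (induction k) (simp_all add: add.commute mult.assoc)
    have "(\<Prod>l<n + (n + c). 1 + y * Q ^ (2 * l + 1)) =
        (\<Prod>l<n. 1 + y * Q ^ (2 * l + 1)) * (\<Prod>l<n + c. 1 + y * Q ^ (2 * (l + n) + 1))"
      by (rule prod_split)
    also have "(\<Prod>l<n + c. 1 + y * Q ^ (2 * (l + n) + 1)) = qpoch Q (Q\<^sup>2) (n + c)"
    proof -
      have "1 + y * Q ^ (2 * (l + n) + 1) = 1 - Q * (Q\<^sup>2) ^ l" for l
      proof -
        have "2 * int (l + n) + 1 - 2 * int n = int (2 * l + 1)"
          by simp
        then show ?thesis
          unfolding eq by (simp only: power_int_of_nat) (simp only: power_add power_mult, simp)
      qed
      then show ?thesis
        by (simp add: qpoch_def)
    qed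
    finally have split: "(\<Prod>l<n + (n + c). 1 + y * Q ^ (2 * l + 1)) =
      (\<Prod>l<n. 1 + y * Q ^ (2 * l + 1)) * qpoch Q (Q\<^sup>2) (n + c)" .
    have N: "?N = n + (n + c)"
      by simp
    have "(- 1) ^ n * Q ^ (n\<^sup>2) * (\<Prod>l<n. 1 + y * Q ^ (2 * l + 1)) = qpoch Q (Q\<^sup>2) n"
      using h[of n] unfolding h_def eq .
    then show ?thesis
      unfolding N split by (simp only: flip: mult.assoc)
  qed
  let ?f = "\<lambda>r. (- 1) powi r * Q powi (r\<^sup>2) * (qfact_recip (Q\<^sup>2) (int n + r) * qfact_recip (Q\<^sup>2) (int n + int c - r))"
  have "((\<lambda>j. ?f (int j - int n)) has_sum (qpoch Q (Q\<^sup>2) n * qpoch Q (Q\<^sup>2) (n + c) / ?P ?N)) {..?N}"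
  proof (rule has_sum_finiteI)
    have "(\<Sum>j\<le>?N. ?f (int j - int n)) =
        (\<Sum>j\<le>?N. (- 1) ^ n * Q ^ (n\<^sup>2) * (Q ^ (j\<^sup>2) * y ^ j * 1 ^ (?N - j) / (?P j * ?P (?N - j))))"
    proof (intro sum.cong refl)
      fix j assume "j \<in> {..?N}"
      then have 1: "int n + int c - (int j - int n) = int (?N - j)"
        by auto
      have 2: "int n + (int j - int n) = int j"
        by simp
      have 3: "Q powi ((int j - int n)\<^sup>2) = Q ^ (n\<^sup>2) * Q ^ (j\<^sup>2) * Q powi (- 2 * int n * int j)"
      proof -
        have "(int j - int n)\<^sup>2 = int (n\<^sup>2) + int (j\<^sup>2) + - 2 * int n * int j"
          by (simp add: power2_eq_square algebra_simps)
        then show ?thesis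
          using Q(2) by (simp only: power_int_add power_int_of_nat simp_thms)
      qed
      have 4: "(- 1 :: complex) powi (int j - int n) = (- 1) ^ n * (- 1) ^ j"
        by (cases "even n") (simp_all add: power_int_diff)
      have 5: "y ^ j = (- 1) ^ j * Q powi (- 2 * int n * int j)"
        unfolding y_def by (subst power_minus) (simp only: power_int_mult power_int_of_nat)
      show "?f (int j - int n) = (- 1) ^ n * Q ^ (n\<^sup>2) * (Q ^ (j\<^sup>2) * y ^ j * 1 ^ (?N - j) / (?P j * ?P (?N - j)))"
        unfolding 1 2 3 4 5 qfact_recip_of_nat by simp
    qed
    also have "\<dots> = (- 1) ^ n * Q ^ (n\<^sup>2) * ((\<Prod>l<?N. 1 + y * Q ^ (2 * l + 1)) / ?P ?N)"
      unfolding finite_q_binomial[OF Q(1), symmetric] by (simp add: sum_distrib_left)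
    finally show "qpoch Q (Q\<^sup>2) n * qpoch Q (Q\<^sup>2) (n + c) / ?P ?N = (\<Sum>j\<le>?N. ?f (int j - int n))"
      using prod by simp
  qed simp
  then have "(?f has_sum (qpoch Q (Q\<^sup>2) n * qpoch Q (Q\<^sup>2) (n + c) / ?P ?N)) ((\<lambda>j. int j - int n) ` {..?N})"
    by (subst has_sum_reindex) (auto simp: inj_on_def o_def)
  also have "?this \<longleftrightarrow> ?thesis"
  proof (rule has_sum_cong_neutral)
    fix r assume r: "r \<in> UNIV - (\<lambda>j. int j - int n) ` {..?N}"
    \<comment> \<open>The integers outside the image of {0..2n+c} are exactly those for which one
      reciprocal factorial vanishes.\<close>
    have "int n + r < 0 \<or> int n + int c - r < 0"
    proof (rule ccontr)
      assume "\<not> ?thesis"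
      then have "r = int (nat (int n + r)) - int n" "nat (int n + r) \<in> {..?N}"
        by auto
      with r show False
        by blast
    qed
    then show "?f r = 0"
      by (auto simp: qfact_recip_neg)
  qed auto
  finally show ?thesis .
qed

text \<open>One double series summed both ways. For fixed \<open>n\<close> the sum over
  \<open>r\<close> is the finite triple product; for fixed \<open>r\<close> the sum over
  \<open>n\<close> is the given \<open>h r\<close>. The shift \<open>c\<close> selects the pair
  relative to 1 or to the base, and \<open>d\<close> the linear exponent.\<close>

lemma bailey_sum:
  fixes Q :: complex and h :: "int \<Rightarrow> complex"
  assumes Q: "norm Q < 1" "Q \<noteq> 0" and c: "c = 0 \<or> c = 1"
  assumes h: "\<And>r. ((\<lambda>n. (Q\<^sup>2) powi (n\<^sup>2 + d * n) * (qfact_recip (Q\<^sup>2) (n + r) * qfact_recip (Q\<^sup>2) (n + int c - r))) has_sum h r) UNIV"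
  assumes S: "((\<lambda>r. (- 1) powi r * Q powi (r\<^sup>2) * h r) has_sum S) UNIV"
  shows "((\<lambda>n. (Q\<^sup>2) powi ((int n)\<^sup>2 + d * int n) * (qpoch Q (Q\<^sup>2) n * qpoch Q (Q\<^sup>2) (n + c) / qpoch (Q\<^sup>2) (Q\<^sup>2) (2 * n + c))) has_sum S) UNIV"
proof -
  have p: "norm (Q\<^sup>2) < 1" "Q\<^sup>2 \<noteq> 0"
    using norm_square_less_1[OF Q(1)] Q(2) by auto
  let ?w = "qfact_recip (Q\<^sup>2)"
  define f where "f = (\<lambda>(r, n). (- 1) powi r * Q powi (r\<^sup>2) * ((Q\<^sup>2) powi (n\<^sup>2 + d * n) * (?w (n + r) * ?w (n + int c - r))))"
  obtain C where C: "0 < C" "\<And>n. norm (?w n) \<le> C"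
    using qfact_recip_bounded[OF p(1)] by metis
  have "f summable_on UNIV \<times> UNIV"
  proof (rule summable_on_bounded_mult)
    show "(\<lambda>(r, n). (Q powi (r\<^sup>2) * (- 1) powi r) * ((Q\<^sup>2) powi (n\<^sup>2) * ((Q\<^sup>2) powi d) powi n)) summable_on UNIV \<times> UNIV"
      using Q p by (intro summable_on_product_complex summable_on_gauss_int) auto
    fix u :: "int \<times> int"
    obtain r n where u: "u = (r, n)"
      by (cases u)
    have e: "(Q\<^sup>2) powi (n\<^sup>2 + d * n) = (Q\<^sup>2) powi (n\<^sup>2) * ((Q\<^sup>2) powi d) powi n"
      using p(2) by (simp only: power_int_add power_int_mult simp_thms)
    have "norm (?w (n + r)) * norm (?w (n + int c - r)) \<le> C * C"
      using C(1) by (intro mult_mono[OF C(2) C(2)]) auto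
    from mult_right_mono[OF this, of "norm (Q powi (r\<^sup>2) * (- 1) powi r * ((Q\<^sup>2) powi (n\<^sup>2) * ((Q\<^sup>2) powi d) powi n))"]
    show "norm (f u) \<le> C * C * norm (case u of (r, n) \<Rightarrow> (Q powi (r\<^sup>2) * (- 1) powi r) * ((Q\<^sup>2) powi (n\<^sup>2) * ((Q\<^sup>2) powi d) powi n))"
      unfolding u f_def prod.case e by (simp add: norm_mult mult_ac)
  qed
  then obtain T where T: "(f has_sum T) (UNIV \<times> UNIV)"
    unfolding summable_on_def by blast
  have "((\<lambda>r. (- 1) powi r * Q powi (r\<^sup>2) * h r) has_sum T) UNIV"
    by (rule has_sum_SigmaD[OF T]) (simp add: f_def has_sum_cmult_right h)
  then have TS: "T = S"
    using S by (rule has_sum_unique)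
  have swapped: "((\<lambda>(n, r). f (r, n)) has_sum S) (UNIV \<times> UNIV)"
    using T unfolding TS by (subst (asm) has_sum_swap) simp
  have rows: "((\<lambda>r. f (r, n)) has_sum (if n < 0 then 0 else (Q\<^sup>2) powi (n\<^sup>2 + d * n) *
      (qpoch Q (Q\<^sup>2) (nat n) * qpoch Q (Q\<^sup>2) (nat n + c) / qpoch (Q\<^sup>2) (Q\<^sup>2) (2 * nat n + c)))) UNIV" for n
  proof (cases "n < 0")
    case True
    \<comment> \<open>The two indices add up to 2n + c, which is negative because n is at most -1
      and c at most 1.\<close>
    have "?w (n + r) * ?w (n + int c - r) = 0" for r
      using True c by (cases "n + r < 0") (auto simp: qfact_recip_neg)
    then have "(\<lambda>r. f (r, n)) = (\<lambda>_. 0)"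
      unfolding f_def by (simp add: fun_eq_iff)
    then show ?thesis
      using True by simp
  next
    case False
    then obtain m where m: "n = int m"
      by (metis nonneg_int_cases not_le)
    show ?thesis
      using has_sum_cmult_right[OF finite_triple_product[OF Q c, of m], of "(Q\<^sup>2) powi (n\<^sup>2 + d * n)"]
      by (simp add: f_def m mult_ac)
  qed
  have "((\<lambda>n. if n < 0 then 0 else (Q\<^sup>2) powi (n\<^sup>2 + d * n) *
      (qpoch Q (Q\<^sup>2) (nat n) * qpoch Q (Q\<^sup>2) (nat n + c) / qpoch (Q\<^sup>2) (Q\<^sup>2) (2 * nat n + c))) has_sum S) UNIV"
    by (rule has_sum_SigmaD[OF swapped]) (simp only: prod.case rows)
  then show ?thesis
    by (subst (asm) has_sum_int_nonneg) simp_all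
qed

text \<open>Write n^2 = r^2 + (n + r)(n - r) and use the two-shift Cauchy sum.\<close>

lemma cauchy_sum_square:
  fixes p :: complex
  assumes p: "norm p < 1" "p \<noteq> 0"
  shows "((\<lambda>n. p powi (n\<^sup>2) * (qfact_recip p (n + r) * qfact_recip p (n - r))) has_sum
    p powi (r\<^sup>2) / qpoch_inf p p) UNIV"
proof -
  have "((\<lambda>n. p powi (r\<^sup>2) * (p powi ((n + r) * (n + - r)) * (qfact_recip p (n + r) * qfact_recip p (n + - r)))) has_sum
      p powi (r\<^sup>2) * (1 / qpoch_inf p p)) UNIV"
    by (intro has_sum_cmult_right cauchy_sum_int p)
  also have "(\<lambda>n. p powi (r\<^sup>2) * (p powi ((n + r) * (n + - r)) * (qfact_recip p (n + r) * qfact_recip p (n + - r)))) =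
      (\<lambda>n. p powi (n\<^sup>2) * (qfact_recip p (n + r) * qfact_recip p (n - r)))"
  proof
    fix n
    have "n\<^sup>2 = r\<^sup>2 + (n + r) * (n + - r)"
      by (simp add: power2_eq_square algebra_simps)
    then have "p powi (n\<^sup>2) = p powi (r\<^sup>2) * p powi ((n + r) * (n + - r))"
      using p(2) by (simp only: power_int_add simp_thms)
    then show "p powi (r\<^sup>2) * (p powi ((n + r) * (n + - r)) * (qfact_recip p (n + r) * qfact_recip p (n + - r))) =
      p powi (n\<^sup>2) * (qfact_recip p (n + r) * qfact_recip p (n - r))"
      by simp
  qed
  finally show ?thesis
    by simp
qed

text \<open>Write n^2 + n = (r^2 - r) + (n + r)(n + 1 - r); the shifts are \<open>r\<close> and
  \<open>1 - r\<close>.\<close>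

lemma cauchy_sum_square_succ:
  fixes p :: complex
  assumes p: "norm p < 1" "p \<noteq> 0"
  shows "((\<lambda>n. p powi (n\<^sup>2 + n) * (qfact_recip p (n + r) * qfact_recip p (n + 1 - r))) has_sum
    p powi (r\<^sup>2 - r) / qpoch_inf p p) UNIV"
proof -
  have "((\<lambda>n. p powi (r\<^sup>2 - r) * (p powi ((n + r) * (n + (1 - r))) * (qfact_recip p (n + r) * qfact_recip p (n + (1 - r))))) has_sum
      p powi (r\<^sup>2 - r) * (1 / qpoch_inf p p)) UNIV"
    by (intro has_sum_cmult_right cauchy_sum_int p)
  also have "(\<lambda>n. p powi (r\<^sup>2 - r) * (p powi ((n + r) * (n + (1 - r))) * (qfact_recip p (n + r) * qfact_recip p (n + (1 - r))))) =
      (\<lambda>n. p powi (n\<^sup>2 + n) * (qfact_recip p (n + r) * qfact_recip p (n + 1 - r)))"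
  proof
    fix n
    have "n\<^sup>2 + n = (r\<^sup>2 - r) + (n + r) * (n + (1 - r))"
      by (simp add: power2_eq_square algebra_simps)
    then have "p powi (n\<^sup>2 + n) = p powi (r\<^sup>2 - r) * p powi ((n + r) * (n + (1 - r)))"
      using p(2) by (simp only: power_int_add simp_thms)
    then show "p powi (r\<^sup>2 - r) * (p powi ((n + r) * (n + (1 - r))) * (qfact_recip p (n + r) * qfact_recip p (n + (1 - r)))) =
      p powi (n\<^sup>2 + n) * (qfact_recip p (n + r) * qfact_recip p (n + 1 - r))"
      by (simp add: add_diff_eq)
  qed
  finally show ?thesis
    by simp
qed

text \<open>The exponent n^2 - n does not fit the shifts r and -r, so the summand is split by 1 =
  p^(n-r) + (1 - p^(n-r)). The first part is \<open>cauchy_sum_square\<close>; in the second the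
  factor lowers the index n - r by one, and (n + r)(n - 1 - r) = n^2 - n - r^2 - r fits. Hence two
  powers of p on the right.\<close>

lemma cauchy_sum_square_pred:
  fixes p :: complex
  assumes p: "norm p < 1" "p \<noteq> 0"
  shows "((\<lambda>n. p powi (n\<^sup>2 - n) * (qfact_recip p (n + r) * qfact_recip p (n - r))) has_sum
    (p powi (r\<^sup>2 - r) + p powi (r\<^sup>2 + r)) / qpoch_inf p p) UNIV"
proof -
  let ?w = "qfact_recip p"
  have "((\<lambda>n. p powi (- r) * (p powi (n\<^sup>2) * (?w (n + r) * ?w (n - r))) +
      p powi (r\<^sup>2 + r) * (p powi ((n + r) * (n + (- 1 - r))) * (?w (n + r) * ?w (n + (- 1 - r))))) has_sum
      p powi (- r) * (p powi (r\<^sup>2) / qpoch_inf p p) + p powi (r\<^sup>2 + r) * (1 / qpoch_inf p p)) UNIV"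
    by (intro has_sum_add has_sum_cmult_right cauchy_sum_int cauchy_sum_square p)
  also have "(\<lambda>n. p powi (- r) * (p powi (n\<^sup>2) * (?w (n + r) * ?w (n - r))) +
      p powi (r\<^sup>2 + r) * (p powi ((n + r) * (n + (- 1 - r))) * (?w (n + r) * ?w (n + (- 1 - r))))) =
      (\<lambda>n. p powi (n\<^sup>2 - n) * (?w (n + r) * ?w (n - r)))"
  proof
    fix n
    have 1: "p powi (r\<^sup>2 + r) * p powi ((n + r) * (n + (- 1 - r))) = p powi (n\<^sup>2 - n)"
    proof -
      have "n\<^sup>2 - n = (r\<^sup>2 + r) + (n + r) * (n + (- 1 - r))"
        by (simp add: power2_eq_square algebra_simps)
      then show ?thesis
        using p(2) by (simp only: power_int_add simp_thms)
    qed
    have 2: "p powi (- r) * p powi (n\<^sup>2) = p powi (n\<^sup>2 - n) * p powi (n - r)"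
    proof -
      have "- r + n\<^sup>2 = (n\<^sup>2 - n) + (n - r)"
        by simp
      then show ?thesis
        using p(2) by (metis power_int_add)
    qed
    have 3: "?w (n + (- 1 - r)) = (1 - p powi (n - r)) * ?w (n - r)"
      using qfact_recip_pred[OF p(1), of "n - r"] by (simp add: algebra_simps)
    show "p powi (- r) * (p powi (n\<^sup>2) * (?w (n + r) * ?w (n - r))) +
      p powi (r\<^sup>2 + r) * (p powi ((n + r) * (n + (- 1 - r))) * (?w (n + r) * ?w (n + (- 1 - r)))) =
      p powi (n\<^sup>2 - n) * (?w (n + r) * ?w (n - r))"
      unfolding mult.assoc[symmetric] 1 2 3 by (simp add: algebra_simps)
  qed
  also have "p powi (- r) * (p powi (r\<^sup>2) / qpoch_inf p p) + p powi (r\<^sup>2 + r) * (1 / qpoch_inf p p) =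
      (p powi (r\<^sup>2 - r) + p powi (r\<^sup>2 + r)) / qpoch_inf p p"
  proof -
    have "p powi (- r) * p powi (r\<^sup>2) = p powi (r\<^sup>2 - r)"
      using p(2) by (simp flip: power_int_add)
    then show ?thesis
      by (simp add: add_divide_distrib)
  qed
  finally show ?thesis .
qed

lemma square_powi: "(Q\<^sup>2) powi n = Q powi (2 * n)" for Q :: complex
  by (simp add: power_int_mult)

text \<open>The factor Q^(r^2) from the finite triple product joins Q^(2 r^2) from Cauchy's sum, so
  the outer series are theta functions with exponents 3 r^2 and 3 r^2 - 2 r or 3 r^2 + 2 r.\<close>

lemma bailey_sums:
  fixes Q :: complex
  assumes Q: "norm Q < 1" "Q \<noteq> 0"
  shows bailey_sum_square: "((\<lambda>n. Q ^ (2 * n\<^sup>2) * (qpoch Q (Q\<^sup>2) n * qpoch Q (Q\<^sup>2) n / qpoch (Q\<^sup>2) (Q\<^sup>2) (2 * n))) has_sum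
      qpoch_inf (Q ^ 6) (Q ^ 6) * qpoch_inf (Q ^ 3) (Q ^ 6) * qpoch_inf (Q ^ 3) (Q ^ 6) / qpoch_inf (Q\<^sup>2) (Q\<^sup>2)) UNIV"
    and bailey_sum_square_succ: "((\<lambda>n. Q ^ (2 * n\<^sup>2) * (Q\<^sup>2) ^ n * (qpoch Q (Q\<^sup>2) n * qpoch Q (Q\<^sup>2) (n + 1) / qpoch (Q\<^sup>2) (Q\<^sup>2) (2 * n + 1))) has_sum
      qpoch_inf (Q ^ 6) (Q ^ 6) * qpoch_inf Q (Q ^ 6) * qpoch_inf (Q ^ 5) (Q ^ 6) / qpoch_inf (Q\<^sup>2) (Q\<^sup>2)) UNIV"
    and bailey_sum_square_pred: "((\<lambda>n. Q ^ (2 * n\<^sup>2) * (1 / Q\<^sup>2) ^ n * (qpoch Q (Q\<^sup>2) n * qpoch Q (Q\<^sup>2) n / qpoch (Q\<^sup>2) (Q\<^sup>2) (2 * n))) has_sum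
      2 * (qpoch_inf (Q ^ 6) (Q ^ 6) * qpoch_inf Q (Q ^ 6) * qpoch_inf (Q ^ 5) (Q ^ 6)) / qpoch_inf (Q\<^sup>2) (Q\<^sup>2)) UNIV"
proof -
  have p: "norm (Q\<^sup>2) < 1" "Q\<^sup>2 \<noteq> 0"
    using norm_square_less_1[OF Q(1)] Q(2) by auto
  let ?P = "qpoch_inf (Q\<^sup>2) (Q\<^sup>2)"
  have theta0: "((\<lambda>r. (- 1) powi r * Q powi (3 * r\<^sup>2)) has_sum
      qpoch_inf (Q ^ 6) (Q ^ 6) * qpoch_inf (Q ^ 3) (Q ^ 6) * qpoch_inf (Q ^ 3) (Q ^ 6)) (UNIV :: int set)"
    using theta_sum[OF Q, of "- 1" 3 3 3] by simp
  have theta1: "((\<lambda>r. (- 1) powi r * Q powi (3 * r\<^sup>2 - 2 * r)) has_sum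
      qpoch_inf (Q ^ 6) (Q ^ 6) * qpoch_inf Q (Q ^ 6) * qpoch_inf (Q ^ 5) (Q ^ 6)) (UNIV :: int set)"
    using theta_sum[OF Q, of "- 1" 1 5 3] by simp
  \<comment> \<open>The reflection of \<open>theta1\<close> under r to -r, with the same value; this
    is the origin of the factor 2 in \<open>bailey_sum_square_pred\<close>.\<close>
  have theta2: "((\<lambda>r. (- 1) powi r * Q powi (3 * r\<^sup>2 + 2 * r)) has_sum
      qpoch_inf (Q ^ 6) (Q ^ 6) * qpoch_inf Q (Q ^ 6) * qpoch_inf (Q ^ 5) (Q ^ 6)) (UNIV :: int set)"
    using theta_sum[OF Q, of "- 1" 5 1 3] by (simp add: mult_ac)
  have merge: "Q powi m * Q powi n = Q powi (m + n)" for m n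
    using Q(2) by (simp add: power_int_add)
  have square_nat: "(Q\<^sup>2) powi ((int n)\<^sup>2 + d * int n) = Q ^ (2 * n\<^sup>2) * ((Q\<^sup>2) powi d) ^ n" for n d
  proof -
    have "(Q\<^sup>2) powi ((int n)\<^sup>2) = Q ^ (2 * n\<^sup>2)"
      by (simp only: power_mult power_int_of_nat flip: of_nat_power)
    then show ?thesis
      using p(2) by (simp only: power_int_add power_int_mult power_int_of_nat simp_thms)
  qed
  have "((\<lambda>r. (- 1) powi r * Q powi (r\<^sup>2) * ((Q\<^sup>2) powi (r\<^sup>2) / ?P)) has_sum
      qpoch_inf (Q ^ 6) (Q ^ 6) * qpoch_inf (Q ^ 3) (Q ^ 6) * qpoch_inf (Q ^ 3) (Q ^ 6) / ?P) UNIV"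
  proof -
    have eq: "(- 1) powi r * Q powi (r\<^sup>2) * ((Q\<^sup>2) powi (r\<^sup>2) / ?P) = (- 1) powi r * Q powi (3 * r\<^sup>2) / ?P" for r
      using merge[of "r\<^sup>2" "2 * r\<^sup>2"] by (simp add: square_powi mult.assoc)
    show ?thesis
      unfolding eq using has_sum_divide_const[OF theta0, of ?P] by simp
  qed
  then have "((\<lambda>n. (Q\<^sup>2) powi ((int n)\<^sup>2 + 0 * int n) * (qpoch Q (Q\<^sup>2) n * qpoch Q (Q\<^sup>2) (n + 0) / qpoch (Q\<^sup>2) (Q\<^sup>2) (2 * n + 0))) has_sum
      qpoch_inf (Q ^ 6) (Q ^ 6) * qpoch_inf (Q ^ 3) (Q ^ 6) * qpoch_inf (Q ^ 3) (Q ^ 6) / ?P) UNIV"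
    by (intro bailey_sum[OF Q, of 0 0 "\<lambda>r. (Q\<^sup>2) powi (r\<^sup>2) / ?P"]) (simp_all add: cauchy_sum_square[OF p])
  then show "((\<lambda>n. Q ^ (2 * n\<^sup>2) * (qpoch Q (Q\<^sup>2) n * qpoch Q (Q\<^sup>2) n / qpoch (Q\<^sup>2) (Q\<^sup>2) (2 * n))) has_sum
      qpoch_inf (Q ^ 6) (Q ^ 6) * qpoch_inf (Q ^ 3) (Q ^ 6) * qpoch_inf (Q ^ 3) (Q ^ 6) / ?P) UNIV"
    unfolding square_nat by simp
  have "((\<lambda>r. (- 1) powi r * Q powi (r\<^sup>2) * ((Q\<^sup>2) powi (r\<^sup>2 - r) / ?P)) has_sum
      qpoch_inf (Q ^ 6) (Q ^ 6) * qpoch_inf Q (Q ^ 6) * qpoch_inf (Q ^ 5) (Q ^ 6) / ?P) UNIV"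
  proof -
    have eq: "(- 1) powi r * Q powi (r\<^sup>2) * ((Q\<^sup>2) powi (r\<^sup>2 - r) / ?P) = (- 1) powi r * Q powi (3 * r\<^sup>2 - 2 * r) / ?P" for r
      using merge[of "r\<^sup>2" "2 * (r\<^sup>2 - r)"] by (simp add: square_powi mult.assoc)
    show ?thesis
      unfolding eq using has_sum_divide_const[OF theta1, of ?P] by simp
  qed
  then have "((\<lambda>n. (Q\<^sup>2) powi ((int n)\<^sup>2 + 1 * int n) * (qpoch Q (Q\<^sup>2) n * qpoch Q (Q\<^sup>2) (n + 1) / qpoch (Q\<^sup>2) (Q\<^sup>2) (2 * n + 1))) has_sum
      qpoch_inf (Q ^ 6) (Q ^ 6) * qpoch_inf Q (Q ^ 6) * qpoch_inf (Q ^ 5) (Q ^ 6) / ?P) UNIV"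
    by (intro bailey_sum[OF Q, of 1 1 "\<lambda>r. (Q\<^sup>2) powi (r\<^sup>2 - r) / ?P"])
       (simp_all add: cauchy_sum_square_succ[OF p])
  then show "((\<lambda>n. Q ^ (2 * n\<^sup>2) * (Q\<^sup>2) ^ n * (qpoch Q (Q\<^sup>2) n * qpoch Q (Q\<^sup>2) (n + 1) / qpoch (Q\<^sup>2) (Q\<^sup>2) (2 * n + 1))) has_sum
      qpoch_inf (Q ^ 6) (Q ^ 6) * qpoch_inf Q (Q ^ 6) * qpoch_inf (Q ^ 5) (Q ^ 6) / ?P) UNIV"
    unfolding square_nat by simp
  have "((\<lambda>r. (- 1) powi r * Q powi (r\<^sup>2) * (((Q\<^sup>2) powi (r\<^sup>2 - r) + (Q\<^sup>2) powi (r\<^sup>2 + r)) / ?P)) has_sum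
      2 * (qpoch_inf (Q ^ 6) (Q ^ 6) * qpoch_inf Q (Q ^ 6) * qpoch_inf (Q ^ 5) (Q ^ 6)) / ?P) UNIV"
  proof -
    have eq: "(- 1) powi r * Q powi (r\<^sup>2) * (((Q\<^sup>2) powi (r\<^sup>2 - r) + (Q\<^sup>2) powi (r\<^sup>2 + r)) / ?P) =
        ((- 1) powi r * Q powi (3 * r\<^sup>2 - 2 * r) + (- 1) powi r * Q powi (3 * r\<^sup>2 + 2 * r)) / ?P" for r
      using merge[of "r\<^sup>2" "2 * (r\<^sup>2 - r)"] merge[of "r\<^sup>2" "2 * (r\<^sup>2 + r)"]
      by (simp add: square_powi mult.assoc distrib_left)
    show ?thesis
      unfolding eq using has_sum_divide_const[OF has_sum_add[OF theta1 theta2], of ?P] by (simp add: mult_ac)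
  qed
  then have "((\<lambda>n. (Q\<^sup>2) powi ((int n)\<^sup>2 + - 1 * int n) * (qpoch Q (Q\<^sup>2) n * qpoch Q (Q\<^sup>2) (n + 0) / qpoch (Q\<^sup>2) (Q\<^sup>2) (2 * n + 0))) has_sum
      2 * (qpoch_inf (Q ^ 6) (Q ^ 6) * qpoch_inf Q (Q ^ 6) * qpoch_inf (Q ^ 5) (Q ^ 6)) / ?P) UNIV"
    by (intro bailey_sum[OF Q, of 0 "- 1" "\<lambda>r. ((Q\<^sup>2) powi (r\<^sup>2 - r) + (Q\<^sup>2) powi (r\<^sup>2 + r)) / ?P"])
       (simp_all add: cauchy_sum_square_pred[OF p])
  then show "((\<lambda>n. Q ^ (2 * n\<^sup>2) * (1 / Q\<^sup>2) ^ n * (qpoch Q (Q\<^sup>2) n * qpoch Q (Q\<^sup>2) n / qpoch (Q\<^sup>2) (Q\<^sup>2) (2 * n))) has_sum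
      2 * (qpoch_inf (Q ^ 6) (Q ^ 6) * qpoch_inf Q (Q ^ 6) * qpoch_inf (Q ^ 5) (Q ^ 6)) / ?P) UNIV"
    unfolding square_nat by (simp add: power_int_minus divide_inverse)
qed

section \<open>The sixteen sums\<close>

lemma qpoch_power_nonzero:
  fixes Q :: complex
  assumes "norm Q < 1" "0 < i" "0 < j"
  shows "qpoch (Q ^ i) (Q ^ j) n \<noteq> 0" "qpoch (- (Q ^ i)) (Q ^ j) n \<noteq> 0"
  using assms by (intro qpoch_nonzero norm_power_less_1; simp add: norm_power_less_1)+

lemma qpoch_odd: "qpoch a p (2 * m + 1) = (1 - a) * (qpoch (a * p) (p\<^sup>2) m * qpoch (a * p\<^sup>2) (p\<^sup>2) m)"
  using qpoch_Suc_shift[of a p "2 * m"] unfolding qpoch_even by (simp add: power2_eq_square mult.assoc)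

text \<open>Right-hand sides are products in powers of \<open>Q\<close>, while \<open>x\<close>,
  \<open>y\<close>, \<open>z\<close> need the square root \<open>q\<close> of it. Instantiating Q as
  the given nome or as its square serves the two families of identities.\<close>

locale nome =
  fixes q Q :: complex
  assumes q: "norm q < 1" "q \<noteq> 0" and Q: "Q = q\<^sup>2"
begin

lemma norm_Q: "norm Q < 1" and Q_nonzero: "Q \<noteq> 0"
  using norm_square_less_1[OF q(1)] q(2) by (auto simp: Q)

lemma norm_Q_power: "0 < n \<Longrightarrow> norm (Q ^ n) < 1"
  by (rule norm_power_less_1[OF norm_Q])

lemmas Q_qpoch_nonzero =
  qpoch_power_nonzero[OF norm_Q, of 1 1, simplified]
  qpoch_power_nonzero[OF norm_Q, of 2 1, simplified]
  qpoch_power_nonzero[OF norm_Q, of 1 2, simplified]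
  qpoch_power_nonzero[OF norm_Q, of 2 2, simplified]
  qpoch_power_nonzero[OF norm_Q, of 3 2, simplified]

lemma Q_inf_nonzero:
  "qpoch_inf Q Q \<noteq> 0" "qpoch_inf (- Q) Q \<noteq> 0" "qpoch_inf (Q\<^sup>2) (Q\<^sup>2) \<noteq> 0"
  using norm_Q norm_Q_power[of 2] by (simp_all add: qpoch_inf_nonzero_norm)

lemma Q_inf_square: "qpoch_inf (Q\<^sup>2) (Q\<^sup>2) = qpoch_inf Q Q * qpoch_inf (- Q) Q"
  by (rule qpoch_inf_square[OF norm_Q])

lemma Q_inf_minus: "qpoch_inf (- Q) Q = (1 + Q) * qpoch_inf (- (Q\<^sup>2)) Q"
  using qpoch_inf_rec[OF norm_Q, of "- Q"] by (simp add: power2_eq_square)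

lemma one_plus_Q_nonzero: "1 + Q \<noteq> 0"
  using Q_inf_minus Q_inf_nonzero by auto

text \<open>Here A = B = -Q^2 cancel, and (-Q;-Q)_(2m+1) = (1 + Q) (Q^2;Q^2)_m (-Q^3;Q^2)_m
  identifies the rest as \<open>slater_38\<close> at -Q. The factor 1 + Q completes the prefactor
  (-Q^2;Q)_inf to (-Q;Q)_inf.\<close>

lemma triple_sum_1:
  "(triple_term q (q ^ 3) (q ^ 6) (q ^ 4) has_sum
    qpoch_inf Q (Q ^ 8) * qpoch_inf (Q ^ 7) (Q ^ 8) * qpoch_inf (Q ^ 8) (Q ^ 8) / qpoch_inf Q Q) UNIV"
proof -
  let ?T = "qpoch_inf (Q ^ 8) (Q ^ 8) * qpoch_inf (Q ^ 7) (Q ^ 8) * qpoch_inf Q (Q ^ 8) / qpoch_inf (Q\<^sup>2) (Q\<^sup>2)"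
  have "((\<lambda>m. (1 + Q) * ((- Q) ^ (2 * m\<^sup>2 + 2 * m) / qpoch (- Q) (- Q) (2 * m + 1))) has_sum (1 + Q) * ?T) UNIV"
    using slater_38[of "- Q"] norm_Q Q_nonzero by (intro has_sum_cmult_right) simp
  also have "(\<lambda>m. (1 + Q) * ((- Q) ^ (2 * m\<^sup>2 + 2 * m) / qpoch (- Q) (- Q) (2 * m + 1))) =
      (\<lambda>m. Q ^ (2 * m\<^sup>2) * (Q\<^sup>2) ^ m * qpoch (- (Q\<^sup>2)) (Q\<^sup>2) m /
        (qpoch (Q\<^sup>2) (Q\<^sup>2) m * qpoch (- (Q\<^sup>2)) (Q\<^sup>2) m * qpoch (- (Q\<^sup>2) * Q) (Q\<^sup>2) m))"
  proof
    fix m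
    have "qpoch (- Q) (- Q) (2 * m + 1) = (1 + Q) * (qpoch (Q\<^sup>2) (Q\<^sup>2) m * qpoch (- (Q\<^sup>2) * Q) (Q\<^sup>2) m)"
      unfolding qpoch_odd by (simp add: power2_eq_square mult.assoc)
    moreover have "(- Q) ^ (2 * m\<^sup>2 + 2 * m) = Q ^ (2 * m\<^sup>2) * (Q\<^sup>2) ^ m"
      by (simp add: power_add power_mult)
    ultimately show "(1 + Q) * ((- Q) ^ (2 * m\<^sup>2 + 2 * m) / qpoch (- Q) (- Q) (2 * m + 1)) =
      Q ^ (2 * m\<^sup>2) * (Q\<^sup>2) ^ m * qpoch (- (Q\<^sup>2)) (Q\<^sup>2) m /
        (qpoch (Q\<^sup>2) (Q\<^sup>2) m * qpoch (- (Q\<^sup>2)) (Q\<^sup>2) m * qpoch (- (Q\<^sup>2) * Q) (Q\<^sup>2) m)"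
      using one_plus_Q_nonzero Q_qpoch_nonzero(8)[of m] by simp
  qed
  finally have "(triple_term q (q ^ 3) (q ^ 6) (Q\<^sup>2) has_sum qpoch_inf (- (Q\<^sup>2)) Q * ((1 + Q) * ?T)) UNIV"
    by (intro triple_sum_reduction_quotient[where A = "- (Q\<^sup>2)" and B = "- (Q\<^sup>2)" and Q = Q] q(1) Q Q_qpoch_nonzero)
       (simp_all add: Q flip: power_mult power_add power_Suc2)
  also have "qpoch_inf (- (Q\<^sup>2)) Q * ((1 + Q) * ?T) = qpoch_inf (- Q) Q * ?T"
    by (simp add: Q_inf_minus)
  also have "\<dots> = qpoch_inf Q (Q ^ 8) * qpoch_inf (Q ^ 7) (Q ^ 8) * qpoch_inf (Q ^ 8) (Q ^ 8) / qpoch_inf Q Q"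
    using Q_inf_nonzero by (simp add: Q_inf_square)
  also have "Q\<^sup>2 = q ^ 4"
    by (simp add: Q flip: power_mult)
  finally show ?thesis .
qed

text \<open>With A = -Q^2 and B = -Q, the symbol of A cancels that of BQ, leaving
  \<open>slater_39\<close> at -Q because (-Q;-Q)_(2m) = (-Q;Q^2)_m (Q^2;Q^2)_m.\<close>

lemma triple_sum_2:
  "(triple_term q q (q\<^sup>2) 1 has_sum
    qpoch_inf (Q ^ 3) (Q ^ 8) * qpoch_inf (Q ^ 5) (Q ^ 8) * qpoch_inf (Q ^ 8) (Q ^ 8) / qpoch_inf Q Q) UNIV"
proof -
  let ?T = "qpoch_inf (Q ^ 8) (Q ^ 8) * qpoch_inf (Q ^ 3) (Q ^ 8) * qpoch_inf (Q ^ 5) (Q ^ 8) / qpoch_inf (Q\<^sup>2) (Q\<^sup>2)"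
  have "((\<lambda>m. (- Q) ^ (2 * m\<^sup>2) / qpoch (- Q) (- Q) (2 * m)) has_sum ?T) UNIV"
    using slater_39[of "- Q"] norm_Q Q_nonzero by simp
  also have "(\<lambda>m. (- Q) ^ (2 * m\<^sup>2) / qpoch (- Q) (- Q) (2 * m)) =
      (\<lambda>m. Q ^ (2 * m\<^sup>2) * 1 ^ m * qpoch (- (Q\<^sup>2)) (Q\<^sup>2) m /
        (qpoch (Q\<^sup>2) (Q\<^sup>2) m * qpoch (- Q) (Q\<^sup>2) m * qpoch (- Q * Q) (Q\<^sup>2) m))"
  proof
    fix m
    have "qpoch (- Q) (- Q) (2 * m) = qpoch (- Q) (Q\<^sup>2) m * qpoch (Q\<^sup>2) (Q\<^sup>2) m"
      unfolding qpoch_even by (simp add: power2_eq_square)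
    moreover have "- Q * Q = - (Q\<^sup>2)"
      by (simp add: power2_eq_square)
    ultimately show "(- Q) ^ (2 * m\<^sup>2) / qpoch (- Q) (- Q) (2 * m) =
      Q ^ (2 * m\<^sup>2) * 1 ^ m * qpoch (- (Q\<^sup>2)) (Q\<^sup>2) m /
        (qpoch (Q\<^sup>2) (Q\<^sup>2) m * qpoch (- Q) (Q\<^sup>2) m * qpoch (- Q * Q) (Q\<^sup>2) m)"
      using Q_qpoch_nonzero(8)[of m] by simp
  qed
  finally have "(triple_term q q (q\<^sup>2) 1 has_sum qpoch_inf (- Q) Q * ?T) UNIV"
    by (intro triple_sum_reduction_quotient[where A = "- (Q\<^sup>2)" and B = "- Q" and Q = Q] q(1) Q Q_qpoch_nonzero)
       (simp_all add: Q power2_eq_square)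
  also have "qpoch_inf (- Q) Q * ?T = qpoch_inf (Q ^ 3) (Q ^ 8) * qpoch_inf (Q ^ 5) (Q ^ 8) * qpoch_inf (Q ^ 8) (Q ^ 8) / qpoch_inf Q Q"
    using Q_inf_nonzero by (simp add: Q_inf_square)
  finally show ?thesis .
qed

text \<open>With A = B = Q^2 the terms are, up to 1 - Q, the odd ones of Euler's series at t = 1/q.
  The full series is (-1;Q)_inf = 2 (-Q;Q)_inf and the alternating one is (1;Q)_inf = 0, so the odd
  part is (-Q;Q)_inf.\<close>

lemma triple_sum_3:
  "(triple_term q (- (q ^ 3)) (- (q ^ 4)) (q\<^sup>2) has_sum qpoch_inf (Q\<^sup>2) (Q\<^sup>2)) UNIV"
proof -
  define f where "f n = q ^ (n\<^sup>2) * (1 / q) ^ n / qpoch Q Q n" for n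
  have f1: "(f has_sum qpoch_inf (- 1) Q) UNIV"
    using euler_sum[OF q(1), of "1 / q"] q(2) by (simp add: f_def[abs_def] Q)
  have f2: "((\<lambda>n. (- 1) ^ n * f n) has_sum qpoch_inf 1 Q) UNIV"
  proof -
    have "(- 1 / q) ^ n = (- 1) ^ n * (1 / q) ^ n" for n
      by (simp flip: power_mult_distrib)
    then show ?thesis
      using euler_sum[OF q(1), of "- 1 / q"] q(2) by (simp add: f_def Q mult_ac)
  qed
  have "qpoch_inf (- 1) Q = 2 * qpoch_inf (- Q) Q"
    using qpoch_inf_rec[OF norm_Q, of "- 1"] by simp
  moreover have "qpoch_inf 1 Q = 0"
    using qpoch_inf_rec[OF norm_Q, of 1] by simp
  ultimately have "((\<lambda>m. (1 - Q) * f (2 * m + 1)) has_sum (1 - Q) * qpoch_inf (- Q) Q) UNIV"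
    using has_sum_cmult_right[OF has_sum_even_odd(2)[OF f1 f2], of "1 - Q"] by simp
  also have "(\<lambda>m. (1 - Q) * f (2 * m + 1)) =
      (\<lambda>m. Q ^ (2 * m\<^sup>2) * Q ^ m * qpoch (Q\<^sup>2) (Q\<^sup>2) m /
        (qpoch (Q\<^sup>2) (Q\<^sup>2) m * qpoch (Q\<^sup>2) (Q\<^sup>2) m * qpoch (Q\<^sup>2 * Q) (Q\<^sup>2) m))"
  proof
    fix m
    have "qpoch Q Q (2 * m + 1) = (1 - Q) * (qpoch (Q\<^sup>2) (Q\<^sup>2) m * qpoch (Q\<^sup>2 * Q) (Q\<^sup>2) m)"
      unfolding qpoch_odd by (simp add: power2_eq_square mult.assoc)
    moreover have "q ^ ((2 * m + 1)\<^sup>2) * (1 / q) ^ (2 * m + 1) = Q ^ (2 * m\<^sup>2) * Q ^ m"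
    proof -
      have "(2 * m + 1)\<^sup>2 = 2 * (2 * m\<^sup>2 + m) + (2 * m + 1)"
        by (simp add: power2_eq_square algebra_simps)
      then have "q ^ ((2 * m + 1)\<^sup>2) * (1 / q) ^ (2 * m + 1) = Q ^ (2 * m\<^sup>2 + m) * (q ^ (2 * m + 1) * (1 / q) ^ (2 * m + 1))"
        unfolding Q power_mult[symmetric] by (simp only: power_add mult.assoc)
      then show ?thesis
        using q(2) by (simp add: power_add power_one_over)
    qed
    moreover have "1 - Q \<noteq> 0"
      using norm_Q by auto
    ultimately show "(1 - Q) * f (2 * m + 1) = Q ^ (2 * m\<^sup>2) * Q ^ m * qpoch (Q\<^sup>2) (Q\<^sup>2) m /
        (qpoch (Q\<^sup>2) (Q\<^sup>2) m * qpoch (Q\<^sup>2) (Q\<^sup>2) m * qpoch (Q\<^sup>2 * Q) (Q\<^sup>2) m)"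
      using Q_qpoch_nonzero(7)[of m] unfolding f_def by simp
  qed
  finally have "(triple_term q (- (q ^ 3)) (- (q ^ 4)) Q has_sum qpoch_inf (Q\<^sup>2) Q * ((1 - Q) * qpoch_inf (- Q) Q)) UNIV"
    by (intro triple_sum_reduction_quotient[where A = "Q\<^sup>2" and B = "Q\<^sup>2" and Q = Q] q(1) Q Q_qpoch_nonzero)
       (simp_all add: Q flip: power_mult power_add power_Suc2)
  also have "qpoch_inf (Q\<^sup>2) Q * ((1 - Q) * qpoch_inf (- Q) Q) = qpoch_inf (Q\<^sup>2) (Q\<^sup>2)"
    unfolding Q_inf_square using qpoch_inf_rec[OF norm_Q, of Q] by (simp add: power2_eq_square)
  finally show ?thesis
    by (simp add: Q)
qed

text \<open>The two denominators combine to (Q^4;Q^4)_m, so this is Euler's series in base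
  Q^4.\<close>

lemma euler_sum_quartic:
  "((\<lambda>m. Q ^ (2 * m\<^sup>2) * a ^ m / (qpoch (Q\<^sup>2) (Q\<^sup>2) m * qpoch (- (Q\<^sup>2)) (Q\<^sup>2) m)) has_sum
    qpoch_inf (- a * Q\<^sup>2) (Q ^ 4)) UNIV"
proof -
  have "((\<lambda>m. (Q\<^sup>2) ^ (m\<^sup>2) * a ^ m / qpoch ((Q\<^sup>2)\<^sup>2) ((Q\<^sup>2)\<^sup>2) m) has_sum qpoch_inf (- a * Q\<^sup>2) ((Q\<^sup>2)\<^sup>2)) UNIV"
    by (intro euler_sum norm_Q_power) simp
  then show ?thesis
    unfolding qpoch_square by (simp flip: power_mult)
qed

text \<open>A = B = -Q cancel, and BQ = -Q^2 leaves \<open>euler_sum_quartic\<close>.\<close>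

lemma triple_sum_7:
  "(triple_term q q a a has_sum qpoch_inf (- Q) Q * qpoch_inf (- a * Q\<^sup>2) (Q ^ 4)) UNIV"
proof (rule triple_sum_reduction_quotient[where A = "- Q" and B = "- Q" and Q = Q])
  show "((\<lambda>m. Q ^ (2 * m\<^sup>2) * a ^ m * qpoch (- Q) (Q\<^sup>2) m /
        (qpoch (Q\<^sup>2) (Q\<^sup>2) m * qpoch (- Q) (Q\<^sup>2) m * qpoch (- Q * Q) (Q\<^sup>2) m)) has_sum
      qpoch_inf (- a * Q\<^sup>2) (Q ^ 4)) UNIV"
  proof -
    have "- Q * Q = - (Q\<^sup>2)"
      by (simp add: power2_eq_square)
    then show ?thesis
      using euler_sum_quartic[of a] Q_qpoch_nonzero(6) by simp
  qed
qed (use Q_qpoch_nonzero in \<open>auto simp: Q q power2_eq_square\<close>)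

text \<open>Here B = -Q^2, and A = -Q^3 = BQ cancels the other symbol than in the preceding
  sum.\<close>

lemma triple_sum_8:
  "(triple_term q (q ^ 3) (a * q ^ 4) a has_sum qpoch_inf (- (Q\<^sup>2)) Q * qpoch_inf (- a * Q\<^sup>2) (Q ^ 4)) UNIV"
proof (rule triple_sum_reduction_quotient[where A = "- (Q ^ 3)" and B = "- (Q\<^sup>2)" and Q = Q])
  show "((\<lambda>m. Q ^ (2 * m\<^sup>2) * a ^ m * qpoch (- (Q ^ 3)) (Q\<^sup>2) m /
        (qpoch (Q\<^sup>2) (Q\<^sup>2) m * qpoch (- (Q\<^sup>2)) (Q\<^sup>2) m * qpoch (- (Q\<^sup>2) * Q) (Q\<^sup>2) m)) has_sum
      qpoch_inf (- a * Q\<^sup>2) (Q ^ 4)) UNIV"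
  proof -
    have "- (Q\<^sup>2) * Q = - (Q ^ 3)"
      by (simp add: power2_eq_square power3_eq_cube)
    then show ?thesis
      using euler_sum_quartic[of a] Q_qpoch_nonzero(10) by simp
  qed
qed (use Q_qpoch_nonzero in \<open>simp_all add: Q q flip: power_mult power_add power_Suc2\<close>)

text \<open>A = B = -1 cancel, leaving \<open>slater_39\<close> at -Q; the factor 2 comes from
  (-1;Q)_inf = 2 (-Q;Q)_inf.\<close>

lemma triple_sum_9:
  "(triple_term q (1 / q) (1 / Q) 1 has_sum
    2 * (qpoch_inf (Q ^ 3) (Q ^ 8) * qpoch_inf (Q ^ 5) (Q ^ 8) * qpoch_inf (Q ^ 8) (Q ^ 8)) / qpoch_inf Q Q) UNIV"
proof -
  let ?T = "qpoch_inf (Q ^ 8) (Q ^ 8) * qpoch_inf (Q ^ 3) (Q ^ 8) * qpoch_inf (Q ^ 5) (Q ^ 8) / qpoch_inf (Q\<^sup>2) (Q\<^sup>2)"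
  \<comment> \<open>The argument -1 has norm 1, outside the scope of \<open>qpoch_nonzero\<close>,
    so the first factor 2 is split off.\<close>
  have nz: "qpoch (- 1) p n \<noteq> 0" if "norm p < 1" for p n
    using that by (cases n) (simp_all add: qpoch_Suc_shift qpoch_nonzero)
  have "((\<lambda>m. (- Q) ^ (2 * m\<^sup>2) / qpoch (- Q) (- Q) (2 * m)) has_sum ?T) UNIV"
    using slater_39[of "- Q"] norm_Q Q_nonzero by simp
  also have "(\<lambda>m. (- Q) ^ (2 * m\<^sup>2) / qpoch (- Q) (- Q) (2 * m)) =
      (\<lambda>m. Q ^ (2 * m\<^sup>2) * 1 ^ m * qpoch (- 1) (Q\<^sup>2) m /
        (qpoch (Q\<^sup>2) (Q\<^sup>2) m * qpoch (- 1) (Q\<^sup>2) m * qpoch (- 1 * Q) (Q\<^sup>2) m))"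
  proof
    fix m
    have "qpoch (- Q) (- Q) (2 * m) = qpoch (- Q) (Q\<^sup>2) m * qpoch (Q\<^sup>2) (Q\<^sup>2) m"
      unfolding qpoch_even by (simp add: power2_eq_square)
    then show "(- Q) ^ (2 * m\<^sup>2) / qpoch (- Q) (- Q) (2 * m) =
      Q ^ (2 * m\<^sup>2) * 1 ^ m * qpoch (- 1) (Q\<^sup>2) m /
        (qpoch (Q\<^sup>2) (Q\<^sup>2) m * qpoch (- 1) (Q\<^sup>2) m * qpoch (- 1 * Q) (Q\<^sup>2) m)"
      using nz[of "Q\<^sup>2" m] norm_Q_power[of 2] by simp
  qed
  finally have "(triple_term q (1 / q) (1 / Q) 1 has_sum qpoch_inf (- 1) Q * ?T) UNIV"
    by (intro triple_sum_reduction_quotient[where A = "- 1" and B = "- 1" and Q = Q] q(1) Q nz norm_Q)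
       (simp_all add: Q_nonzero q(2))
  also have "qpoch_inf (- 1) Q * ?T = 2 * (qpoch_inf (Q ^ 3) (Q ^ 8) * qpoch_inf (Q ^ 5) (Q ^ 8) * qpoch_inf (Q ^ 8) (Q ^ 8)) / qpoch_inf Q Q"
    using Q_inf_nonzero qpoch_inf_rec[OF norm_Q, of "- 1"] by (simp add: Q_inf_square)
  finally show ?thesis .
qed



section \<open>Sums evaluated by Bailey's lemma\<close>

lemma qpoch_Q2_even:
  "qpoch (Q\<^sup>2) (Q\<^sup>2) (2 * m) =
    qpoch Q (Q\<^sup>2) m * qpoch (- Q) (Q\<^sup>2) m * (qpoch (Q\<^sup>2) (Q\<^sup>2) m * qpoch (- (Q\<^sup>2)) (Q\<^sup>2) m)"
proof -
  have "Q\<^sup>2 * Q\<^sup>2 = (Q\<^sup>2)\<^sup>2"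
    by (simp add: power2_eq_square)
  then show ?thesis
    unfolding qpoch_even by (simp only: qpoch_square)
qed

lemma bailey_term:
  "qpoch Q (Q\<^sup>2) m * qpoch Q (Q\<^sup>2) m / qpoch (Q\<^sup>2) (Q\<^sup>2) (2 * m) =
    qpoch Q (Q\<^sup>2) m / (qpoch (Q\<^sup>2) (Q\<^sup>2) m * qpoch (- Q) (Q\<^sup>2) m * qpoch (- Q * Q) (Q\<^sup>2) m)"
proof -
  have "- Q * Q = - (Q\<^sup>2)"
    by (simp add: power2_eq_square)
  then show ?thesis
    using Q_qpoch_nonzero(5)[of m] unfolding qpoch_Q2_even by simp
qed

lemma bailey_term_succ:
  "(1 + Q) * (qpoch Q (Q\<^sup>2) m * qpoch Q (Q\<^sup>2) (m + 1) / qpoch (Q\<^sup>2) (Q\<^sup>2) (2 * m + 1)) =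
    qpoch Q (Q\<^sup>2) m / (qpoch (Q\<^sup>2) (Q\<^sup>2) m * qpoch (- (Q\<^sup>2)) (Q\<^sup>2) m * qpoch (- (Q\<^sup>2) * Q) (Q\<^sup>2) m)"
proof -
  have 1: "qpoch (Q\<^sup>2) (Q\<^sup>2) (2 * m + 1) =
      qpoch Q (Q\<^sup>2) (m + 1) * qpoch (- Q) (Q\<^sup>2) (m + 1) * (qpoch (Q\<^sup>2) (Q\<^sup>2) m * qpoch (- (Q\<^sup>2)) (Q\<^sup>2) m)"
  proof -
    have factor: "1 - Q\<^sup>2 * (Q\<^sup>2) ^ (2 * m) = (1 - Q * (Q\<^sup>2) ^ m) * (1 - - Q * (Q\<^sup>2) ^ m)"
    proof -
      have "(Q\<^sup>2) ^ (2 * m) = (Q\<^sup>2) ^ m * (Q\<^sup>2) ^ m"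
        by (simp add: mult_2 power_add)
      moreover have "1 - Q\<^sup>2 * (x * x) = (1 - Q * x) * (1 - - Q * x)" for x
        by (simp add: power2_eq_square algebra_simps)
      ultimately show ?thesis
        by metis
    qed
    show ?thesis
      unfolding Suc_eq_plus1[symmetric] qpoch_Suc qpoch_Q2_even factor by (simp only: mult_ac)
  qed
  have 2: "qpoch (- Q) (Q\<^sup>2) (m + 1) = (1 + Q) * qpoch (- (Q\<^sup>2) * Q) (Q\<^sup>2) m"
    by (simp add: qpoch_Suc_shift mult.commute)
  show ?thesis
    using Q_qpoch_nonzero(5)[of "m + 1"] one_plus_Q_nonzero unfolding 1 2 by simp
qed

text \<open>A = Q and B = -Q^2 give the summand of \<open>bailey_term_succ\<close>; the factor 1 + Q
  again completes (-Q^2;Q)_inf to (-Q;Q)_inf.\<close>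

lemma triple_sum_4:
  "(triple_term q (q ^ 3) (- (q ^ 4)) (q ^ 4) has_sum
    qpoch_inf Q (Q ^ 6) * qpoch_inf (Q ^ 5) (Q ^ 6) * qpoch_inf (Q ^ 6) (Q ^ 6) / qpoch_inf Q Q) UNIV"
proof -
  let ?T = "qpoch_inf (Q ^ 6) (Q ^ 6) * qpoch_inf Q (Q ^ 6) * qpoch_inf (Q ^ 5) (Q ^ 6) / qpoch_inf (Q\<^sup>2) (Q\<^sup>2)"
  have "(triple_term q (q ^ 3) (- (q ^ 4)) (Q\<^sup>2) has_sum qpoch_inf (- (Q\<^sup>2)) Q * ((1 + Q) * ?T)) UNIV"
  proof (rule triple_sum_reduction_quotient[where A = Q and B = "- (Q\<^sup>2)" and Q = Q])
    have "((\<lambda>m. (1 + Q) * (Q ^ (2 * m\<^sup>2) * (Q\<^sup>2) ^ m *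
        (qpoch Q (Q\<^sup>2) m * qpoch Q (Q\<^sup>2) (m + 1) / qpoch (Q\<^sup>2) (Q\<^sup>2) (2 * m + 1)))) has_sum (1 + Q) * ?T) UNIV"
      by (intro has_sum_cmult_right bailey_sum_square_succ norm_Q Q_nonzero)
    also have "(\<lambda>m. (1 + Q) * (Q ^ (2 * m\<^sup>2) * (Q\<^sup>2) ^ m *
        (qpoch Q (Q\<^sup>2) m * qpoch Q (Q\<^sup>2) (m + 1) / qpoch (Q\<^sup>2) (Q\<^sup>2) (2 * m + 1)))) =
      (\<lambda>m. Q ^ (2 * m\<^sup>2) * (Q\<^sup>2) ^ m * qpoch Q (Q\<^sup>2) m /
        (qpoch (Q\<^sup>2) (Q\<^sup>2) m * qpoch (- (Q\<^sup>2)) (Q\<^sup>2) m * qpoch (- (Q\<^sup>2) * Q) (Q\<^sup>2) m))"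
      unfolding mult.left_commute[of "1 + Q"] bailey_term_succ by simp
    finally show "((\<lambda>m. Q ^ (2 * m\<^sup>2) * (Q\<^sup>2) ^ m * qpoch Q (Q\<^sup>2) m /
        (qpoch (Q\<^sup>2) (Q\<^sup>2) m * qpoch (- (Q\<^sup>2)) (Q\<^sup>2) m * qpoch (- (Q\<^sup>2) * Q) (Q\<^sup>2) m)) has_sum (1 + Q) * ?T) UNIV" .
  qed (use Q_qpoch_nonzero in \<open>simp_all add: Q q flip: power_mult power_add power_Suc2\<close>)
  also have "qpoch_inf (- (Q\<^sup>2)) Q * ((1 + Q) * ?T) = qpoch_inf (- Q) Q * ?T"
    by (simp add: Q_inf_minus)
  also have "\<dots> = qpoch_inf Q (Q ^ 6) * qpoch_inf (Q ^ 5) (Q ^ 6) * qpoch_inf (Q ^ 6) (Q ^ 6) / qpoch_inf Q Q"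
    using Q_inf_nonzero by (simp add: Q_inf_square)
  also have "Q\<^sup>2 = q ^ 4"
    by (simp add: Q flip: power_mult)
  finally show ?thesis .
qed

text \<open>A = Q and B = -Q lead to \<open>bailey_sum_square_pred\<close>. Splitting (Q;Q)_inf
  modulo 6 cancels the classes 1, 5, 6 of the theta function and leaves 2, 3, 4 in the
  denominator.\<close>

lemma triple_sum_5:
  "(triple_term q q (- (1 / Q\<^sup>2)) (1 / Q\<^sup>2) has_sum
    2 / (qpoch_inf (Q\<^sup>2) (Q ^ 6) * qpoch_inf (Q ^ 3) (Q ^ 6) * qpoch_inf (Q ^ 4) (Q ^ 6))) UNIV"
proof -
  let ?T = "2 * (qpoch_inf (Q ^ 6) (Q ^ 6) * qpoch_inf Q (Q ^ 6) * qpoch_inf (Q ^ 5) (Q ^ 6)) / qpoch_inf (Q\<^sup>2) (Q\<^sup>2)"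
  have "(triple_term q q (- (1 / Q\<^sup>2)) (1 / Q\<^sup>2) has_sum qpoch_inf (- Q) Q * ?T) UNIV"
  proof (rule triple_sum_reduction_quotient[where A = Q and B = "- Q" and Q = Q])
    show "((\<lambda>m. Q ^ (2 * m\<^sup>2) * (1 / Q\<^sup>2) ^ m * qpoch Q (Q\<^sup>2) m /
        (qpoch (Q\<^sup>2) (Q\<^sup>2) m * qpoch (- Q) (Q\<^sup>2) m * qpoch (- Q * Q) (Q\<^sup>2) m)) has_sum ?T) UNIV"
      using bailey_sum_square_pred[OF norm_Q Q_nonzero] unfolding bailey_term times_divide_eq_right .
  qed (use Q_qpoch_nonzero in \<open>simp_all add: Q q power2_eq_square\<close>)
  also have "qpoch_inf (- Q) Q * ?T =
      2 * (qpoch_inf (Q ^ 6) (Q ^ 6) * qpoch_inf Q (Q ^ 6) * qpoch_inf (Q ^ 5) (Q ^ 6)) / qpoch_inf Q Q"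
    using Q_inf_nonzero by (simp add: Q_inf_square)
  also have "qpoch_inf Q Q = qpoch_inf Q (Q ^ 6) * qpoch_inf (Q\<^sup>2) (Q ^ 6) * qpoch_inf (Q ^ 3) (Q ^ 6) *
      qpoch_inf (Q ^ 4) (Q ^ 6) * qpoch_inf (Q ^ 5) (Q ^ 6) * qpoch_inf (Q ^ 6) (Q ^ 6)"
    using qpoch_inf_dissect[OF norm_Q, of 6 Q]
    by (simp add: eval_nat_numeral lessThan_Suc mult_ac flip: power_Suc)
  also have "2 * (qpoch_inf (Q ^ 6) (Q ^ 6) * qpoch_inf Q (Q ^ 6) * qpoch_inf (Q ^ 5) (Q ^ 6)) / \<dots> =
      2 / (qpoch_inf (Q\<^sup>2) (Q ^ 6) * qpoch_inf (Q ^ 3) (Q ^ 6) * qpoch_inf (Q ^ 4) (Q ^ 6))"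
  proof -
    have "qpoch_inf (Q ^ i) (Q ^ 6) \<noteq> 0" if "0 < i" for i
      using that by (intro qpoch_inf_nonzero_norm norm_Q_power) auto
    from this[of 1] this[of 5] this[of 6] show ?thesis
      by simp
  qed
  finally show ?thesis .
qed

lemma triple_sum_6:
  "(triple_term q q (- 1) 1 has_sum
    qpoch_inf (Q ^ 3) (Q ^ 6) * qpoch_inf (Q ^ 3) (Q ^ 6) * qpoch_inf (Q ^ 6) (Q ^ 6) / qpoch_inf Q Q) UNIV"
proof -
  let ?T = "qpoch_inf (Q ^ 6) (Q ^ 6) * qpoch_inf (Q ^ 3) (Q ^ 6) * qpoch_inf (Q ^ 3) (Q ^ 6) / qpoch_inf (Q\<^sup>2) (Q\<^sup>2)"
  have "(triple_term q q (- 1) 1 has_sum qpoch_inf (- Q) Q * ?T) UNIV"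
  proof (rule triple_sum_reduction_quotient[where A = Q and B = "- Q" and Q = Q])
    show "((\<lambda>m. Q ^ (2 * m\<^sup>2) * 1 ^ m * qpoch Q (Q\<^sup>2) m /
        (qpoch (Q\<^sup>2) (Q\<^sup>2) m * qpoch (- Q) (Q\<^sup>2) m * qpoch (- Q * Q) (Q\<^sup>2) m)) has_sum ?T) UNIV"
      using bailey_sum_square[OF norm_Q Q_nonzero] unfolding bailey_term times_divide_eq_right power_one mult_1_right .
  qed (use Q_qpoch_nonzero in \<open>simp_all add: Q q power2_eq_square\<close>)
  also have "qpoch_inf (- Q) Q * ?T =
      qpoch_inf (Q ^ 3) (Q ^ 6) * qpoch_inf (Q ^ 3) (Q ^ 6) * qpoch_inf (Q ^ 6) (Q ^ 6) / qpoch_inf Q Q"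
    using Q_inf_nonzero by (simp add: Q_inf_square)
  finally show ?thesis .
qed

section \<open>Terminating sums, Cauchy sums and the remaining theta sum\<close>

lemma qpoch_1: "0 < m \<Longrightarrow> qpoch 1 p m = 0"
  by (cases m) (simp_all add: qpoch_Suc_shift)

text \<open>Here A = 1, so only the term m = 0 survives, and \<open>b\<close> disappears with the
  others.\<close>

lemma triple_sum_10: "(triple_term q a (- b) (b * Q) has_sum qpoch_inf (- a * q) Q) UNIV"
proof (rule triple_sum_reduction_qpoch[OF q(1), of _ _ 1 "- a * q"])
  show "((\<lambda>m. q ^ (4 * m\<^sup>2) * (b * Q) ^ m * qpoch 1 (q ^ 4) m * qpoch_inf (- a * q * q ^ (4 * m)) (q\<^sup>2) /
      qpoch (q ^ 4) (q ^ 4) m) has_sum qpoch_inf (- a * q) Q) UNIV"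
    by (rule has_sum_finite_neutralI[of "{0}"]) (auto simp: qpoch_1 Q)
qed (auto simp: Q)

lemma triple_sum_14: "(triple_term q (- a / q) (- (a\<^sup>2) / Q\<^sup>2) (a\<^sup>2 / Q) has_sum qpoch_inf a Q) UNIV"
proof (rule triple_sum_reduction_qpoch[OF q(1), of _ _ 1 a])
  show "((\<lambda>m. q ^ (4 * m\<^sup>2) * (a\<^sup>2 / Q) ^ m * qpoch 1 (q ^ 4) m * qpoch_inf (a * q ^ (4 * m)) (q\<^sup>2) /
      qpoch (q ^ 4) (q ^ 4) m) has_sum qpoch_inf a Q) UNIV"
    by (rule has_sum_finite_neutralI[of "{0}"]) (auto simp: qpoch_1 Q)
qed (use q(2) in \<open>simp_all add: Q power2_eq_square\<close>)

text \<open>A = 1/Q^2 in base Q^2 has its zero factor at index 1, so the terms m = 0 and m = 1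
  survive. The coefficient Q^2 (1 - 1/Q^2) / (1 - Q^2) = -1 of the second gives the
  difference.\<close>

lemma triple_sum_15:
  "(triple_term q (- a / q) (- (1 / Q ^ 3)) 1 has_sum (qpoch_inf a Q - qpoch_inf (a * Q\<^sup>2) Q)) UNIV"
proof (rule triple_sum_reduction_qpoch[OF q(1), of _ _ "1 / Q\<^sup>2" a])
  have Q2: "q ^ 4 = Q\<^sup>2"
    by (simp add: Q flip: power_mult)
  let ?g = "\<lambda>m. q ^ (4 * m\<^sup>2) * 1 ^ m * qpoch (1 / Q\<^sup>2) (q ^ 4) m * qpoch_inf (a * q ^ (4 * m)) (q\<^sup>2) / qpoch (q ^ 4) (q ^ 4) m"
  show "(?g has_sum (qpoch_inf a Q - qpoch_inf (a * Q\<^sup>2) Q)) UNIV"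
  proof (rule has_sum_finite_neutralI[of "{0, 1}"])
    fix m :: nat assume "m \<in> UNIV - {0, 1}"
    then have "2 \<le> m"
      by auto
    then obtain n where "m = 2 + n"
      using le_Suc_ex by blast
    then have "qpoch (1 / Q\<^sup>2) (Q\<^sup>2) m = 0"
      using Q_nonzero by (simp add: qpoch_Suc_shift)
    then show "?g m = 0"
      by (simp add: Q2)
  next
    have "?g 1 = (Q\<^sup>2 * qpoch (1 / Q\<^sup>2) (Q\<^sup>2) 1 / qpoch (Q\<^sup>2) (Q\<^sup>2) 1) * qpoch_inf (a * Q\<^sup>2) Q"
      by (simp add: Q2 flip: Q)
    also have "Q\<^sup>2 * qpoch (1 / Q\<^sup>2) (Q\<^sup>2) 1 / qpoch (Q\<^sup>2) (Q\<^sup>2) 1 = - 1"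
    proof -
      have "1 - Q\<^sup>2 \<noteq> 0"
        using norm_Q_power[of 2] by auto
      moreover have "Q\<^sup>2 * (1 - 1 / Q\<^sup>2) = - (1 - Q\<^sup>2)"
        using Q_nonzero by (simp add: right_diff_distrib)
      ultimately show ?thesis
        by (simp add: qpoch_Suc divide_eq_minus_1_iff)
    qed
    finally show "qpoch_inf a Q - qpoch_inf (a * Q\<^sup>2) Q = sum ?g {0, 1}"
      by (simp flip: Q)
  qed auto
qed (use q(2) in \<open>simp_all add: Q power2_eq_square power3_eq_cube\<close>)

lemma cauchy_sum_Q:
  "((\<lambda>m. q ^ (4 * m\<^sup>2) * z ^ m * qpoch_inf (z * q ^ (4 * m + 4)) (q ^ 4) / qpoch (q ^ 4) (q ^ 4) m) has_sum 1) UNIV"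
proof -
  have eqs: "(q\<^sup>2) ^ (2 * m\<^sup>2) = q ^ (4 * m\<^sup>2)" "(q\<^sup>2) ^ (2 * m + 2) = q ^ (4 * m + 4)" "(q\<^sup>2)\<^sup>2 = q ^ 4" for m
    unfolding power_mult[symmetric] by (rule arg_cong[of _ _ "power q"]; simp)+
  show ?thesis
    using cauchy_sum[OF norm_Q[unfolded Q], of z] unfolding eqs .
qed

lemma Q_inf_even: "qpoch_inf x (q\<^sup>2) = qpoch_inf x (q ^ 4) * qpoch_inf (x * q\<^sup>2) (q ^ 4)"
  using qpoch_inf_even[OF norm_Q, of x] by (simp add: Q flip: power_mult)

lemma q4_inf_split: "qpoch x (q ^ 4) m * qpoch_inf (x * q ^ (4 * m)) (q ^ 4) = qpoch_inf x (q ^ 4)"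
  using qpoch_inf_split[OF norm_power_less_1[OF q(1)], of 4 x m] by (simp add: power_mult)

text \<open>With A = aq and B = a/q, splitting (B q^(4m); q^2)_inf in base q^4 gives (a q^(4m-1);
  q^4)_inf (a q^(4m+1); q^4)_inf. The second factor completes (A;q^4)_m to the constant
  (aq;q^4)_inf; the first is what Cauchy's sum needs at z = a/q^5.\<close>

lemma triple_sum_11:
  "(triple_term q (- a / Q) (- (a\<^sup>2) / Q ^ 3) (a / q ^ 5) has_sum qpoch_inf (a * q) (q ^ 4)) UNIV"
proof (rule triple_sum_reduction_qpoch[OF q(1), of _ _ "a * q" "a / q"])
  let ?z = "a / q ^ 5"
  have "((\<lambda>m. qpoch_inf (a * q) (q ^ 4) * (q ^ (4 * m\<^sup>2) * ?z ^ m * qpoch_inf (?z * q ^ (4 * m + 4)) (q ^ 4) / qpoch (q ^ 4) (q ^ 4) m))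
      has_sum qpoch_inf (a * q) (q ^ 4) * 1) UNIV"
    by (intro has_sum_cmult_right cauchy_sum_Q)
  also have "(\<lambda>m. qpoch_inf (a * q) (q ^ 4) * (q ^ (4 * m\<^sup>2) * ?z ^ m * qpoch_inf (?z * q ^ (4 * m + 4)) (q ^ 4) / qpoch (q ^ 4) (q ^ 4) m)) =
    (\<lambda>m. q ^ (4 * m\<^sup>2) * ?z ^ m * qpoch (a * q) (q ^ 4) m * qpoch_inf (a / q * q ^ (4 * m)) (q\<^sup>2) / qpoch (q ^ 4) (q ^ 4) m)"
  proof
    fix m
    have "?z * q ^ (4 * m + 4) = a / q * q ^ (4 * m)"
      using q(2) by (simp add: power_add eval_nat_numeral)
    moreover have "qpoch_inf (a * q) (q ^ 4) * qpoch_inf (a / q * q ^ (4 * m)) (q ^ 4) =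
        qpoch (a * q) (q ^ 4) m * qpoch_inf (a / q * q ^ (4 * m)) (q\<^sup>2)"
    proof -
      have "a / q * q ^ (4 * m) * q\<^sup>2 = a * q * q ^ (4 * m)"
        using q(2) by (simp add: power2_eq_square)
      then show ?thesis
        unfolding Q_inf_even[of "a / q * q ^ (4 * m)"] q4_inf_split[of "a * q" m, symmetric] by (simp only: mult_ac)
    qed
    ultimately show "qpoch_inf (a * q) (q ^ 4) * (q ^ (4 * m\<^sup>2) * ?z ^ m * qpoch_inf (?z * q ^ (4 * m + 4)) (q ^ 4) / qpoch (q ^ 4) (q ^ 4) m) =
      q ^ (4 * m\<^sup>2) * ?z ^ m * qpoch (a * q) (q ^ 4) m * qpoch_inf (a / q * q ^ (4 * m)) (q\<^sup>2) / qpoch (q ^ 4) (q ^ 4) m"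
      by (simp only: times_divide_eq_right mult.assoc mult.left_commute[of "qpoch_inf (a * q) (q ^ 4)"])
  qed
  finally show "((\<lambda>m. q ^ (4 * m\<^sup>2) * ?z ^ m * qpoch (a * q) (q ^ 4) m * qpoch_inf (a / q * q ^ (4 * m)) (q\<^sup>2) / qpoch (q ^ 4) (q ^ 4) m)
    has_sum qpoch_inf (a * q) (q ^ 4)) UNIV"
    by simp
qed (use q(2) in \<open>simp_all add: Q power2_eq_square eval_nat_numeral\<close>)

text \<open>Now A = B = aq. It is the first half (a q^(4m+1); q^4)_inf that completes (A;q^4)_m, and
  the other half, at a q^(4m+3), fits Cauchy's sum at z = a/q.\<close>

lemma triple_sum_13:
  "(triple_term q (- a) (- (a\<^sup>2) / Q) (a / q) has_sum qpoch_inf (a * q) (q ^ 4)) UNIV"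
proof (rule triple_sum_reduction_qpoch[OF q(1), of _ _ "a * q" "a * q"])
  let ?z = "a / q"
  have "((\<lambda>m. qpoch_inf (a * q) (q ^ 4) * (q ^ (4 * m\<^sup>2) * ?z ^ m * qpoch_inf (?z * q ^ (4 * m + 4)) (q ^ 4) / qpoch (q ^ 4) (q ^ 4) m))
      has_sum qpoch_inf (a * q) (q ^ 4) * 1) UNIV"
    by (intro has_sum_cmult_right cauchy_sum_Q)
  also have "(\<lambda>m. qpoch_inf (a * q) (q ^ 4) * (q ^ (4 * m\<^sup>2) * ?z ^ m * qpoch_inf (?z * q ^ (4 * m + 4)) (q ^ 4) / qpoch (q ^ 4) (q ^ 4) m)) =
    (\<lambda>m. q ^ (4 * m\<^sup>2) * ?z ^ m * qpoch (a * q) (q ^ 4) m * qpoch_inf (a * q * q ^ (4 * m)) (q\<^sup>2) / qpoch (q ^ 4) (q ^ 4) m)"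
  proof
    fix m
    have "?z * q ^ (4 * m + 4) = a * q * q ^ (4 * m) * q\<^sup>2"
      using q(2) by (simp add: power_add eval_nat_numeral)
    moreover have "qpoch_inf (a * q) (q ^ 4) * qpoch_inf (a * q * q ^ (4 * m) * q\<^sup>2) (q ^ 4) =
        qpoch (a * q) (q ^ 4) m * qpoch_inf (a * q * q ^ (4 * m)) (q\<^sup>2)"
      unfolding Q_inf_even[of "a * q * q ^ (4 * m)"] q4_inf_split[of "a * q" m, symmetric] by (simp only: mult_ac)
    ultimately show "qpoch_inf (a * q) (q ^ 4) * (q ^ (4 * m\<^sup>2) * ?z ^ m * qpoch_inf (?z * q ^ (4 * m + 4)) (q ^ 4) / qpoch (q ^ 4) (q ^ 4) m) =
      q ^ (4 * m\<^sup>2) * ?z ^ m * qpoch (a * q) (q ^ 4) m * qpoch_inf (a * q * q ^ (4 * m)) (q\<^sup>2) / qpoch (q ^ 4) (q ^ 4) m"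
      by (simp only: times_divide_eq_right mult.assoc mult.left_commute[of "qpoch_inf (a * q) (q ^ 4)"])
  qed
  finally show "((\<lambda>m. q ^ (4 * m\<^sup>2) * ?z ^ m * qpoch (a * q) (q ^ 4) m * qpoch_inf (a * q * q ^ (4 * m)) (q\<^sup>2) / qpoch (q ^ 4) (q ^ 4) m)
    has_sum qpoch_inf (a * q) (q ^ 4)) UNIV"
    by simp
qed (use q(2) in \<open>simp_all add: Q power2_eq_square\<close>)

lemma triple_sum_12:
  "(triple_term q (- (1 / q)) (- (1 / Q)) (1 / Q\<^sup>2) has_sum
    qpoch_inf (Q ^ 3) (Q ^ 8) * qpoch_inf (Q ^ 5) (Q ^ 8) * qpoch_inf (Q ^ 8) (Q ^ 8) *
      (qpoch_inf (Q\<^sup>2) (Q ^ 16) * qpoch_inf (Q ^ 14) (Q ^ 16))) UNIV"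
proof (rule triple_sum_reduction_qpoch[OF q(1), of _ _ "Q\<^sup>2" 1])
  let ?T = "qpoch_inf (Q ^ 8) (Q ^ 8) * qpoch_inf (- (Q ^ 7)) (Q ^ 8) * qpoch_inf (- Q) (Q ^ 8) / qpoch_inf (Q\<^sup>2) (Q\<^sup>2)"
  let ?f = "\<lambda>m. q ^ (4 * m\<^sup>2) * (1 / Q\<^sup>2) ^ m * qpoch (Q\<^sup>2) (q ^ 4) m * qpoch_inf (1 * q ^ (4 * m)) (q\<^sup>2) / qpoch (q ^ 4) (q ^ 4) m"
  have q4: "q ^ 4 = Q\<^sup>2" and q4m: "q ^ (4 * m) = Q ^ (2 * m)" for m
    unfolding Q power_mult[symmetric] by simp_all
  have "((\<lambda>m. qpoch_inf Q Q * (Q ^ (2 * m\<^sup>2 + 2 * m) / qpoch Q Q (2 * m + 1))) has_sum qpoch_inf Q Q * ?T) UNIV"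
    by (intro has_sum_cmult_right slater_38 norm_Q Q_nonzero)
  also have "(\<lambda>m. qpoch_inf Q Q * (Q ^ (2 * m\<^sup>2 + 2 * m) / qpoch Q Q (2 * m + 1))) = ?f \<circ> Suc"
  proof
    fix m
    have "qpoch_inf (1 * Q ^ (2 * Suc m)) Q = qpoch_inf Q Q / qpoch Q Q (2 * m + 1)"
      using qpoch_inf_split[OF norm_Q, of Q "2 * m + 1"] Q_qpoch_nonzero(1)[of "2 * m + 1"] by simp
    moreover have "Q ^ (2 * (Suc m)\<^sup>2) * (1 / Q\<^sup>2) ^ Suc m = Q ^ (2 * m\<^sup>2 + 2 * m)"
    proof -
      have "2 * (Suc m)\<^sup>2 = (2 * m\<^sup>2 + 2 * m) + 2 * Suc m"
        by (simp add: power2_eq_square)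
      then have "Q ^ (2 * (Suc m)\<^sup>2) * (1 / Q\<^sup>2) ^ Suc m = Q ^ (2 * m\<^sup>2 + 2 * m) * ((Q\<^sup>2) ^ Suc m * (1 / Q\<^sup>2) ^ Suc m)"
        by (simp only: power_add power_mult mult.assoc)
      also have "(Q\<^sup>2) ^ Suc m * (1 / Q\<^sup>2) ^ Suc m = 1"
        using Q_nonzero unfolding power_mult_distrib[symmetric] by simp
      finally show ?thesis
        by simp
    qed
    ultimately show "qpoch_inf Q Q * (Q ^ (2 * m\<^sup>2 + 2 * m) / qpoch Q Q (2 * m + 1)) = (?f \<circ> Suc) m"
      using Q_qpoch_nonzero(7)[of "Suc m"] unfolding o_def q4 q4m Q[symmetric] by simp
  qed
  also have "(?f \<circ> Suc has_sum qpoch_inf Q Q * ?T) UNIV \<longleftrightarrow> (?f has_sum qpoch_inf Q Q * ?T) (range Suc)"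
    by (rule has_sum_reindex[symmetric]) simp
  also have "\<dots> \<longleftrightarrow> (?f has_sum qpoch_inf Q Q * ?T) UNIV"
  proof (rule has_sum_cong_neutral)
    fix m :: nat assume "m \<in> UNIV - range Suc"
    then have "m = 0"
      by (cases m) auto
    moreover have "qpoch_inf 1 Q = 0"
      using qpoch_inf_rec[OF norm_Q, of 1] by simp
    ultimately show "?f m = 0"
      by (simp add: Q)
  qed auto
  also have "qpoch_inf Q Q * ?T = qpoch_inf Q (Q\<^sup>2) * qpoch_inf (- Q) (Q ^ 8) * qpoch_inf (- (Q ^ 7)) (Q ^ 8) * qpoch_inf (Q ^ 8) (Q ^ 8)"
    using qpoch_inf_even[OF norm_Q, of Q] Q_inf_nonzero(3) by (simp add: power2_eq_square)
  \<comment> \<open>The split modulo 8 exposes the classes 1 and 7, which pair with the factors at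
    -Q and -Q^7 by (x;p)_inf (-x;p)_inf = (x^2;p^2)_inf.\<close>
  also have "qpoch_inf Q (Q\<^sup>2) = qpoch_inf Q (Q ^ 8) * qpoch_inf (Q ^ 3) (Q ^ 8) * qpoch_inf (Q ^ 5) (Q ^ 8) * qpoch_inf (Q ^ 7) (Q ^ 8)"
  proof -
    have "qpoch_inf Q (Q\<^sup>2) = (\<Prod>r<4. qpoch_inf (Q * (Q\<^sup>2) ^ r) ((Q\<^sup>2) ^ 4))"
      by (intro qpoch_inf_dissect norm_Q_power) simp_all
    also have "(Q\<^sup>2) ^ 4 = Q ^ 8"
      by (simp flip: power_mult)
    finally show ?thesis
      by (simp add: lessThan_nat_numeral mult_ac flip: power_mult power_Suc)
  qed
  also have "qpoch_inf Q (Q ^ 8) * qpoch_inf (Q ^ 3) (Q ^ 8) * qpoch_inf (Q ^ 5) (Q ^ 8) * qpoch_inf (Q ^ 7) (Q ^ 8) *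
      qpoch_inf (- Q) (Q ^ 8) * qpoch_inf (- (Q ^ 7)) (Q ^ 8) * qpoch_inf (Q ^ 8) (Q ^ 8) =
      qpoch_inf (Q ^ 3) (Q ^ 8) * qpoch_inf (Q ^ 5) (Q ^ 8) * qpoch_inf (Q ^ 8) (Q ^ 8) *
      ((qpoch_inf Q (Q ^ 8) * qpoch_inf (- Q) (Q ^ 8)) * (qpoch_inf (Q ^ 7) (Q ^ 8) * qpoch_inf (- (Q ^ 7)) (Q ^ 8)))"
    by (simp only: mult_ac)
  also have "\<dots> = qpoch_inf (Q ^ 3) (Q ^ 8) * qpoch_inf (Q ^ 5) (Q ^ 8) * qpoch_inf (Q ^ 8) (Q ^ 8) *
      (qpoch_inf (Q\<^sup>2) (Q ^ 16) * qpoch_inf (Q ^ 14) (Q ^ 16))"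
    unfolding qpoch_inf_square[OF norm_Q_power[of 8, simplified], symmetric] by (simp flip: power_mult)
  finally show "(?f has_sum qpoch_inf (Q ^ 3) (Q ^ 8) * qpoch_inf (Q ^ 5) (Q ^ 8) * qpoch_inf (Q ^ 8) (Q ^ 8) *
      (qpoch_inf (Q\<^sup>2) (Q ^ 16) * qpoch_inf (Q ^ 14) (Q ^ 16))) UNIV" .
qed (use q(2) in \<open>simp_all add: Q power2_eq_square\<close>)

text \<open>A = B = Q cancel, leaving Q^(2m^2-2m) / (Q^2;Q^2)_m^2, the case r = 0 of
  \<open>cauchy_sum_square_pred\<close>; there the two powers on the right coincide and give the
  2.\<close>

lemma triple_sum_16:
  "(triple_term q (- q) (- (1 / Q\<^sup>2)) (1 / Q\<^sup>2) has_sum 2 * qpoch_inf Q (Q\<^sup>2)) UNIV"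
proof -
  have "(triple_term q (- q) (- (1 / Q\<^sup>2)) (1 / Q\<^sup>2) has_sum qpoch_inf Q Q * (2 / qpoch_inf (Q\<^sup>2) (Q\<^sup>2))) UNIV"
  proof (rule triple_sum_reduction_quotient[where A = Q and B = Q and Q = Q])
    have Q2: "Q\<^sup>2 \<noteq> 0"
      using Q_nonzero by simp
    have "((\<lambda>m. (Q\<^sup>2) powi (m\<^sup>2 - m) * (qfact_recip (Q\<^sup>2) m * qfact_recip (Q\<^sup>2) m)) has_sum 2 / qpoch_inf (Q\<^sup>2) (Q\<^sup>2)) UNIV"
      using cauchy_sum_square_pred[OF norm_Q_power Q2, of 0] by simp
    then have "((\<lambda>m. (Q\<^sup>2) powi ((int m)\<^sup>2 - int m) * (qfact_recip (Q\<^sup>2) (int m) * qfact_recip (Q\<^sup>2) (int m))) has_sum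
        2 / qpoch_inf (Q\<^sup>2) (Q\<^sup>2)) UNIV"
      by (subst (asm) has_sum_int_nonneg) (simp_all add: qfact_recip_neg)
    also have "(\<lambda>m. (Q\<^sup>2) powi ((int m)\<^sup>2 - int m) * (qfact_recip (Q\<^sup>2) (int m) * qfact_recip (Q\<^sup>2) (int m))) =
      (\<lambda>m. Q ^ (2 * m\<^sup>2) * (1 / Q\<^sup>2) ^ m * qpoch Q (Q\<^sup>2) m / (qpoch (Q\<^sup>2) (Q\<^sup>2) m * qpoch Q (Q\<^sup>2) m * qpoch (Q * Q) (Q\<^sup>2) m))"
    proof
      fix m
      have "(Q\<^sup>2) powi ((int m)\<^sup>2 - int m) = (Q\<^sup>2) powi (int (m\<^sup>2)) / (Q\<^sup>2) powi int m"
        using Q2 by (simp add: power_int_diff)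
      then have "(Q\<^sup>2) powi ((int m)\<^sup>2 - int m) = Q ^ (2 * m\<^sup>2) * (1 / Q\<^sup>2) ^ m"
        unfolding power_int_of_nat power_mult power_one_over by simp
      moreover have "Q * Q = Q\<^sup>2"
        by (simp add: power2_eq_square)
      ultimately show "(Q\<^sup>2) powi ((int m)\<^sup>2 - int m) * (qfact_recip (Q\<^sup>2) (int m) * qfact_recip (Q\<^sup>2) (int m)) =
        Q ^ (2 * m\<^sup>2) * (1 / Q\<^sup>2) ^ m * qpoch Q (Q\<^sup>2) m / (qpoch (Q\<^sup>2) (Q\<^sup>2) m * qpoch Q (Q\<^sup>2) m * qpoch (Q * Q) (Q\<^sup>2) m)"
        using Q_qpoch_nonzero(5)[of m] by simp
    qed
    finally show "((\<lambda>m. Q ^ (2 * m\<^sup>2) * (1 / Q\<^sup>2) ^ m * qpoch Q (Q\<^sup>2) m / (qpoch (Q\<^sup>2) (Q\<^sup>2) m * qpoch Q (Q\<^sup>2) m * qpoch (Q * Q) (Q\<^sup>2) m))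
      has_sum 2 / qpoch_inf (Q\<^sup>2) (Q\<^sup>2)) UNIV" .
  qed (use Q_qpoch_nonzero in \<open>simp_all add: Q q power2_eq_square\<close>)
  also have "qpoch_inf Q Q * (2 / qpoch_inf (Q\<^sup>2) (Q\<^sup>2)) = 2 * qpoch_inf Q (Q\<^sup>2)"
    using qpoch_inf_even[OF norm_Q, of Q] Q_inf_nonzero(3) by (simp add: power2_eq_square)
  finally show ?thesis .
qed

end

section \<open>Translation to the exponents of the sixteen identities\<close>

lemma triple_term_powi:
  fixes q :: complex
  assumes "q \<noteq> 0"
  shows "triple_term q (X * q powi \<alpha>) (Y * q powi \<beta>) (Z * q powi \<gamma>) = (\<lambda>(i, j, k). X ^ i * Y ^ j * Z ^ k *
    q powi (int (i^2 + 6*j^2 + 4*k^2 + 4*i*j + 4*i*k + 8*j*k) + \<alpha> * int i + \<beta> * int j + \<gamma> * int k)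
      / (qpoch (q^2) (q^2) i * qpoch (q^4) (q^4) j * qpoch (q^4) (q^4) k))"
proof -
  have "q ^ ((i + 2 * j + 2 * k)\<^sup>2 + 2 * j\<^sup>2) * (X * q powi \<alpha>) ^ i * (Y * q powi \<beta>) ^ j * (Z * q powi \<gamma>) ^ k =
      X ^ i * Y ^ j * Z ^ k *
      q powi (int (i^2 + 6*j^2 + 4*k^2 + 4*i*j + 4*i*k + 8*j*k) + \<alpha> * int i + \<beta> * int j + \<gamma> * int k)" for i j k
  proof -
    have "(i + 2 * j + 2 * k)\<^sup>2 + 2 * j\<^sup>2 = i^2 + 6*j^2 + 4*k^2 + 4*i*j + 4*i*k + 8*j*k"
      by (simp add: power2_eq_square algebra_simps)
    moreover have "(q powi \<delta>) ^ n = q powi (\<delta> * int n)" for \<delta> n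
      by (simp only: power_int_mult power_int_of_nat)
    ultimately show ?thesis
      using assms by (simp only: power_mult_distrib power_int_add power_int_of_nat simp_thms mult_ac)
  qed
  then show ?thesis
    by (simp add: triple_term_def)
qed

text \<open>At the square root s of q, linear exponents double. The coefficient of i stays odd, so
  that it combines with i^2 to an even exponent of s.\<close>

lemma triple_term_csqrt:
  fixes q :: complex
  shows "triple_term (csqrt q) (X * csqrt q ^ (2 * u + 1)) (Y * csqrt q ^ (2 * v)) (Z * csqrt q ^ (2 * w)) = (\<lambda>(i, j, k). X ^ i * Y ^ j * Z ^ k *
    q ^ ((i^2 + (2 * u + 1)*i) div 2 + 3*j^2 + 2*k^2 + 2*i*j + 2*i*k + 4*j*k + v * j + w * k)
      / (qpoch q q i * qpoch (q^2) (q^2) j * qpoch (q^2) (q^2) k))"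
proof -
  define s where "s = csqrt q"
  have s: "s\<^sup>2 = q" "s ^ 4 = q\<^sup>2"
    unfolding s_def using power_mult[of "csqrt q" 2 2] by simp_all
  have "s ^ ((i + 2 * j + 2 * k)\<^sup>2 + 2 * j\<^sup>2) * (X * s ^ (2 * u + 1)) ^ i * (Y * s ^ (2 * v)) ^ j * (Z * s ^ (2 * w)) ^ k =
      X ^ i * Y ^ j * Z ^ k *
      q ^ ((i^2 + (2 * u + 1)*i) div 2 + 3*j^2 + 2*k^2 + 2*i*j + 2*i*k + 4*j*k + v * j + w * k)" (is "?L = _ * q ^ ?e") for i j k
  proof -
    \<comment> \<open>The numbers i^2 and (2u+1) i have equal parity, so the \<open>div\<close> is
      exact.\<close>
    have "2 * ((i^2 + (2 * u + 1)*i) div 2) = i^2 + (2 * u + 1)*i"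
      by (intro dvd_mult_div_cancel) auto
    then have e: "(i + 2 * j + 2 * k)\<^sup>2 + 2 * j\<^sup>2 + (2 * u + 1) * i + (2 * v) * j + (2 * w) * k = 2 * ?e"
      by (simp add: power2_eq_square algebra_simps)
    have "?L = X ^ i * Y ^ j * Z ^ k * s ^ ((i + 2 * j + 2 * k)\<^sup>2 + 2 * j\<^sup>2 + (2 * u + 1) * i + (2 * v) * j + (2 * w) * k)"
    proof -
      have "s ^ n * (X * s ^ d) ^ i * (Y * s ^ e) ^ j * (Z * s ^ f) ^ k = X ^ i * Y ^ j * Z ^ k * s ^ (n + d * i + e * j + f * k)"
        for n d e f
        by (simp add: power_mult_distrib power_add mult_ac flip: power_mult)
      then show ?thesis .
    qed
    then show ?thesis
      unfolding e power_mult s .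
  qed
  then show ?thesis
    unfolding s_def[symmetric] by (simp add: triple_term_def s)
qed

theorem theorem4p3:
  fixes q a b :: complex
  assumes "0 < norm q" and "norm q < 1"
  shows "
    (((\<lambda>(i, j, k). q ^ ((i^2 + 3*i) div 2 + 3*j^2 + 2*k^2 + 2*i*j + 2*i*k + 4*j*k + 3*j + 2*k)
        / (qpoch q q i * qpoch (q^2) (q^2) j * qpoch (q^2) (q^2) k))
      has_sum (qpochs_inf [q, q^7, q^8] (q^8) / qpoch_inf q q)) UNIV) \<and>
    (((\<lambda>(i, j, k). q ^ ((i^2 + i) div 2 + 3*j^2 + 2*k^2 + 2*i*j + 2*i*k + 4*j*k + j)
        / (qpoch q q i * qpoch (q^2) (q^2) j * qpoch (q^2) (q^2) k))
      has_sum (qpochs_inf [q^3, q^5, q^8] (q^8) / qpoch_inf q q)) UNIV) \<and>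
    (((\<lambda>(i, j, k). (-1) ^ (i + j) * q ^ ((i^2 + 3*i) div 2 + 3*j^2 + 2*k^2 + 2*i*j + 2*i*k + 4*j*k + 2*j + k)
        / (qpoch q q i * qpoch (q^2) (q^2) j * qpoch (q^2) (q^2) k))
      has_sum qpoch_inf (q^2) (q^2)) UNIV) \<and>
    (((\<lambda>(i, j, k). (-1) ^ j * q ^ ((i^2 + 3*i) div 2 + 3*j^2 + 2*k^2 + 2*i*j + 2*i*k + 4*j*k + 2*j + 2*k)
        / (qpoch q q i * qpoch (q^2) (q^2) j * qpoch (q^2) (q^2) k))
      has_sum (qpochs_inf [q, q^5, q^6] (q^6) / qpoch_inf q q)) UNIV) \<and>
    (((\<lambda>(i, j, k). (-1) ^ j * q powi (int (i^2 + 6*j^2 + 4*k^2 + 4*i*j + 4*i*k + 8*j*k) + int i - 4 * int j - 4 * int k)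
        / (qpoch (q^2) (q^2) i * qpoch (q^4) (q^4) j * qpoch (q^4) (q^4) k))
      has_sum (2 / qpochs_inf [q^4, q^6, q^8] (q^12))) UNIV) \<and>
    (((\<lambda>(i, j, k). (-1) ^ j * q powi (int (i^2 + 6*j^2 + 4*k^2 + 4*i*j + 4*i*k + 8*j*k) + int i)
        / (qpoch (q^2) (q^2) i * qpoch (q^4) (q^4) j * qpoch (q^4) (q^4) k))
      has_sum (qpochs_inf [q^6, q^6, q^12] (q^12) / qpoch_inf (q^2) (q^2))) UNIV) \<and>
    (((\<lambda>(i, j, k). q ^ ((i^2 + i) div 2 + 3*j^2 + 2*k^2 + 2*i*j + 2*i*k + 4*j*k) * a ^ (j + k)
        / (qpoch q q i * qpoch (q^2) (q^2) j * qpoch (q^2) (q^2) k))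
      has_sum (qpoch_inf (-q) q * qpoch_inf (-a * q^2) (q^4))) UNIV) \<and>
    (((\<lambda>(i, j, k). q ^ ((i^2 + 3*i) div 2 + 3*j^2 + 2*k^2 + 2*i*j + 2*i*k + 4*j*k + 2*j) * a ^ (j + k)
        / (qpoch q q i * qpoch (q^2) (q^2) j * qpoch (q^2) (q^2) k))
      has_sum (qpoch_inf (-(q^2)) q * qpoch_inf (-a * q^2) (q^4))) UNIV) \<and>
    (((\<lambda>(i, j, k). q powi (int (i^2 + 6*j^2 + 4*k^2 + 4*i*j + 4*i*k + 8*j*k) - int i - 2 * int j)
        / (qpoch (q^2) (q^2) i * qpoch (q^4) (q^4) j * qpoch (q^4) (q^4) k))
      has_sum (2 * qpochs_inf [q^6, q^10, q^16] (q^16) / qpoch_inf (q^2) (q^2))) UNIV) \<and>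
    (((\<lambda>(i, j, k). (-1) ^ j * q powi (int (i^2 + 6*j^2 + 4*k^2 + 4*i*j + 4*i*k + 8*j*k) + 2 * int k) * a ^ i * b ^ (j + k)
        / (qpoch (q^2) (q^2) i * qpoch (q^4) (q^4) j * qpoch (q^4) (q^4) k))
      has_sum qpoch_inf (-a * q) (q^2)) UNIV) \<and>
    (((\<lambda>(i, j, k). (-1) ^ (i + j) * q powi (int (i^2 + 6*j^2 + 4*k^2 + 4*i*j + 4*i*k + 8*j*k) - 2 * int i - 6 * int j - 5 * int k) * a ^ (i + 2*j + k)
        / (qpoch (q^2) (q^2) i * qpoch (q^4) (q^4) j * qpoch (q^4) (q^4) k))
      has_sum qpoch_inf (a * q) (q^4)) UNIV) \<and>
    (((\<lambda>(i, j, k). (-1) ^ (i + j) * q powi (int (i^2 + 6*j^2 + 4*k^2 + 4*i*j + 4*i*k + 8*j*k) - int i - 2 * int j - 4 * int k)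
        / (qpoch (q^2) (q^2) i * qpoch (q^4) (q^4) j * qpoch (q^4) (q^4) k))
      has_sum (qpochs_inf [q^6, q^10, q^16] (q^16) * qpochs_inf [q^4, q^28] (q^32))) UNIV) \<and>
    (((\<lambda>(i, j, k). (-1) ^ (i + j) * q powi (int (i^2 + 6*j^2 + 4*k^2 + 4*i*j + 4*i*k + 8*j*k) - 2 * int j - int k) * a ^ (i + 2*j + k)
        / (qpoch (q^2) (q^2) i * qpoch (q^4) (q^4) j * qpoch (q^4) (q^4) k))
      has_sum qpoch_inf (a * q) (q^4)) UNIV) \<and>
    (((\<lambda>(i, j, k). (-1) ^ (i + j) * q powi (int (i^2 + 6*j^2 + 4*k^2 + 4*i*j + 4*i*k + 8*j*k) - int i - 4 * int j - 2 * int k) * a ^ (i + 2*j + 2*k)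
        / (qpoch (q^2) (q^2) i * qpoch (q^4) (q^4) j * qpoch (q^4) (q^4) k))
      has_sum qpoch_inf a (q^2)) UNIV) \<and>
    (((\<lambda>(i, j, k). (-1) ^ (i + j) * q powi (int (i^2 + 6*j^2 + 4*k^2 + 4*i*j + 4*i*k + 8*j*k) - int i - 6 * int j) * a ^ i
        / (qpoch (q^2) (q^2) i * qpoch (q^4) (q^4) j * qpoch (q^4) (q^4) k))
      has_sum (qpoch_inf a (q^2) - qpoch_inf (a * q^4) (q^2))) UNIV) \<and>
    (((\<lambda>(i, j, k). (-1) ^ (i + j) * q powi (int (i^2 + 6*j^2 + 4*k^2 + 4*i*j + 4*i*k + 8*j*k) + int i - 4 * int j - 4 * int k)
        / (qpoch (q^2) (q^2) i * qpoch (q^4) (q^4) j * qpoch (q^4) (q^4) k))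
      has_sum (2 * qpoch_inf (q^2) (q^4))) UNIV)"
proof (intro conjI, goal_cases)
  have q: "norm q < 1" "q \<noteq> 0"
    using assms by auto
  define s where "s = csqrt q"
  \<comment> \<open>Instance \<open>A\<close> has nome q and square root s, for the identities with
    half-integral coefficients; instance \<open>B\<close> has nome q^2 and square root q, for the
    others.\<close>
  interpret A: nome s q
    using q norm_csqrt_less_1[of q] by unfold_locales (auto simp: s_def)
  interpret B: nome q "q\<^sup>2"
    using q by unfold_locales auto
  note first = triple_term_csqrt[of q, folded s_def]
  note second = triple_term_powi[OF q(2)]
  have minus_power: "(- x) ^ n = (- 1) ^ n * x ^ n" for x :: complex and n
    by (rule power_minus)
  have powi: "q powi (- 1) = 1 / q" "q powi (- 2) = 1 / q\<^sup>2" "q powi (- 3) = 1 / q ^ 3" "q powi (- 4) = 1 / q ^ 4"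
      "q powi (- 5) = 1 / q ^ 5" "q powi (- 6) = 1 / q ^ 6"
    by (simp_all add: power_int_minus divide_inverse)
  {
    case 1
    show ?case
      using A.triple_sum_1 first[of 1 1 1 3 1 2] by (simp add: qpochs_inf_def mult.assoc)
  next
    case 2
    show ?case
      using A.triple_sum_2 first[of 1 0 1 1 1 0] by (simp add: qpochs_inf_def mult.assoc)
  next
    case 3
    show ?case
      using A.triple_sum_3 first[of "- 1" 1 "- 1" 2 1 1] by (simp add: power_add)
  next
    case 4
    show ?case
      using A.triple_sum_4 first[of 1 1 "- 1" 2 1 2] by (simp add: qpochs_inf_def mult.assoc)
  next
    case 5
    show ?case
      using B.triple_sum_5 second[of 1 1 "- 1" "- 4" 1 "- 4"] by (simp add: powi inverse_eq_divide qpochs_inf_def mult.assoc flip: power_mult)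
  next
    case 6
    show ?case
      using B.triple_sum_6 second[of 1 1 "- 1" 0 1 0] by (simp add: qpochs_inf_def mult.assoc flip: power_mult)
  next
    case 7
    show ?case
      using A.triple_sum_7[of a] first[of 1 0 a 0 a 0] by (simp add: power_add mult_ac)
  next
    case 8
    show ?case
      using A.triple_sum_8[of a] first[of 1 1 a 2 a 0] by (simp add: power_add mult_ac)
  next
    case 9
    show ?case
      using B.triple_sum_9 second[of 1 "- 1" 1 "- 2" 1 0] by (simp add: powi inverse_eq_divide qpochs_inf_def mult.assoc flip: power_mult)
  next
    case 10
    show ?case
      using B.triple_sum_10[of a b] second[of a 0 "- b" 0 b 2] by (simp add: minus_power[of b] power_add mult_ac)
  next
    case 11
    show ?case
      using B.triple_sum_11[of a] second[of "- a" "- 2" "- (a\<^sup>2)" "- 6" a "- 5"]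
      by (simp add: powi inverse_eq_divide minus_power[of a] minus_power[of "a\<^sup>2"] power_add mult_ac flip: power_mult)
  next
    case 12
    show ?case
      using B.triple_sum_12 second[of "- 1" "- 1" "- 1" "- 2" 1 "- 4"]
      by (simp add: powi inverse_eq_divide qpochs_inf_def power_add mult_ac flip: power_mult)
  next
    case 13
    show ?case
      using B.triple_sum_13[of a] second[of "- a" 0 "- (a\<^sup>2)" "- 2" a "- 1"]
      by (simp add: powi inverse_eq_divide minus_power[of a] minus_power[of "a\<^sup>2"] power_add mult_ac flip: power_mult)
  next
    case 14
    show ?case
      using B.triple_sum_14[of a] second[of "- a" "- 1" "- (a\<^sup>2)" "- 4" "a\<^sup>2" "- 2"]
      by (simp add: powi inverse_eq_divide minus_power[of a] minus_power[of "a\<^sup>2"] power_add mult_ac flip: power_mult)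
  next
    case 15
    show ?case
      using B.triple_sum_15[of a] second[of "- a" "- 1" "- 1" "- 6" 1 0]
      by (simp add: powi inverse_eq_divide minus_power[of a] power_add mult_ac flip: power_mult)
  next
    case 16
    show ?case
      using B.triple_sum_16 second[of "- 1" 1 "- 1" "- 4" 1 "- 4"]
      by (simp add: powi inverse_eq_divide power_add mult_ac flip: power_mult)
  }
qed

end
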